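(* Let $\mathcal{E}=\{E_L\}_{L\ge 1}$ be a sequence of measurable subsets of $\mathbb{S}^d$ that is relatively dense, and let $\omega\in RH_\infty$. Then there is a constant $C>0$, not depending on $L$, such that for every $L\ge 1$ and every $Q_L\in\Pi_L$, $$\sup_{u\in\mathbb{S}^d}|Q_L(u)|\,\omega(u)\le C\sup_{u\in E_L}|Q_L(u)|\,\omega(u).$$
   Context: $d\ge 1$ is an integer and $\mathbb{S}^d$ is the unit sphere of $\mathbb{R}^{d+1}$ with surface measure $\sigma$ and geodesic distance $d(u,v)=\arccos\langle u,v\rangle$. $B(u,\delta)\subset\mathbb{S}^d$ denotes the geodesic ball of center $u\in\mathbb{S}^d$ and radius $\delta>0$; such sets are the spherical caps. $\Pi_L$ is the space of spherical harmonics of degree at most $L$, equivalently the space of restrictions to $\mathbb{S}^d$ of polynomials in $d+1$ variables of degree at most $L$. The sequence $\mathcal{E}$ is relatively dense if there exist $r>0$ and $\varrho>0$ such that for all $L\ge 1$, $$\inf_{u\in\mathbb{S}^d}\frac{\sigma(E_L\cap B(u,r/L))}{\sigma(B(u,r/L))}\ge\varrho.$$ The reverse Hölder class $RH_\infty$ consists of the (integrable) functions $\omega\ge 0$ on $\mathbb{S}^d$ for which there is a constant $C'>0$ such that, for any spherical cap $B\subset\mathbb{S}^d$, the inequality $$\omega(u)\le\frac{C'}{\sigma(B)}\int_B\omega(v)\,d\sigma(v)$$ holds for almost every $u\in B$.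
   Formalization: Both suprema are read as essential suprema with respect to σ, because ω in RH_∞ is controlled only almost everywhere and the pointwise inequality fails if ω is made unbounded on a countable set that every E_L avoids. *)

theory Defs
  imports "HOL-Probability.Essential_Supremum"
begin

text \<open>
  The unit sphere of \<open>\<real>\<^sup>n\<close>, \<open>n = d + 1\<close>, is \<open>sphere 0 1 :: (real ^ 'n) set\<close>. Its surface
  measure is defined by polar coordinates: the measure of \<open>A\<close> is \<open>n\<close> times the Lebesgue measure of
  the cone \<open>{t x | 0 < t \<le> 1, x \<in> A}\<close>. The completion makes
  ``measurable'' mean measurable with respect to the completed surface measure, so that
  all Borel sets and all subsets of null sets are measurable.
\<close>

definition surface_measure :: "(real ^ 'n) measure" where
  "surface_measure = completion (scale_measure (of_nat CARD('n))
     (distr (restrict_space lborel (cball 0 1 - {0})) (restrict_space borel (sphere 0 1)) sgn))"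

lemma space_surface_measure [simp]: "space (surface_measure :: (real ^ 'n) measure) = sphere 0 1"
  by (simp add: surface_measure_def space_scale_measure space_restrict_space)

lemma emeasure_surface_measure:
  fixes A :: "(real ^ 'n) set"
  assumes "A \<in> sets borel" "A \<subseteq> sphere 0 1"
  shows "emeasure surface_measure A =
    of_nat CARD('n) * emeasure lborel {x \<in> cball 0 1. x \<noteq> 0 \<and> sgn x \<in> A}"
proof -
  let ?D = "cball 0 1 - {0} :: (real ^ 'n) set"
  let ?S = "restrict_space borel (sphere 0 1) :: (real ^ 'n) measure"
  have "sgn \<in> borel_measurable (borel :: (real ^ 'n) measure)"
    unfolding sgn_div_norm by measurable
  then have "sgn \<in> restrict_space lborel ?D \<rightarrow>\<^sub>M ?S"
    by (intro measurable_restrict_space2 measurable_restrict_space1)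
       (auto simp: space_restrict_space norm_sgn)
  moreover have A: "A \<in> sets ?S"
    using assms by (auto simp: sets_restrict_space)
  ultimately have "emeasure (distr (restrict_space lborel ?D) ?S sgn) A =
      emeasure (restrict_space lborel ?D) (sgn -` A \<inter> ?D)"
    by (subst emeasure_distr) (auto simp: space_restrict_space)
  also have "\<dots> = emeasure lborel (sgn -` A \<inter> ?D)"
    by (intro emeasure_restrict_space) (auto intro: borel_closed)
  also have "sgn -` A \<inter> ?D = {x \<in> cball 0 1. x \<noteq> 0 \<and> sgn x \<in> A}"
    by auto
  finally show ?thesis
    using A by (simp add: surface_measure_def)
qed

definition geodesic_dist :: "real ^ 'n \<Rightarrow> real ^ 'n \<Rightarrow> real" where
  "geodesic_dist u v = arccos (u \<bullet> v)"

definition cap :: "real ^ 'n \<Rightarrow> real \<Rightarrow> (real ^ 'n) set" where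
  "cap u \<delta> = {v \<in> sphere 0 1. geodesic_dist u v < \<delta>}"

text \<open>
  Functions whose restriction to the sphere is a polynomial of degree at most \<open>L\<close>; an exponent
  vector \<open>\<alpha>\<close> stands for the monomial of degree \<open>\<Sum>i\<in>UNIV. \<alpha> i\<close>. Values off the sphere
  are irrelevant. Coefficients are complex, which includes the real ones.
\<close>

definition spherical_polys :: "nat \<Rightarrow> (real ^ 'n \<Rightarrow> complex) set" where
  "spherical_polys L = {Q. \<exists>c :: ('n \<Rightarrow> nat) \<Rightarrow> complex. \<forall>x \<in> sphere 0 1.
     Q x = (\<Sum>\<alpha> | (\<Sum>i\<in>UNIV. \<alpha> i) \<le> L. c \<alpha> * of_real (\<Prod>i\<in>UNIV. (x $ i) ^ \<alpha> i))}"

text \<open>The sum above is not degenerate: its index set is finite.\<close>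

lemma finite_exponents: "finite {\<alpha> :: 'n::finite \<Rightarrow> nat. (\<Sum>i\<in>UNIV. \<alpha> i) \<le> L}"
proof (rule finite_subset)
  have "\<alpha> i \<le> (\<Sum>i\<in>UNIV. \<alpha> i)" for \<alpha> :: "'n \<Rightarrow> nat" and i
    by (rule member_le_sum) auto
  then show "{\<alpha> :: 'n \<Rightarrow> nat. (\<Sum>i\<in>UNIV. \<alpha> i) \<le> L} \<subseteq> (\<Pi>\<^sub>E i\<in>UNIV. {..L})"
    unfolding PiE_UNIV_domain by (fastforce intro: order_trans)
  show "finite (\<Pi>\<^sub>E i\<in>(UNIV :: 'n set). {..L})"
    by (rule finite_PiE) auto
qed

definition relatively_dense :: "(nat \<Rightarrow> (real ^ 'n) set) \<Rightarrow> bool" where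
  "relatively_dense E \<longleftrightarrow> (\<exists>r > 0. \<exists>\<rho> > 0. \<forall>L \<ge> 1.
     (INF u \<in> sphere 0 1. measure surface_measure (E L \<inter> cap u (r / real L)) /
                          measure surface_measure (cap u (r / real L))) \<ge> \<rho>)"

definition RH_infinity :: "(real ^ 'n \<Rightarrow> real) set" where
  "RH_infinity = {\<omega>. integrable surface_measure \<omega> \<and> (\<forall>u \<in> sphere 0 1. \<omega> u \<ge> 0) \<and>
     (\<exists>C > 0. \<forall>z \<in> sphere 0 1. \<forall>\<delta> > 0. AE u in surface_measure. u \<in> cap z \<delta> \<longrightarrow>
        \<omega> u \<le> C / measure surface_measure (cap z \<delta>) *
               (LINT v:cap z \<delta>|surface_measure. \<omega> v))}"

text \<open>
  The supremum of a weighted function over a set. Since weights in \<open>RH_infinity\<close> are only determined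
  (and only controlled) almost everywhere, it is the essential supremum with respect to
  the surface measure. A pointwise supremum could be changed at will by altering the weight on
  a null set.
\<close>

definition weighted_sup :: "(real ^ 'n) set \<Rightarrow> (real ^ 'n \<Rightarrow> complex) \<Rightarrow> (real ^ 'n \<Rightarrow> real) \<Rightarrow> ereal" where
  "weighted_sup A Q \<omega> =
     esssup (restrict_space surface_measure A) (\<lambda>u. ereal (cmod (Q u) * \<omega> u))"

end

theory Submission
  imports Defs "HOL-Complex_Analysis.Complex_Analysis"
begin

text \<open>
  Let \<open>\<nu> = \<omega> \<sigma>\<close>, let \<open>v u\<close> be the \<open>\<nu>\<close>-measure of the ball of radius \<open>1/L\<close> around \<open>u\<close>, and let \<open>z\<close> almost
  maximize \<open>\<bar>Q\<bar> v\<close> on the sphere. Three facts combine.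

  A weight in \<open>RH\<^sub>\<infinity>\<close> is doubling, because thin annuli carry little mass, and \<open>\<omega>\<close> is much smaller than its
  average over a ball only on a small proportion of that ball: a stopping time argument shows that passing
  from the sublevel set of \<open>t\<close> to that of \<open>K t\<close> increases the measure by a fixed factor.

  As \<open>v\<close> is doubling, \<open>\<bar>Q u\<bar> \<le> \<kappa> (1 + L \<bar>u - z\<bar>)\<^sup>s \<bar>Q z\<bar>\<close> everywhere on the sphere. On each great circle through
  \<open>z\<close>, multiplication by a power of a Dirichlet kernel turns this into a bounded trigonometric polynomial
  of degree comparable to \<open>L\<close>. Rescaled by \<open>1/L\<close>, these form a normal family of holomorphic functions, so
  \<open>\<bar>Q\<bar> < \<epsilon> \<bar>Q z\<bar>\<close> holds only on a small proportion of a ball of radius comparable to \<open>1/L\<close> around \<open>z\<close>.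

  Being almost maximal therefore spreads along chains of balls to most of the cap of radius \<open>r/L\<close> around
  \<open>z\<close>. At a point of \<open>E L\<close> in this cap outside the two exceptional sets, \<open>\<bar>Q\<bar> \<omega>\<close> is comparable to its supremum.
\<close>

section \<open>Doubling measures and the Vitali covering lemma\<close>

text \<open>Near-maximality is taken for \<open>\<bar>Q\<bar> v\<close> and not for
  \<open>\<bar>Q\<bar> \<omega>\<close> because \<omega> is known only up to null sets and may
  oscillate, while the doubling of \<open>v\<close> turns near-maximality at \<open>z\<close> into
  polynomial growth of \<open>Q\<close> alone, a form that complex analysis can use. Since
  \<open>v\<close> is a measure of open balls, the supremum of \<open>\<bar>Q\<bar> v\<close> need
  not be attained; a factor 2 is given away. As \<open>v\<close> is about \<open>L\<close> to the
  power -d times an average of \<omega>, a power \<open>L ^ d\<close> relates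
  \<open>\<bar>Q\<bar> v\<close> to \<open>\<bar>Q\<bar> \<omega>\<close>: from above by reverse
  Hoelder at radius \<open>1/L\<close>, from below outside a sublevel set of \<omega>. What shapes
  the statements is uniformity: every constant precedes \<open>L\<close> and \<open>Q\<close>. The
  tolerated proportion of bad points is fixed by \<open>r\<close> and \<rho>, the length of the
  chains by \<open>r\<close>, and only then the thresholds. The analysis is done with chordal balls
  and Borel measures on the whole Euclidean space; geodesic caps and the completed measure appear
  only where the hypotheses enter and at the end. A weight vanishing almost everywhere is not
  doubling with positive balls and is treated apart.\<close>

lemma finite_disjoint_balls:
  fixes c :: "'i \<Rightarrow> 'a::metric_space" and r :: "'i \<Rightarrow> real"
  assumes "finite I"
  shows "\<exists>J\<subseteq>I. disjoint_family_on (\<lambda>i. ball (c i) (r i)) J \<and>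
    (\<Union>i\<in>I. ball (c i) (r i)) \<subseteq> (\<Union>i\<in>J. ball (c i) (3 * r i))"
  using assms
proof (induction I rule: finite_psubset_induct)
  case (psubset I)
  show ?case
  proof (cases "(\<Union>i\<in>I. ball (c i) (r i)) = {}")
    case True
    then show ?thesis by (intro exI[of _ "{}"]) (auto simp: disjoint_family_on_def)
  next
    case False
    then have "I \<noteq> {}" by auto
    with psubset.hyps have "Max (r ` I) \<in> r ` I" by (intro Max_in) auto
    then obtain m where "m \<in> I" "r m = Max (r ` I)" by auto
    with psubset.hyps have m: "m \<in> I" "\<And>i. i \<in> I \<Longrightarrow> r i \<le> r m"
      by auto
    \<comment> \<open>Radii are arbitrary reals. Positivity puts \<open>c m\<close> into its own
      ball, so that \<open>m\<close> drops out of \<open>I'\<close> and the induction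
      descends.\<close>
    have rm: "r m > 0"
    proof (rule ccontr)
      assume "\<not> r m > 0"
      with m(2) have "ball (c i) (r i) = {}" if "i \<in> I" for i
        using that by (force simp: ball_eq_empty)
      with False show False by auto
    qed
    \<comment> \<open>The balls left out meet the one of largest radius, hence lie in its
      triple.\<close>
    define I' where "I' = {i\<in>I. ball (c i) (r i) \<inter> ball (c m) (r m) = {}}"
    have "c m \<in> ball (c m) (r m)" using rm by simp
    then have "m \<notin> I'" unfolding I'_def by blast
    moreover have "I' \<subseteq> I" by (auto simp: I'_def)
    ultimately have "I' \<subset> I" using m(1) by blast
    from psubset.IH[OF this] obtain J where J: "J \<subseteq> I'" "disjoint_family_on (\<lambda>i. ball (c i) (r i)) J"
      "(\<Union>i\<in>I'. ball (c i) (r i)) \<subseteq> (\<Union>i\<in>J. ball (c i) (3 * r i))" by blast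
    show ?thesis
    proof (intro exI[of _ "insert m J"] conjI)
      show "insert m J \<subseteq> I" using J(1) m(1) by (auto simp: I'_def)
      show "disjoint_family_on (\<lambda>i. ball (c i) (r i)) (insert m J)"
        using J(1,2) by (auto simp: disjoint_family_on_def I'_def)
      show "(\<Union>i\<in>I. ball (c i) (r i)) \<subseteq> (\<Union>i\<in>insert m J. ball (c i) (3 * r i))"
      proof
        fix x assume "x \<in> (\<Union>i\<in>I. ball (c i) (r i))"
        then obtain i where i: "i \<in> I" "dist (c i) x < r i" by auto
        show "x \<in> (\<Union>i\<in>insert m J. ball (c i) (3 * r i))"
        proof (cases "i \<in> I'")
          case True
          then have "x \<in> (\<Union>i\<in>I'. ball (c i) (r i))" using i by auto
          then have "x \<in> (\<Union>i\<in>J. ball (c i) (3 * r i))" using J(3) by (rule rev_subsetD)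
          then show ?thesis by auto
        next
          case False
          then obtain y where y: "dist (c i) y < r i" "dist (c m) y < r m"
            using i(1) by (auto simp: I'_def)
          have "dist (c m) x \<le> dist (c m) y + (dist (c i) y + dist (c i) x)"
            using dist_triangle[of "c m" x y] dist_triangle[of y x "c i"] by (simp add: dist_commute)
          also have "\<dots> < 3 * r m" using y i m(2)[OF i(1)] by linarith
          finally show ?thesis by auto
        qed
      qed
    qed
  qed
qed

text \<open>The measure lives on a whole Polish space and is concentrated on \<open>X\<close>, with
  conditions only at centers in \<open>X\<close>. This gives direct access to inner and outer
  regularity and to ambient metric balls.\<close>

locale doubling_measure = finite_measure M for M :: "'a::polish_space measure" +
  fixes X :: "'a set" and D :: real
  assumes sets_M: "sets M = sets borel"
    and X_borel: "X \<in> sets borel"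
    and null_outside: "measure M (- X) = 0"
    and doubling: "\<And>x r. x \<in> X \<Longrightarrow> 0 < r \<Longrightarrow> measure M (ball x (2 * r)) \<le> D * measure M (ball x r)"
    and ball_pos: "\<And>x r. x \<in> X \<Longrightarrow> 0 < r \<Longrightarrow> 0 < measure M (ball x r)"
    and D_ge_1: "1 \<le> D"
begin

lemma space_M [simp]: "space M = UNIV"
  using sets_eq_imp_space_eq[OF sets_M] by simp

lemma borel_sets [measurable]: "A \<in> sets borel \<Longrightarrow> A \<in> sets M"
  using sets_M by simp

lemma ball_sets [measurable]: "ball x r \<in> sets M"
  by (simp add: sets_M)

lemma mono_borel: "A \<subseteq> B \<Longrightarrow> B \<in> sets borel \<Longrightarrow> measure M A \<le> measure M B"
  by (rule finite_measure_mono) auto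

lemma doubling_pow: "x \<in> X \<Longrightarrow> 0 < r \<Longrightarrow> measure M (ball x (2 ^ k * r)) \<le> D ^ k * measure M (ball x r)"
proof (induction k)
  case (Suc k)
  have "measure M (ball x (2 ^ Suc k * r)) \<le> D * measure M (ball x (2 ^ k * r))"
    using doubling[of x "2 ^ k * r"] Suc by (simp add: mult.assoc)
  also have "\<dots> \<le> D * (D ^ k * measure M (ball x r))"
    using Suc D_ge_1 by (intro mult_left_mono) auto
  finally show ?case by simp
qed simp

lemma compact_approx:
  assumes "A \<in> sets borel" "0 < e"
  obtains K where "compact K" "K \<subseteq> A" "measure M A \<le> measure M K + e"
proof -
  have "emeasure M A = (SUP K \<in> {K. K \<subseteq> A \<and> compact K}. emeasure M K)"
    by (rule inner_regular[OF sets_M _ assms(1)]) (simp add: emeasure_eq_measure)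
  have "\<exists>K\<in>{K. K \<subseteq> A \<and> compact K}. emeasure M A < emeasure M K + ennreal e"
  proof (rule ccontr)
    assume "\<not> ?thesis"
    then have *: "\<And>K. K \<subseteq> A \<Longrightarrow> compact K \<Longrightarrow> measure M K + e \<le> measure M A"
      using assms(2) by (force simp: emeasure_eq_measure ennreal_plus[symmetric] not_less simp del: ennreal_plus)
    from *[of "{}"] have p: "e \<le> measure M A" by auto
    have "emeasure M A \<le> ennreal (measure M A - e)"
      unfolding \<open>emeasure M A = _\<close>
    proof (rule SUP_least)
      fix K assume "K \<in> {K. K \<subseteq> A \<and> compact K}"
      with * have "measure M K + e \<le> measure M A" by auto
      then show "emeasure M K \<le> ennreal (measure M A - e)"
        by (simp add: emeasure_eq_measure ennreal_leI)
    qed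
    then have "measure M A \<le> measure M A - e" using p by (simp add: emeasure_eq_measure)
    then show False using assms(2) by simp
  qed
  then show ?thesis using assms(2) that
    by (force simp: emeasure_eq_measure ennreal_plus[symmetric] ennreal_less_iff simp del: ennreal_plus)
qed

lemma open_approx:
  assumes "A \<in> sets borel" "0 < e"
  obtains U where "open U" "A \<subseteq> U" "measure M (U - A) \<le> e"
proof -
  have *: "emeasure M A = (INF U \<in> {U. A \<subseteq> U \<and> open U}. emeasure M U)"
    by (rule outer_regular[OF sets_M _ assms(1)]) (simp add: emeasure_eq_measure)
  have "(INF U \<in> {U. A \<subseteq> U \<and> open U}. emeasure M U) < emeasure M A + ennreal e"
    unfolding *[symmetric] using assms(2) by (simp add: emeasure_eq_measure ennreal_plus[symmetric] ennreal_less_iff del: ennreal_plus)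
  then obtain U where U: "A \<subseteq> U" "open U" "measure M U < measure M A + e"
    unfolding INF_less_iff using assms(2)
    by (auto simp: emeasure_eq_measure ennreal_plus[symmetric] ennreal_less_iff simp del: ennreal_plus)
  have "measure M (U - A) = measure M U - measure M A"
    using U(1,2) assms(1) by (intro finite_measure_Diff) auto
  with U that show ?thesis by force
qed

text \<open>Regularity replaces \<open>A \<inter> X\<close> by a compact subset at the cost of
  \<open>e\<close>, so a finite covering suffices. The triple of a ball lies in the fourfold ball,
  which is two doublings and gives the factor \<open>D\<^sup>2\<close>.\<close>

lemma vitali:
  assumes A: "A \<in> sets borel" and e: "0 < e"
    and r: "\<And>x. x \<in> A \<inter> X \<Longrightarrow> 0 < r x"
  obtains J where "finite J" "J \<subseteq> A \<inter> X" "disjoint_family_on (\<lambda>x. ball x (r x)) J"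
    "measure M A \<le> D\<^sup>2 * (\<Sum>x\<in>J. measure M (ball x (r x))) + e"
proof -
  from compact_approx[of "A \<inter> X", OF _ e] A X_borel
  obtain K where K: "compact K" "K \<subseteq> A \<inter> X" "measure M (A \<inter> X) \<le> measure M K + e" by auto
  have "K \<subseteq> (\<Union>x\<in>K. ball x (r x))" using K(2) r by force
  from compactE_image[OF K(1) _ this] obtain I where I: "I \<subseteq> K" "finite I" "K \<subseteq> (\<Union>x\<in>I. ball x (r x))"
    by auto
  from finite_disjoint_balls[OF I(2), of "\<lambda>x. x" r] obtain J where J: "J \<subseteq> I"
    "disjoint_family_on (\<lambda>x. ball x (r x)) J" "(\<Union>x\<in>I. ball x (r x)) \<subseteq> (\<Union>x\<in>J. ball x (3 * r x))"
    by blast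
  have fJ: "finite J" using J(1) I(2) finite_subset by blast
  have JX: "J \<subseteq> A \<inter> X" using J(1) I(1) K(2) by blast
  have AX: "measure M A \<le> measure M (A \<inter> X)"
  proof -
    have "measure M A \<le> measure M (A \<inter> X) + measure M (A - X)"
      using A X_borel measure_Un_le[of "A \<inter> X" M "A - X"] by (simp add: Int_Diff_Un)
    moreover have "measure M (A - X) \<le> measure M (- X)"
      using X_borel by (intro mono_borel) auto
    ultimately show ?thesis using null_outside measure_nonneg[of M] by simp
  qed
  have "measure M K \<le> measure M (\<Union>x\<in>J. ball x (3 * r x))"
    using I(3) J(3) fJ by (intro mono_borel) auto
  also have "\<dots> \<le> (\<Sum>x\<in>J. measure M (ball x (3 * r x)))"
    using fJ by (intro finite_measure_subadditive_finite) auto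
  also have "\<dots> \<le> (\<Sum>x\<in>J. D\<^sup>2 * measure M (ball x (r x)))"
  proof (rule sum_mono)
    fix x assume "x \<in> J"
    then have x: "x \<in> X" "0 < r x" using JX r by auto
    have "measure M (ball x (3 * r x)) \<le> measure M (ball x (2^2 * r x))"
      using x by (intro mono_borel) auto
    also have "\<dots> \<le> D\<^sup>2 * measure M (ball x (r x))" using doubling_pow[OF x] by blast
    finally show "measure M (ball x (3 * r x)) \<le> D\<^sup>2 * measure M (ball x (r x))" .
  qed
  finally have "measure M A \<le> D\<^sup>2 * (\<Sum>x\<in>J. measure M (ball x (r x))) + e"
    using AX K(3) by (simp add: sum_distrib_left)
  with fJ JX J(2) that show ?thesis by blast
qed

text \<open>The selected balls are disjoint, so their shares of \<open>G\<close> add up to at most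
  the measure of \<open>G\<close>. One suitable radius per point is enough, which is exactly what a
  stopping time delivers.\<close>

lemma vitali_bound:
  assumes A: "A \<in> sets borel" and G: "G \<in> sets borel"
    and c: "0 \<le> c"
    and r: "\<And>x. x \<in> A \<inter> X \<Longrightarrow> \<exists>r>0. measure M (ball x r) \<le> c * measure M (ball x r \<inter> G)"
  shows "measure M A \<le> D\<^sup>2 * c * measure M G"
proof (rule field_le_epsilon)
  fix e :: real assume "0 < e"
  from r obtain r where r: "\<And>x. x \<in> A \<inter> X \<Longrightarrow> 0 < r x"
    "\<And>x. x \<in> A \<inter> X \<Longrightarrow> measure M (ball x (r x)) \<le> c * measure M (ball x (r x) \<inter> G)" by metis
  obtain J where J: "finite J" "J \<subseteq> A \<inter> X" "disjoint_family_on (\<lambda>x. ball x (r x)) J"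
    "measure M A \<le> D\<^sup>2 * (\<Sum>x\<in>J. measure M (ball x (r x))) + e"
    by (rule vitali[OF A \<open>0 < e\<close> r(1)])
  have "(\<Sum>x\<in>J. measure M (ball x (r x))) \<le> (\<Sum>x\<in>J. c * measure M (ball x (r x) \<inter> G))"
    using J(2) r(2) by (intro sum_mono) auto
  also have "\<dots> = c * (\<Sum>x\<in>J. measure M (ball x (r x) \<inter> G))" by (simp add: sum_distrib_left)
  also have "(\<Sum>x\<in>J. measure M (ball x (r x) \<inter> G)) = measure M (\<Union>x\<in>J. ball x (r x) \<inter> G)"
    using J G by (intro finite_measure_finite_Union[symmetric]) (auto simp: disjoint_family_on_def)
  also have "\<dots> \<le> measure M G" using G by (intro mono_borel) auto
  finally have "(\<Sum>x\<in>J. measure M (ball x (r x))) \<le> c * measure M G" using c by (simp add: mult_left_mono)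
  then have "D\<^sup>2 * (\<Sum>x\<in>J. measure M (ball x (r x))) \<le> D\<^sup>2 * (c * measure M G)"
    by (intro mult_left_mono) auto
  with J(4) show "measure M A \<le> D\<^sup>2 * c * measure M G + e" by (simp add: mult.assoc)
qed

end

section \<open>Reverse Hoelder weights: small sublevel sets\<close>

lemma (in finite_measure) measure_density_le:
  assumes w: "w \<in> borel_measurable M" and w0: "\<And>x. 0 \<le> w x" and c: "0 \<le> c"
    and A: "A \<in> sets M" and le: "AE u in M. u \<in> A \<longrightarrow> w u \<le> c"
  shows "measure (density M (\<lambda>x. ennreal (w x))) A \<le> c * measure M A"
proof -
  have "emeasure (density M (\<lambda>x. ennreal (w x))) A = (\<integral>\<^sup>+x. ennreal (w x) * indicator A x \<partial>M)"
    using w A by (intro emeasure_density) auto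
  also have "\<dots> \<le> (\<integral>\<^sup>+x. ennreal c * indicator A x \<partial>M)"
    using le by (intro nn_integral_mono_AE) (auto simp: indicator_def ennreal_leI)
  also have "\<dots> = ennreal (c * measure M A)"
    using A c by (simp add: nn_integral_cmult_indicator emeasure_eq_measure ennreal_mult)
  finally show ?thesis
    using c by (simp add: Sigma_Algebra.measure_def enn2real_leI)
qed

text \<open>Separated from \<open>rh_weight\<close> so that the weighted measure is available as a
  finite Borel measure before its doubling has been proved.\<close>

locale weighted_doubling_measure = doubling_measure +
  fixes w :: "'a::polish_space \<Rightarrow> real" and C :: real
  assumes w_borel [measurable]: "w \<in> borel_measurable borel"
    and w_nonneg: "\<And>x. 0 \<le> w x"
    and w_integrable: "integrable M w"
    and C_ge_1: "1 \<le> C"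
begin

definition wM :: "'a measure" where "wM = density M (\<lambda>x. ennreal (w x))"

lemma w_measurable [measurable]: "w \<in> borel_measurable M"
  by (subst measurable_cong_sets[OF sets_M refl]) (rule w_borel)

lemma sets_wM: "sets wM = sets borel" by (simp add: wM_def sets_M)

lemma finite_wM: "finite_measure wM"
proof
  have "emeasure wM (space wM) = (\<integral>\<^sup>+x. ennreal (w x) \<partial>M)"
    unfolding wM_def by (simp add: emeasure_density flip: space_M)
  also have "\<dots> < \<infinity>"
    using w_integrable w_nonneg by (simp add: integrable_iff_bounded)
  finally show "emeasure wM (space wM) \<noteq> \<infinity>" by simp
qed

sublocale N: finite_measure wM by (rule finite_wM)

lemma sublevel_borel: "{u \<in> ball z r. w u < t} \<in> sets borel"
proof -
  have "{u \<in> ball z r. w u < t} = ball z r \<inter> (w -` {..<t} \<inter> space borel)" by auto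
  also have "\<dots> \<in> sets borel"
    by (intro sets.Int measurable_sets[OF w_borel]) auto
  finally show ?thesis .
qed

lemma N_mono_borel: "A \<subseteq> B \<Longrightarrow> B \<in> sets borel \<Longrightarrow> measure wM A \<le> measure wM B"
  by (rule N.finite_measure_mono) (simp_all add: sets_wM)

lemma N_le: "A \<in> sets borel \<Longrightarrow> 0 \<le> c \<Longrightarrow> AE u in M. u \<in> A \<longrightarrow> w u \<le> c \<Longrightarrow> measure wM A \<le> c * measure M A"
  unfolding wM_def by (rule measure_density_le[OF w_measurable w_nonneg _ borel_sets])

end

text \<open>Doubling of the weight is an assumption of its own: on the sphere it is derived from the
  thin annuli of caps, a structure that an abstract doubling space does not offer.\<close>

locale rh_weight = weighted_doubling_measure +
  fixes Dw :: real
  assumes rh: "\<And>z s. z \<in> X \<Longrightarrow> 0 < s \<Longrightarrow>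
      AE u in M. u \<in> ball z s \<longrightarrow> w u * measure M (ball z s) \<le> C * measure wM (ball z s)"
    and w_doubling: "\<And>z s. z \<in> X \<Longrightarrow> 0 < s \<Longrightarrow> measure wM (ball z (2 * s)) \<le> Dw * measure wM (ball z s)"
    and Dw_ge_1: "1 \<le> Dw"
begin

lemma w_doubling_pow: "x \<in> X \<Longrightarrow> 0 < r \<Longrightarrow> measure wM (ball x (2 ^ k * r)) \<le> Dw ^ k * measure wM (ball x r)"
proof (induction k)
  case (Suc k)
  have "measure wM (ball x (2 ^ Suc k * r)) \<le> Dw * measure wM (ball x (2 ^ k * r))"
    using w_doubling[of x "2 ^ k * r"] Suc by (simp add: mult.assoc)
  also have "\<dots> \<le> Dw * (Dw ^ k * measure wM (ball x r))"
    using Suc Dw_ge_1 by (intro mult_left_mono) auto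
  finally show ?case by simp
qed simp

lemma rh_quotient:
  assumes "z \<in> X" "0 < s"
  shows "AE u in M. u \<in> ball z s \<longrightarrow> w u \<le> C * measure wM (ball z s) / measure M (ball z s)"
  using rh[OF assms] by eventually_elim (simp add: pos_le_divide_eq[OF ball_pos[OF assms]])

text \<open>Reverse Hoelder bounds \<open>w\<close> on the ball by \<open>C\<close> times its
  average, so the small part outside \<open>A\<close> carries at most half of the mass and is
  absorbed on the left; the rest carries at most \<open>t\<close> times the measure.\<close>

lemma rh_average_le:
  assumes x: "x \<in> X" "0 < r" and t: "0 \<le> t" and A: "A \<in> sets borel" "\<And>u. u \<in> A \<Longrightarrow> w u \<le> t"
    and small: "2 * C * measure M (ball x r - A) \<le> measure M (ball x r)"
  shows "measure wM (ball x r) \<le> 2 * t * measure M (ball x r)"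
proof -
  let ?b = "measure M (ball x r)" and ?v = "measure wM (ball x r)"
  have b: "0 < ?b" using ball_pos[OF x] .
  have "?v = measure wM ((ball x r \<inter> A) \<union> (ball x r - A))" by (simp only: Int_Diff_Un)
  also have "\<dots> = measure wM (ball x r \<inter> A) + measure wM (ball x r - A)"
  proof (rule N.finite_measure_Union)
    show "ball x r \<inter> A \<in> sets wM" unfolding sets_wM using A(1) by (intro sets.Int) auto
    show "ball x r - A \<in> sets wM" unfolding sets_wM using A(1) by (intro sets.Diff) auto
    show "ball x r \<inter> A \<inter> (ball x r - A) = {}" by blast
  qed
  also have "measure wM (ball x r \<inter> A) \<le> t * measure M (ball x r \<inter> A)"
  proof (rule N_le)
    show "ball x r \<inter> A \<in> sets borel" using A(1) by (intro sets.Int) auto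
    show "AE u in M. u \<in> ball x r \<inter> A \<longrightarrow> w u \<le> t" by (intro AE_I2) (use A(2) in blast)
  qed (rule t)
  also have "\<dots> \<le> t * ?b"
    using t by (intro mult_left_mono mono_borel) auto
  also have "measure wM (ball x r - A) \<le> (C * ?v / ?b) * measure M (ball x r - A)"
  proof (rule N_le)
    show "AE u in M. u \<in> ball x r - A \<longrightarrow> w u \<le> C * ?v / ?b"
      using rh_quotient[OF x] by eventually_elim auto
    show "ball x r - A \<in> sets borel" using A(1) by (intro sets.Diff) auto
    show "0 \<le> C * ?v / ?b" using C_ge_1 by simp
  qed
  also have "(C * ?v / ?b) * measure M (ball x r - A) = (?v / (2 * ?b)) * (2 * C * measure M (ball x r - A))"
    by simp
  also have "\<dots> \<le> (?v / (2 * ?b)) * ?b"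
    using b by (intro mult_left_mono small) auto
  also have "\<dots> = ?v / 2" using b by simp
  finally show ?thesis by simp
qed

text \<open>Stopping time on the radii \<open>h / 2 ^ j\<close> around a point of \<open>A\<close>.
  Take the last radius at which \<open>A\<close> still leaves free a share
  \<open>1 / (2 * C)\<close> of the ball. At half that radius the average is at most
  \<open>2 * t\<close> by \<open>rh_average_le\<close>, so doubling bounds the average at the
  stopping radius by \<open>2 * Dw * t\<close>, and reverse Hoelder puts almost every point of that
  ball below \<open>2 * C * Dw * t\<close>, hence strictly below \<open>K * t\<close>. The free
  share of the ball thus lies in \<open>A' - A\<close>.\<close>

lemma sublevel_growth:
  fixes z :: 'a and \<rho> h t :: real
  defines "K \<equiv> 2 * C * Dw + 1"
  defines "A \<equiv> {u \<in> ball z \<rho>. w u < t}" and "A' \<equiv> {u \<in> ball z (\<rho> + h). w u < K * t}"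
  assumes t: "0 < t" and h: "0 < h"
    and large: "\<And>x. x \<in> ball z \<rho> \<inter> X \<Longrightarrow> 2 * t * measure M (ball x h) < measure wM (ball x h)"
  shows "measure M A \<le> D\<^sup>2 * (2 * C) * (measure M A' - measure M A)"
proof (rule field_le_epsilon)
  fix e :: real assume e: "0 < e"
  define e' where "e' = e / (D\<^sup>2 * (2 * C))"
  have DC: "0 < D\<^sup>2 * (2 * C)" using D_ge_1 C_ge_1 by auto
  have e': "0 < e'" using e DC by (simp add: e'_def)
  have A_borel: "A \<in> sets borel" "A' \<in> sets borel"
    unfolding A_def A'_def by (rule sublevel_borel)+
  have K1: "1 \<le> K" using C_ge_1 Dw_ge_1 by (simp add: K_def)
  have "A \<subseteq> A'"
  proof -
    have "t \<le> K * t" using K1 t by simp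
    then show ?thesis using h by (auto simp: A_def A'_def)
  qed
  \<comment> \<open>Takes the place of a density theorem: if a ball inside \<open>U\<close> is still
    good, its free share lies in \<open>U - A\<close>, which is negligible; otherwise the stopping
    radius exists.\<close>
  obtain U where U: "open U" "A \<subseteq> U" "measure M (U - A) \<le> e'"
    using open_approx[OF A_borel(1) e'] by blast
  define G where "G = (U \<union> A') - A"
  have G: "G \<in> sets borel" using U(1) A_borel by (auto simp: G_def)
  have "measure M A \<le> D\<^sup>2 * (2 * C) * measure M G"
  proof (rule vitali_bound)
    show "A \<in> sets borel" by (rule A_borel)
    show "G \<in> sets borel" by (rule G)
    show "0 \<le> 2 * C" using C_ge_1 by simp
    fix x assume "x \<in> A \<inter> X"
    then have x: "x \<in> X" "x \<in> ball z \<rho>" "x \<in> U" using U(2) by (auto simp: A_def)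
    define good where "good j \<longleftrightarrow> measure M (ball x (h / 2 ^ j)) \<le> 2 * C * measure M (ball x (h / 2 ^ j) - A)" for j :: nat
    have not_good: "measure wM (ball x (h / 2 ^ j)) \<le> 2 * t * measure M (ball x (h / 2 ^ j))"
      if "\<not> good j" for j
    proof (rule rh_average_le[OF x(1) _ _ A_borel(1)])
      show "2 * C * measure M (ball x (h / 2 ^ j) - A) \<le> measure M (ball x (h / 2 ^ j))"
        using that unfolding good_def by linarith
    qed (use h t in \<open>auto simp: A_def\<close>)
    \<comment> \<open>At radius \<open>h\<close> a ball that is not good would have average at most
      \<open>2 * t\<close>, against \<open>large\<close>.\<close>
    have good0: "good 0"
      using not_good[of 0] large[of x] x by fastforce
    obtain d where d: "0 < d" "ball x d \<subseteq> U"
      using U(1) x(3) open_contains_ball by blast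
    have "(\<lambda>j. h / 2 ^ j) \<longlonglongrightarrow> 0" by real_asymp
    then have "eventually (\<lambda>j. h / 2 ^ j < d) sequentially" using d(1) order_tendstoD(2) by blast
    then obtain j1 where j1: "\<And>j. j \<ge> j1 \<Longrightarrow> h / 2 ^ j < d" by (auto simp: eventually_sequentially)
    show "\<exists>r>0. measure M (ball x r) \<le> 2 * C * measure M (ball x r \<inter> G)"
    proof (cases "good j1")
      case True
      have "ball x (h / 2 ^ j1) \<subseteq> U" using d(2) j1[of j1] by (meson less_imp_le order_refl order_trans subset_ball)
      then have "ball x (h / 2 ^ j1) - A = ball x (h / 2 ^ j1) \<inter> G" by (auto simp: G_def)
      then show ?thesis using True h by (intro exI[of _ "h / 2 ^ j1"]) (auto simp: good_def)
    next
      case False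
      obtain j where j: "good j" "\<not> good (Suc j)"
        using good0 False by (induction j1) auto
      define r where "r = h / 2 ^ j"
      have r: "0 < r" "r \<le> h" using h by (auto simp: r_def divide_le_eq_1 field_simps intro: order_trans[OF _ mult_left_mono[of 1]])
      have r2: "h / 2 ^ Suc j = r / 2" by (simp add: r_def)
      have "measure wM (ball x r) \<le> Dw * measure wM (ball x (r / 2))"
        using w_doubling[OF x(1), of "r / 2"] r by simp
      also have "\<dots> \<le> Dw * (2 * t * measure M (ball x (r / 2)))"
        using not_good[OF j(2)] Dw_ge_1 unfolding r2 by (intro mult_left_mono) auto
      also have "\<dots> \<le> Dw * (2 * t * measure M (ball x r))"
        using Dw_ge_1 t r by (intro mult_left_mono mono_borel) auto
      finally have "measure wM (ball x r) / measure M (ball x r) \<le> 2 * Dw * t"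
        using ball_pos[OF x(1) r(1)] by (simp add: field_simps)
      then have "C * (measure wM (ball x r) / measure M (ball x r)) \<le> C * (2 * Dw * t)"
        using C_ge_1 by (intro mult_left_mono) auto
      also have "\<dots> < K * t" using t by (simp add: K_def algebra_simps)
      finally have lt: "C * measure wM (ball x r) / measure M (ball x r) < K * t" by simp
      have sub: "ball x r \<subseteq> ball z (\<rho> + h)"
      proof
        fix y assume "y \<in> ball x r"
        then show "y \<in> ball z (\<rho> + h)"
          using x(2) r(2) dist_triangle[of z y x] by auto
      qed
      have "measure M (ball x r - A) \<le> measure M (ball x r \<inter> G)"
      proof (rule finite_measure_mono_AE)
        show "AE u in M. u \<in> ball x r - A \<longrightarrow> u \<in> ball x r \<inter> G"
          using rh_quotient[OF x(1) r(1)]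
          by eventually_elim (use lt sub in \<open>auto simp: G_def A'_def\<close>)
      qed (use G in auto)
      then have "2 * C * measure M (ball x r - A) \<le> 2 * C * measure M (ball x r \<inter> G)"
        using C_ge_1 by (intro mult_left_mono) auto
      with j(1) have "measure M (ball x r) \<le> 2 * C * measure M (ball x r \<inter> G)"
        unfolding good_def r_def[symmetric] by linarith
      then show ?thesis using r by blast
    qed
  qed
  also have "measure M G \<le> (measure M A' - measure M A) + e'"
  proof -
    have "measure M G \<le> measure M ((A' - A) \<union> (U - A))" using U(1) A_borel by (intro mono_borel) (auto simp: G_def)
    also have "\<dots> \<le> measure M (A' - A) + measure M (U - A)"
      using U(1) A_borel by (intro measure_Un_le) auto
    also have "measure M (A' - A) = measure M A' - measure M A"
      using \<open>A \<subseteq> A'\<close> A_borel by (intro finite_measure_Diff) auto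
    finally show ?thesis using U(3) by linarith
  qed
  finally have "measure M A \<le> D\<^sup>2 * (2 * C) * (measure M A' - measure M A + e')"
    using DC by (meson less_imp_le mult_left_mono order_trans)
  also have "\<dots> = D\<^sup>2 * (2 * C) * (measure M A' - measure M A) + e"
    using D_ge_1 C_ge_1 by (simp only: distrib_left) (simp add: e'_def)
  finally show "measure M A \<le> D\<^sup>2 * (2 * C) * (measure M A' - measure M A) + e" .
qed

text \<open>Each of \<open>n\<close> applications of \<open>sublevel_growth\<close> multiplies the
  measure by at least \<open>1 / q\<close> and widens the radius by \<open>R / n\<close>. The last
  set still lies in the ball of radius \<open>2 * R\<close>, so the first one has at most the share
  \<open>q ^ n * D\<close> of the ball of radius \<open>R\<close>.\<close>

lemma sublevel_small:
  assumes \<delta>: "0 < \<delta>"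
  shows "\<exists>\<epsilon>>0. \<forall>z\<in>X. \<forall>R>0.
    measure M {u \<in> ball z R. w u * measure M (ball z R) < \<epsilon> * measure wM (ball z R)} \<le> \<delta> * measure M (ball z R)"
proof -
  define c where "c = D\<^sup>2 * (2 * C)"
  \<comment> \<open>A growth estimate \<open>a \<le> c * (a' - a)\<close> rearranges to
    \<open>a \<le> q * a'\<close>.\<close>
  define q where "q = c / (1 + c)"
  define K where "K = 2 * C * Dw + 1"
  have c: "0 < c" using D_ge_1 C_ge_1 by (auto simp: c_def)
  have q: "0 < q" "q < 1" using c by (auto simp: q_def)
  have K1: "1 \<le> K" using C_ge_1 Dw_ge_1 by (simp add: K_def)
  obtain m where m: "q ^ m < \<delta> / D"
    using real_arch_pow_inv[of "\<delta> / D" q] \<delta> D_ge_1 q by auto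
  define n where "n = Suc m"
  have "q ^ n \<le> q ^ m" unfolding n_def using q by (intro power_decreasing) auto
  with m D_ge_1 have n: "q ^ n * D < \<delta>" "n \<ge> 1"
    by (auto simp: n_def pos_less_divide_eq[symmetric])
  \<comment> \<open>With \<open>h = R / n\<close> this makes \<open>2 ^ k * h\<close> at least
    \<open>3 * R\<close>, so a ball of radius \<open>h\<close> centered within \<open>2 * R\<close>
    of \<open>z\<close> contains \<open>ball z R\<close> after \<open>k\<close> doublings.\<close>
  obtain k where k: "3 * real n \<le> 2 ^ k"
    using real_arch_pow[of 2 "3 * real n"] by (auto intro: less_imp_le)
  \<comment> \<open>Compared with \<open>ball z R\<close>, a ball of radius \<open>h\<close> has at
    least the mass divided by \<open>Dw ^ k\<close> and at most \<open>D\<^sup>2\<close> times the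
    measure; levels rise by at most \<open>K ^ n\<close>. The 4 is the factor 2 of the hypothesis
    \<open>large\<close> times a 2 for strictness.\<close>
  define \<epsilon> where "\<epsilon> = 1 / (4 * K ^ n * D\<^sup>2 * Dw ^ k)"
  have pos: "0 < K ^ n" "0 < D\<^sup>2" "0 < Dw ^ k" using K1 D_ge_1 Dw_ge_1 by auto
  then have \<epsilon>: "0 < \<epsilon>" by (simp add: \<epsilon>_def)
  show ?thesis
  proof (intro exI[of _ \<epsilon>] conjI ballI allI impI \<epsilon>)
    fix z R assume z: "z \<in> X" and R: "0 < (R::real)"
    let ?b = "measure M (ball z R)" and ?v = "measure wM (ball z R)"
    have b: "0 < ?b" by (rule ball_pos[OF z R])
    show "measure M {u \<in> ball z R. w u * ?b < \<epsilon> * ?v} \<le> \<delta> * ?b"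
    proof (cases "?v = 0")
      case True
      have "{u \<in> ball z R. w u * ?b < \<epsilon> * ?v} = {}" using True w_nonneg b by (auto simp: not_less)
      then show ?thesis using \<delta> b by (simp only: measure_empty) simp
    next
      case False
      then have v: "0 < ?v" by (simp add: zero_less_measure_iff)
      define h where "h = R / real n"
      have h: "0 < h" "h \<le> R" "n * h = R"
        using R n(2) by (simp_all add: h_def divide_le_eq)
      define t where "t i = \<epsilon> * K ^ i * (?v / ?b)" for i :: nat
      have t: "0 < t i" for i using \<epsilon> K1 v b by (simp add: t_def)
      define A where "A i = {u \<in> ball z (R + real i * h). w u < t i}" for i
      have step: "measure M (A i) \<le> q * measure M (A (Suc i))" if "i < n" for i
      proof -
        have rad: "R + real i * h \<le> 2 * R"
          using mult_right_mono[of "real i" "real n" h] that h by simp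
        have "measure M (A i) \<le> D\<^sup>2 * (2 * C) * (measure M (A (Suc i)) - measure M (A i))"
        proof -
          have "A (Suc i) = {u \<in> ball z ((R + real i * h) + h). w u < (2 * C * Dw + 1) * t i}"
          proof -
            have "R + real (Suc i) * h = (R + real i * h) + h" by (simp add: algebra_simps)
            moreover have "t (Suc i) = (2 * C * Dw + 1) * t i" by (simp add: t_def K_def)
            ultimately show ?thesis by (simp only: A_def)
          qed
          moreover have "2 * t i * measure M (ball x h) < measure wM (ball x h)"
            if "x \<in> ball z (R + real i * h) \<inter> X" for x
          proof -
            have x: "x \<in> X" "dist z x < 2 * R" using that rad by auto
            have "ball x h \<subseteq> ball z (2^2 * R)"
            proof
              fix y assume "y \<in> ball x h"
              then show "y \<in> ball z (2^2 * R)" using x h dist_triangle[of z y x] by auto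
            qed
            then have "measure M (ball x h) \<le> measure M (ball z (2^2 * R))" by (intro mono_borel) auto
            also have "\<dots> \<le> D\<^sup>2 * ?b" by (rule doubling_pow[OF z R])
            finally have 1: "measure M (ball x h) \<le> D\<^sup>2 * ?b" .
            have "3 * R \<le> 2 ^ k * h"
              using mult_right_mono[OF k, of h] h by (simp add: mult.assoc)
            have "ball z R \<subseteq> ball x (2 ^ k * h)"
            proof
              fix y assume "y \<in> ball z R"
              then show "y \<in> ball x (2 ^ k * h)"
                using x \<open>3 * R \<le> 2 ^ k * h\<close> dist_triangle[of x y z] by (auto simp: dist_commute)
            qed
            then have "?v \<le> measure wM (ball x (2 ^ k * h))" by (intro N_mono_borel) auto
            also have "\<dots> \<le> Dw ^ k * measure wM (ball x h)" by (rule w_doubling_pow[OF x(1) h(1)])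
            finally have 2: "?v \<le> Dw ^ k * measure wM (ball x h)" .
            have "K ^ i \<le> K ^ n" using K1 \<open>i < n\<close> by (intro power_increasing) auto
            have "2 * t i * measure M (ball x h) \<le> 2 * t i * (D\<^sup>2 * ?b)"
              using 1 t[of i] by (intro mult_left_mono) auto
            also have "\<dots> = K ^ i * (2 * \<epsilon> * D\<^sup>2 * ?v)" using b by (simp add: t_def)
            also have "\<dots> \<le> K ^ n * (2 * \<epsilon> * D\<^sup>2 * ?v)"
              using \<open>K ^ i \<le> K ^ n\<close> \<epsilon> by (intro mult_right_mono) auto
            also have "\<dots> = ?v / (2 * Dw ^ k)"
              using K1 D_ge_1 Dw_ge_1 unfolding \<epsilon>_def by (simp add: field_simps)
            also have "\<dots> < ?v / Dw ^ k" using v pos by (simp add: field_simps)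
            also have "\<dots> \<le> measure wM (ball x h)" using 2 pos by (simp add: field_simps)
            finally show ?thesis .
          qed
          ultimately show ?thesis
            using sublevel_growth[of "t i" h z "R + real i * h"] t[of i] h(1)
            unfolding A_def by simp
        qed
        then have "(1 + c) * measure M (A i) \<le> c * measure M (A (Suc i))"
          unfolding c_def[symmetric] by (simp add: algebra_simps)
        then show ?thesis using c by (simp add: q_def field_simps)
      qed
      have "measure M (A 0) \<le> q ^ i * measure M (A i)" if "i \<le> n" for i
        using that
      proof (induction i)
        case (Suc i)
        then have "measure M (A 0) \<le> q ^ i * measure M (A i)" by simp
        also have "\<dots> \<le> q ^ i * (q * measure M (A (Suc i)))"
          using step[of i] Suc.prems q by (intro mult_left_mono) auto
        finally show ?case by (simp add: mult_ac)
      qed simp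
      from this[of n] have "measure M (A 0) \<le> q ^ n * measure M (A n)" by simp
      also have "\<dots> \<le> q ^ n * measure M (ball z (2 * R))"
        using h(3) q by (intro mult_left_mono mono_borel) (auto simp: A_def)
      also have "\<dots> \<le> q ^ n * (D * ?b)" using doubling[OF z R] q by (intro mult_left_mono) auto
      also have "\<dots> \<le> \<delta> * ?b" using n(1) b by (simp add: mult.assoc[symmetric])
      also have "A 0 = {u \<in> ball z R. w u * ?b < \<epsilon> * ?v}"
        using b by (auto simp: A_def t_def field_simps)
      finally show ?thesis .
    qed
  qed
qed

end

section \<open>Small values of polynomials on great circles\<close>

lemma sublevel_borel_on:
  fixes f :: "'a::topological_space \<Rightarrow> real"
  assumes "continuous_on S f" "S \<in> sets borel"
  shows "{x \<in> S. f x < c} \<in> sets borel"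
proof -
  obtain T where "open T" "T \<inter> S = f -` {..<c} \<inter> S"
    using assms(1)[unfolded continuous_on_open_invariant, rule_format, of "{..<c}"] by auto
  moreover have "{x \<in> S. f x < c} = f -` {..<c} \<inter> S" by auto
  ultimately show ?thesis using assms(2) by (metis borel_open sets.Int)
qed

text \<open>A compactness argument, so \<epsilon> is not explicit but depends on \<open>M\<close>
  and \<delta> only. Counterexamples for \<open>1 / Suc n\<close> have a subsequence with a
  holomorphic limit \<open>g\<close>. The points lying in infinitely many of the small-value sets
  form a set of measure at least \<delta> where \<open>g\<close> vanishes; by the identity theorem
  \<open>g\<close> is zero, against modulus 1 at the origin.\<close>

lemma holomorphic_small_values:
  fixes M \<delta> :: real
  assumes \<delta>: "0 < \<delta>"
  shows "\<exists>\<epsilon>>0. \<forall>F. F holomorphic_on ball 0 2 \<and> (\<forall>x\<in>ball 0 2. cmod (F x) \<le> M) \<and> cmod (F 0) = 1 \<longrightarrow>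
    emeasure lborel {x\<in>{0..1}. cmod (F (complex_of_real x)) < \<epsilon>} \<le> ennreal \<delta>"
proof (rule ccontr)
  assume neg: "\<not> ?thesis"
  have "\<exists>F. (F holomorphic_on ball 0 2 \<and> (\<forall>x\<in>ball 0 2. cmod (F x) \<le> M) \<and> cmod (F 0) = 1) \<and>
      \<not> emeasure lborel {x\<in>{0..1}. cmod (F (complex_of_real x)) < 1 / Suc n} \<le> ennreal \<delta>" for n
    using neg by (meson of_nat_0_less_iff zero_less_Suc zero_less_divide_1_iff)
  then have "\<exists>F. \<forall>n. (F n holomorphic_on ball 0 2 \<and> (\<forall>x\<in>ball 0 2. cmod (F n x) \<le> M) \<and> cmod (F n 0) = 1) \<and>
      \<not> emeasure lborel {x\<in>{0..1}. cmod (F n (complex_of_real x)) < 1 / Suc n} \<le> ennreal \<delta>"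
    by (intro choice allI)
  then obtain F where F0: "\<forall>n. (F n holomorphic_on ball 0 2 \<and> (\<forall>x\<in>ball 0 2. cmod (F n x) \<le> M) \<and> cmod (F n 0) = 1) \<and>
      \<not> emeasure lborel {x\<in>{0..1}. cmod (F n (complex_of_real x)) < 1 / Suc n} \<le> ennreal \<delta>"
    by blast
  have F: "\<And>n. F n holomorphic_on ball 0 2" "\<And>n x. x\<in>ball 0 2 \<Longrightarrow> cmod (F n x) \<le> M"
      "\<And>n. cmod (F n 0) = 1"
      "\<And>n. \<not> emeasure lborel {x\<in>{0..1}. cmod (F n (complex_of_real x)) < 1 / Suc n} \<le> ennreal \<delta>"
    using F0 by blast+
  obtain g r where g: "g holomorphic_on ball 0 2" "strict_mono (r :: nat \<Rightarrow> nat)"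
     "\<And>x. x \<in> ball 0 2 \<Longrightarrow> ((\<lambda>n. F (r n) x) \<longlongrightarrow> g x) sequentially"
  proof (rule Montel[of "ball 0 2" "{f. f holomorphic_on ball 0 2 \<and> (\<forall>x\<in>ball 0 2. cmod (f x) \<le> M)}" F])
    show "\<exists>B. \<forall>h\<in>{f. f holomorphic_on ball 0 2 \<and> (\<forall>x\<in>ball 0 2. cmod (f x) \<le> M)}. \<forall>z\<in>K. cmod (h z) \<le> B"
      if "compact K" "K \<subseteq> ball 0 2" for K
      using that by (intro exI[of _ M]) auto
    show "range F \<subseteq> {f. f holomorphic_on ball 0 2 \<and> (\<forall>x\<in>ball 0 2. cmod (f x) \<le> M)}"
      using F(1,2) by blast
  qed auto
  define S where "S n = {x\<in>{0..1}. cmod (F (r n) (complex_of_real x)) < 1 / Suc (r n)}" for n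
  have S_borel: "S n \<in> sets borel" for n
    unfolding S_def
  proof (rule sublevel_borel_on)
    have "continuous_on (complex_of_real ` {0..1}) (F (r n))"
      by (rule continuous_on_subset[OF holomorphic_on_imp_continuous_on[OF F(1)]]) auto
    then show "continuous_on {0..1} (\<lambda>x. cmod (F (r n) (complex_of_real x)))"
      by (intro continuous_on_norm, elim continuous_on_compose2) (auto intro: continuous_intros)
  qed auto
  have S_fin: "A \<subseteq> {0..1} \<Longrightarrow> emeasure lborel A \<noteq> \<infinity>" for A :: "real set"
    using emeasure_mono[of A "{0..1}" lborel] by (auto simp: top_unique)
  have S_ge: "\<delta> \<le> measure lborel (S n)" for n
  proof -
    have "\<not> emeasure lborel (S n) \<le> ennreal \<delta>" unfolding S_def by (rule F(4))
    moreover have "emeasure lborel (S n) \<noteq> \<infinity>" by (rule S_fin) (auto simp: S_def)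
    then have "emeasure lborel (S n) = ennreal (measure lborel (S n))"
      by (intro emeasure_eq_ennreal_measure) simp
    ultimately show ?thesis by (metis ennreal_leI linear)
  qed
  \<comment> \<open>The intersection of these decreasing sets is the limit superior of
    \<open>S\<close>; continuity from above inside the unit interval keeps its measure at least
    \<delta>.\<close>
  define T where "T n = (\<Union>k\<in>{n..}. S k)" for n
  have T_sub: "T n \<subseteq> {0..1}" for n by (auto simp: T_def S_def)
  have T_borel: "T n \<in> sets borel" for n
    unfolding T_def by (intro sets.countable_UN') (auto simp: S_borel)
  have "(\<lambda>n. measure lborel (T n)) \<longlonglongrightarrow> measure lborel (\<Inter>n. T n)"
  proof (rule Lim_measure_decseq)
    show "decseq T" unfolding decseq_def T_def by (intro allI impI UN_mono) auto
  qed (use T_borel S_fin[OF T_sub] in auto)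
  moreover have "\<delta> \<le> measure lborel (T n)" for n
  proof -
    have "measure lborel (S n) \<le> measure lborel (T n)"
      using T_borel S_borel S_fin[OF T_sub]
      by (intro measure_mono_fmeasurable) (auto simp: fmeasurable_def T_def less_top)
    then show ?thesis using S_ge[of n] by simp
  qed
  ultimately have T_pos: "\<delta> \<le> measure lborel (\<Inter>n. T n)"
    by (intro LIMSEQ_le_const) auto
  have zero: "g (complex_of_real x) = 0" if x: "x \<in> (\<Inter>n. T n)" for x
  proof -
    have x01: "x \<in> {0..1}" using x T_sub by blast
    then have lim: "(\<lambda>n. cmod (F (r n) (complex_of_real x))) \<longlonglongrightarrow> cmod (g (complex_of_real x))"
      by (intro tendsto_norm g(3)) auto
    show ?thesis
    proof (rule ccontr)
      assume "g (complex_of_real x) \<noteq> 0"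
      then have pos: "0 < cmod (g (complex_of_real x))" by simp
      have "eventually (\<lambda>n. cmod (F (r n) (complex_of_real x)) > cmod (g (complex_of_real x)) / 2) sequentially"
        using lim pos by (intro order_tendstoD) auto
      moreover have "eventually (\<lambda>n. 1 / real (Suc n) < cmod (g (complex_of_real x)) / 2) sequentially"
        using LIMSEQ_inverse_real_of_nat pos
        by (intro order_tendstoD(2)[of _ 0]) (auto simp: inverse_eq_divide)
      ultimately obtain N where N: "\<And>n. n \<ge> N \<Longrightarrow> cmod (F (r n) (complex_of_real x)) > cmod (g (complex_of_real x)) / 2"
        "\<And>n. n \<ge> N \<Longrightarrow> 1 / real (Suc n) < cmod (g (complex_of_real x)) / 2"
        by (metis (mono_tags, lifting) eventually_at_top_linorder eventually_conj)
      from x obtain k where k: "k \<ge> N" "x \<in> S k" by (auto simp: T_def)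
      \<comment> \<open>The threshold of \<open>S k\<close> is \<open>1 / Suc (r k)\<close>; along
        the subsequence it still tends to zero because of this.\<close>
      have "k \<le> r k" using g(2) by (rule seq_suble)
      then have "1 / real (Suc (r k)) \<le> 1 / real (Suc k)" by (intro divide_left_mono) auto
      then show False using N(1)[OF k(1)] N(2)[OF k(1)] k(2) by (auto simp: S_def)
    qed
  qed
  have inf: "infinite (\<Inter>n. T n)"
  proof
    assume "finite (\<Inter>n. T n)"
    then have "emeasure lborel (\<Inter>n. T n) = 0" by (rule emeasure_lborel_countable[OF countable_finite])
    then show False using T_pos \<delta> by (simp add: Sigma_Algebra.measure_def)
  qed
  have "infinite (complex_of_real ` (\<Inter>n. T n))"
    using inf finite_imageD[of complex_of_real] by (auto simp: inj_on_def)
  moreover have "complex_of_real ` (\<Inter>n. T n) \<subseteq> complex_of_real ` {0..1}" using T_sub by blast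
  moreover have "compact (complex_of_real ` {0..1})"
    by (intro compact_continuous_image continuous_intros) auto
  ultimately obtain l where l: "l \<in> complex_of_real ` {0..1}" "l islimpt complex_of_real ` (\<Inter>n. T n)"
    unfolding compact_eq_Bolzano_Weierstrass by meson
  have "g 0 = 0"
  proof (rule analytic_continuation[OF g(1), of "complex_of_real ` (\<Inter>n. T n)" l])
    show "complex_of_real ` (\<Inter>n. T n) \<subseteq> ball 0 2" using T_sub by force
  qed (use l zero in auto)
  moreover have "(\<lambda>n. cmod (F (r n) 0)) \<longlonglongrightarrow> cmod (g 0)"
    by (intro tendsto_norm g(3)) auto
  ultimately show False using F(3) by (simp add: LIMSEQ_const_iff)
qed

text \<open>Bernstein-Walsh estimate. Inside the disc this is the maximum principle; outside it is
  the maximum principle for the reflected polynomial at \<open>inverse w\<close>, whose moduli on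
  the unit circle obey the same bound.\<close>

lemma poly_norm_le_of_circle:
  fixes p :: "complex poly"
  assumes deg: "degree p \<le> N" and circle: "\<And>w. cmod w = 1 \<Longrightarrow> cmod (poly p w) \<le> H"
  shows "cmod (poly p w) \<le> H * max 1 (cmod w) ^ N"
proof -
  have disc: "cmod (poly q v) \<le> H" if "cmod v \<le> 1" "\<And>w. cmod w = 1 \<Longrightarrow> cmod (poly q w) \<le> H"
    for q :: "complex poly" and v
    by (rule maximum_modulus_frontier[of "poly q" "cball 0 1"])
       (use that in \<open>auto intro!: holomorphic_intros continuous_intros\<close>)
  have H: "0 \<le> H" using circle[of 1] by (auto intro: order_trans[OF norm_ge_zero])
  show ?thesis
  proof (cases "cmod w \<le> 1")
    case True
    then show ?thesis using disc[OF True circle] by (simp add: max_def)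
  next
    case False
    then have w: "w \<noteq> 0" "1 \<le> cmod w" by auto
    have refl: "cmod (poly (reflect_poly p) v) \<le> H" if "cmod v = 1" for v
      using that circle[of "inverse v"] by (subst poly_reflect_poly_nz) (auto simp: norm_mult norm_power norm_inverse)
    have "cmod (inverse w) \<le> 1"
      unfolding norm_inverse using w(2) by (simp add: inverse_le_1_iff)
    then have "cmod (poly (reflect_poly p) (inverse w)) \<le> H"
      by (rule disc) (rule refl)
    have "poly (reflect_poly p) (inverse w) = inverse w ^ degree p * poly p w"
      using w by (subst poly_reflect_poly_nz) auto
    have "cmod (poly p w) \<le> H * cmod w ^ degree p"
    proof -
      have "poly p w = w ^ degree p * poly (reflect_poly p) (inverse w)"
        using w \<open>poly (reflect_poly p) (inverse w) = _\<close> by (simp add: power_inverse field_simps)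
      then show ?thesis
        using \<open>cmod (poly (reflect_poly p) (inverse w)) \<le> H\<close>
        by (simp add: norm_mult norm_power mult.commute[of H] mult_left_mono)
    qed
    also have "\<dots> \<le> H * cmod w ^ N"
      using w deg H by (intro mult_left_mono power_increasing) auto
    finally show ?thesis using w by (simp add: max_def)
  qed
qed

text \<open>Restricted to a great circle, \<open>Q\<close> is a trigonometric polynomial of degree
  at most \<open>L\<close>; the factor \<open>w ^ L\<close> clears its negative powers, so that
  complex polynomials apply.\<close>

lemma great_circle_poly:
  fixes z e :: "real ^ 'n"
  assumes Q: "Q \<in> spherical_polys L" and z: "norm z = 1" "norm e = 1" "z \<bullet> e = 0"
  obtains p where "degree p \<le> 2 * L"
    "\<And>w. cmod w = 1 \<Longrightarrow> poly p w = w ^ L * Q (Re w *\<^sub>R z + Im w *\<^sub>R e)"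
proof -
  from Q obtain c where c: "\<And>x. x \<in> sphere 0 1 \<Longrightarrow>
     Q x = (\<Sum>\<alpha> | (\<Sum>i\<in>UNIV. \<alpha> i) \<le> L. c \<alpha> * of_real (\<Prod>i\<in>UNIV. (x $ i) ^ \<alpha> i))"
    unfolding spherical_polys_def by blast
  \<comment> \<open>On the unit circle this is \<open>w\<close> times the i-th coordinate of the
    point \<open>Re w *\<^sub>R z + Im w *\<^sub>R e\<close>, with
    \<open>Re w = (w + 1/w) / 2\<close> and \<open>Im w = (w - 1/w) / (2 * \<i>)\<close>.\<close>
  define q where "q i = [: Complex (z $ i / 2) (e $ i / 2), 0, Complex (z $ i / 2) (- (e $ i / 2)) :]" for i
  \<comment> \<open>The monomial supplies the powers of \<open>w\<close> that a term of lower degree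
    lacks, so that all terms share the factor \<open>w ^ L\<close>.\<close>
  define p where "p = (\<Sum>\<alpha> | (\<Sum>i\<in>UNIV. \<alpha> i) \<le> L.
      smult (c \<alpha>) (monom 1 (L - (\<Sum>i\<in>UNIV. \<alpha> i)) * (\<Prod>i\<in>UNIV. q i ^ \<alpha> i)))"
  show ?thesis
  proof
    have deg_q: "degree (q i) \<le> 2" for i unfolding q_def
      by (auto simp: degree_pCons_eq_if)
    show "degree p \<le> 2 * L"
      unfolding p_def
    proof (rule degree_sum_le[OF finite_exponents])
      fix \<alpha> :: "'n \<Rightarrow> nat" assume \<alpha>: "\<alpha> \<in> {\<alpha>. (\<Sum>i\<in>UNIV. \<alpha> i) \<le> L}"
      have "degree (\<Prod>i\<in>UNIV. q i ^ \<alpha> i) \<le> (\<Sum>i\<in>UNIV. degree (q i ^ \<alpha> i))"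
        using degree_prod_sum_le[of UNIV "\<lambda>i. q i ^ \<alpha> i"] by (simp add: o_def)
      also have "\<dots> \<le> (\<Sum>i\<in>UNIV. 2 * \<alpha> i)"
      proof (rule sum_mono)
        fix i
        have "degree (q i ^ \<alpha> i) \<le> degree (q i) * \<alpha> i" by (rule degree_power_le)
        also have "\<dots> \<le> 2 * \<alpha> i" using deg_q by (rule mult_right_mono) simp
        finally show "degree (q i ^ \<alpha> i) \<le> 2 * \<alpha> i" .
      qed
      also have "\<dots> = 2 * (\<Sum>i\<in>UNIV. \<alpha> i)" by (simp add: sum_distrib_left)
      finally have d1: "degree (\<Prod>i\<in>UNIV. q i ^ \<alpha> i) \<le> 2 * (\<Sum>i\<in>UNIV. \<alpha> i)" .
      have "degree (smult (c \<alpha>) (monom 1 (L - (\<Sum>i\<in>UNIV. \<alpha> i)) * (\<Prod>i\<in>UNIV. q i ^ \<alpha> i)))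
          \<le> degree (monom (1::complex) (L - (\<Sum>i\<in>UNIV. \<alpha> i)) * (\<Prod>i\<in>UNIV. q i ^ \<alpha> i))"
        by (rule degree_smult_le)
      also have "\<dots> \<le> degree (monom (1::complex) (L - (\<Sum>i\<in>UNIV. \<alpha> i))) + degree (\<Prod>i\<in>UNIV. q i ^ \<alpha> i)"
        by (rule degree_mult_le)
      also have "\<dots> \<le> (L - (\<Sum>i\<in>UNIV. \<alpha> i)) + 2 * (\<Sum>i\<in>UNIV. \<alpha> i)"
        using d1 by (intro add_mono degree_monom_le)
      also have "\<dots> \<le> 2 * L" using \<alpha> by simp
      finally show "degree (smult (c \<alpha>) (monom 1 (L - (\<Sum>i\<in>UNIV. \<alpha> i)) * (\<Prod>i\<in>UNIV. q i ^ \<alpha> i))) \<le> 2 * L" .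
    qed
    fix w :: complex assume w: "cmod w = 1"
    define x where "x = Re w *\<^sub>R z + Im w *\<^sub>R e"
    have w2: "Re w * Re w + Im w * Im w = 1" using w by (simp add: cmod_def power2_eq_square)
    have "norm x ^ 2 = 1\<^sup>2"
      unfolding power2_norm_eq_inner x_def
      using z w2 by (simp add: inner_add_left inner_add_right inner_commute norm_eq_1)
    then have x: "x \<in> sphere 0 1" by (simp add: power2_eq_imp_eq)
    have q_w: "poly (q i) w = w * of_real (x $ i)" for i
    proof (rule complex_eqI)
      have a: "t = t * (Re w * Re w) + t * (Im w * Im w)" for t
        using w2 by (simp flip: distrib_left)
      show "Re (poly (q i) w) = Re (w * of_real (x $ i))"
        using a[of "z $ i"] by (simp add: q_def x_def algebra_simps)
      show "Im (poly (q i) w) = Im (w * of_real (x $ i))"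
        using a[of "e $ i"] by (simp add: q_def x_def algebra_simps)
    qed
    have "poly p w = (\<Sum>\<alpha> | (\<Sum>i\<in>UNIV. \<alpha> i) \<le> L. c \<alpha> * (w ^ (L - (\<Sum>i\<in>UNIV. \<alpha> i)) * (\<Prod>i\<in>UNIV. (w * of_real (x $ i)) ^ \<alpha> i)))"
      by (simp add: p_def poly_sum poly_prod poly_monom q_w)
    also have "\<dots> = (\<Sum>\<alpha> | (\<Sum>i\<in>UNIV. \<alpha> i) \<le> L. w ^ L * (c \<alpha> * of_real (\<Prod>i\<in>UNIV. (x $ i) ^ \<alpha> i)))"
    proof (rule sum.cong)
      fix \<alpha> :: "'n \<Rightarrow> nat" assume \<alpha>: "\<alpha> \<in> {\<alpha>. (\<Sum>i\<in>UNIV. \<alpha> i) \<le> L}"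
      have "w ^ (L - (\<Sum>i\<in>UNIV. \<alpha> i)) * w ^ (\<Sum>i\<in>UNIV. \<alpha> i) = w ^ L"
        using \<alpha> by (simp flip: power_add)
      then show "c \<alpha> * (w ^ (L - (\<Sum>i\<in>UNIV. \<alpha> i)) * (\<Prod>i\<in>UNIV. (w * of_real (x $ i)) ^ \<alpha> i))
          = w ^ L * (c \<alpha> * of_real (\<Prod>i\<in>UNIV. (x $ i) ^ \<alpha> i))"
        by (simp add: power_mult_distrib prod.distrib power_sum[symmetric] mult_ac)
    qed simp
    also have "\<dots> = w ^ L * Q x" by (simp add: c[OF x] sum_distrib_left)
    finally show "poly p w = w ^ L * Q (Re w *\<^sub>R z + Im w *\<^sub>R e)" by (simp add: x_def)
  qed
qed

text \<open>The factor \<open>(1/L) \<Sum>j<L. w\<^sup>j\<close> decays like \<open>1 / (L \<bar>w - 1\<bar>)\<close> on the circle; its \<open>s\<close>-th power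
  compensates the polynomial growth of \<open>Q\<close> away from \<open>z\<close>.\<close>

lemma damped_circle_poly:
  fixes z e :: "real ^ 'n"
  assumes Q: "Q \<in> spherical_polys L" and L: "1 \<le> L" and z: "norm z = 1" "norm e = 1" "z \<bullet> e = 0"
    and growth: "\<And>u. u \<in> sphere 0 1 \<Longrightarrow> cmod (Q u) \<le> \<kappa> * (1 + L * norm (u - z)) ^ s * cmod (Q z)"
  obtains P where "degree P \<le> (s + 2) * L" "cmod (poly P 1) = cmod (Q z)"
    "\<And>w. cmod w = 1 \<Longrightarrow> cmod (poly P w) \<le> \<kappa> * 3 ^ s * cmod (Q z)"
    "\<And>w. cmod w = 1 \<Longrightarrow> cmod (poly P w) \<le> cmod (Q (Re w *\<^sub>R z + Im w *\<^sub>R e))"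
proof -
  obtain p where p: "degree p \<le> 2 * L"
    "\<And>w. cmod w = 1 \<Longrightarrow> poly p w = w ^ L * Q (Re w *\<^sub>R z + Im w *\<^sub>R e)"
    by (rule great_circle_poly[OF Q z]) (rule that)
  define d :: "complex poly" where "d = smult (1 / of_nat L) (\<Sum>j<L. monom 1 j)"
  have deg_d: "degree d \<le> L"
    unfolding d_def
    by (rule order_trans[OF degree_smult_le], rule degree_sum_le)
       (auto intro: order_trans[OF degree_monom_le])
  have poly_d: "poly d w = (1 / of_nat L) * (\<Sum>j<L. w ^ j)" for w
    by (simp add: d_def poly_sum poly_monom)
  have d1: "cmod (poly d w) \<le> 1" if "cmod w = 1" for w
  proof -
    have "cmod (\<Sum>j<L. w ^ j) \<le> (\<Sum>j<L. 1)"
      by (rule order_trans[OF norm_sum], rule sum_mono) (simp add: norm_power that)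
    then show ?thesis using L by (simp add: poly_d norm_mult norm_divide field_simps)
  qed
  have d2: "L * cmod (w - 1) * cmod (poly d w) \<le> 2" if "cmod w = 1" for w
  proof -
    have "L * cmod (w - 1) * cmod (poly d w) = cmod ((w - 1) * (\<Sum>j<L. w ^ j))"
      using L by (simp add: poly_d norm_mult norm_divide)
    also have "(w - 1) * (\<Sum>j<L. w ^ j) = w ^ L - 1" by (simp add: power_diff_1_eq)
    also have "cmod (w ^ L - 1) \<le> 2"
      using norm_triangle_ineq4[of "w ^ L" 1] by (simp add: norm_power that)
    finally show ?thesis .
  qed
  show ?thesis
  proof
    show "degree (p * d ^ s) \<le> (s + 2) * L"
    proof -
      have "degree (p * d ^ s) \<le> degree p + degree d * s"
        using degree_mult_le[of p "d ^ s"] degree_power_le[of d s] by linarith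
      also have "\<dots> \<le> 2 * L + L * s" using p(1) deg_d by (intro add_mono mult_right_mono) auto
      finally show ?thesis by (simp add: algebra_simps)
    qed
    show "cmod (poly (p * d ^ s) 1) = cmod (Q z)"
      using L by (simp add: p(2) poly_d)
    fix w :: complex assume w: "cmod w = 1"
    let ?x = "Re w *\<^sub>R z + Im w *\<^sub>R e"
    have eq: "cmod (poly (p * d ^ s) w) = cmod (Q ?x) * cmod (poly d w) ^ s"
      by (simp add: p(2)[OF w] norm_mult norm_power w)
    show "cmod (poly (p * d ^ s) w) \<le> cmod (Q ?x)"
      unfolding eq using d1[OF w] by (intro mult_left_le power_le_one) auto
    have w2: "Re w * Re w + Im w * Im w = 1" using w by (simp add: cmod_def power2_eq_square)
    have zz: "z \<bullet> z = 1" "e \<bullet> e = 1" "e \<bullet> z = 0" using z by (auto simp: norm_eq_1 inner_commute)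
    have "norm ?x ^ 2 = 1\<^sup>2"
      unfolding power2_norm_eq_inner
      using z zz w2 by (simp add: inner_add_left inner_add_right)
    then have x: "?x \<in> sphere 0 1" by (simp add: power2_eq_imp_eq)
    have "norm (?x - z) ^ 2 = (?x - z) \<bullet> (?x - z)" by (rule power2_norm_eq_inner)
    also have "\<dots> = (Re w - 1)\<^sup>2 + (Im w)\<^sup>2"
      using z zz by (simp add: inner_add_left inner_add_right inner_diff_left inner_diff_right power2_eq_square algebra_simps)
    also have "\<dots> = cmod (w - 1) ^ 2" unfolding cmod_power2 by simp
    finally have "norm (?x - z) ^ 2 = cmod (w - 1) ^ 2" .
    then have nx: "norm (?x - z) = cmod (w - 1)" by (simp add: power2_eq_imp_eq)
    have \<kappa>: "0 \<le> \<kappa> * cmod (Q z)"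
      using growth[of z] z by (auto intro: order_trans[OF norm_ge_zero])
    have "cmod (Q ?x) * cmod (poly d w) ^ s
        \<le> (\<kappa> * (1 + L * cmod (w - 1)) ^ s * cmod (Q z)) * cmod (poly d w) ^ s"
      using growth[OF x] unfolding nx by (intro mult_right_mono) auto
    also have "\<dots> = (\<kappa> * cmod (Q z)) * (cmod (poly d w) + L * cmod (w - 1) * cmod (poly d w)) ^ s"
      by (simp add: power_mult_distrib[symmetric] algebra_simps)
    \<comment> \<open>The 3 is the bound 1 from \<open>d1\<close> plus the bound 2 from
      \<open>d2\<close>: one power of the kernel pays for one power of the growth.\<close>
    also have "\<dots> \<le> (\<kappa> * cmod (Q z)) * 3 ^ s"
      using d1[OF w] d2[OF w] \<kappa> by (intro mult_left_mono power_mono) auto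
    finally show "cmod (poly (p * d ^ s) w) \<le> \<kappa> * 3 ^ s * cmod (Q z)"
      unfolding eq by (simp add: mult_ac)
  qed
qed

text \<open>For real \<xi> the quotient is the point of the unit circle whose angle has tangent
  \<xi>; the lemma continues this parametrization to complex \<xi>. Its squared modulus is
  \<open>cmod (1 + \<i> * \<xi>) / cmod (1 - \<i> * \<xi>)\<close>, at most \<open>1 + 4 * a\<close>
  with \<open>a = 1 / (2 * L)\<close>. A power of order \<open>L\<close> of it therefore stays
  bounded.\<close>

lemma circle_parameter:
  fixes \<xi> :: complex
  assumes L: "1 \<le> (L::nat)" and \<xi>: "cmod \<xi> \<le> 1 / (2 * L)"
  shows "0 < Re (1 + \<xi>\<^sup>2)" "cmod ((1 + \<i> * \<xi>) / csqrt (1 + \<xi>\<^sup>2)) \<le> exp (1 / L)"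
proof -
  define a :: real where "a = 1 / (2 * L)"
  have a: "0 < a" "a \<le> 1 / 2" using L by (auto simp: a_def field_simps)
  have \<xi>a: "cmod \<xi> \<le> a" using \<xi> by (simp add: a_def)
  have "cmod (\<xi>\<^sup>2) \<le> a\<^sup>2" using \<xi>a by (simp add: norm_power power_mono)
  also have "\<dots> \<le> (1 / 2)\<^sup>2" using a by (intro power_mono) auto
  finally have "\<bar>Re (\<xi>\<^sup>2)\<bar> < 1" using abs_Re_le_cmod[of "\<xi>\<^sup>2"] by (simp add: power2_eq_square)
  then show "0 < Re (1 + \<xi>\<^sup>2)" by simp
  have lo: "1 - a \<le> cmod (1 - \<i> * \<xi>)"
    using norm_triangle_ineq2[of 1 "\<i> * \<xi>"] \<xi>a by (simp add: norm_mult)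
  have hi: "cmod (1 + \<i> * \<xi>) \<le> 1 + a"
    using norm_triangle_ineq[of 1 "\<i> * \<xi>"] \<xi>a by (simp add: norm_mult)
  have pos: "0 < cmod (1 - \<i> * \<xi>)" using lo a by linarith
  have fac: "1 + \<xi>\<^sup>2 = (1 + \<i> * \<xi>) * (1 - \<i> * \<xi>)"
    by (simp add: algebra_simps power2_eq_square)
  have "cmod ((1 + \<i> * \<xi>) / csqrt (1 + \<xi>\<^sup>2)) ^ 2 = cmod (1 + \<i> * \<xi>) ^ 2 / cmod (csqrt (1 + \<xi>\<^sup>2) ^ 2)"
    by (simp add: norm_divide power_divide norm_power)
  also have "\<dots> = cmod (1 + \<i> * \<xi>) / cmod (1 - \<i> * \<xi>)"
    using pos by (simp only: power2_csqrt fac norm_mult) (simp add: power2_eq_square)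
  also have "\<dots> \<le> (1 + a) / (1 - a)"
    using lo hi a by (intro frac_le) auto
  also have "\<dots> \<le> 1 + 4 * a"
  proof -
    have "2 * a * a \<le> a" using a mult_right_mono[of "2 * a" 1 a] by simp
    then have "1 + a \<le> (1 + 4 * a) * (1 - a)" by (simp add: algebra_simps)
    then show ?thesis using a by (simp add: divide_le_eq)
  qed
  also have "\<dots> \<le> exp (4 * a)" by (rule exp_ge_add_one_self)
  also have "\<dots> = exp (1 / L) ^ 2"
    using L by (simp add: a_def exp_of_nat_mult[symmetric])
  finally show "cmod ((1 + \<i> * \<xi>) / csqrt (1 + \<xi>\<^sup>2)) \<le> exp (1 / L)"
    by (rule power2_le_imp_le) simp
qed

text \<open>The parameter \<open>l\<close> in the disc of radius 2 makes \<open>l * \<tau>\<close>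
  at most \<open>1 / (2 * L)\<close>, the domain of \<open>circle_parameter\<close>. The damped
  polynomial composed with this parametrization is holomorphic in \<open>l\<close>, has modulus 1 at
  0 after division by \<open>Q z\<close>, and is bounded independently of \<open>L\<close>, so a
  single \<epsilon> serves all degrees.\<close>

lemma ray_small_values:
  fixes \<kappa> \<delta> :: real and s :: nat
  assumes \<delta>: "0 < \<delta>"
  shows "\<exists>\<epsilon>>0. \<forall>L\<ge>1. \<forall>Q\<in>spherical_polys L. \<forall>z e :: real ^ 'n. \<forall>\<tau>.
    norm z = 1 \<and> norm e = 1 \<and> z \<bullet> e = 0 \<and> 0 \<le> \<tau> \<and> \<tau> \<le> 1 / (4 * real L) \<and>
    (\<forall>u\<in>sphere 0 1. cmod (Q u) \<le> \<kappa> * (1 + L * norm (u - z)) ^ s * cmod (Q z)) \<longrightarrow>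
    emeasure lborel {l\<in>{0..1}. cmod (Q (sgn (z + (l * \<tau>) *\<^sub>R e))) < \<epsilon> * cmod (Q z)} \<le> ennreal \<delta>"
proof -
  \<comment> \<open>The bound of the damped polynomial on the circle, times
    \<open>exp (1 / L)\<close> raised to its degree bound \<open>(s + 2) * L\<close>.\<close>
  define M where "M = \<kappa> * 3 ^ s * exp (s + 2)"
  obtain \<epsilon> where \<epsilon>: "0 < \<epsilon>" "\<And>F. F holomorphic_on ball 0 2 \<Longrightarrow> (\<And>x. x\<in>ball 0 2 \<Longrightarrow> cmod (F x) \<le> M) \<Longrightarrow> cmod (F 0) = 1 \<Longrightarrow>
    emeasure lborel {x\<in>{0..1}. cmod (F (complex_of_real x)) < \<epsilon>} \<le> ennreal \<delta>"
    using holomorphic_small_values[OF \<delta>, of M] by blast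
  show ?thesis
  proof (intro exI[of _ \<epsilon>] conjI allI ballI impI \<epsilon>(1))
    fix L :: nat and Q and z e :: "real ^ 'n" and \<tau> :: real
    assume L: "1 \<le> L" and Q: "Q \<in> spherical_polys L"
      and "norm z = 1 \<and> norm e = 1 \<and> z \<bullet> e = 0 \<and> 0 \<le> \<tau> \<and> \<tau> \<le> 1 / (4 * real L) \<and>
        (\<forall>u\<in>sphere 0 1. cmod (Q u) \<le> \<kappa> * (1 + L * norm (u - z)) ^ s * cmod (Q z))"
    then have z: "norm z = 1" "norm e = 1" "z \<bullet> e = 0" and \<tau>: "0 \<le> \<tau>" "\<tau> \<le> 1 / (4 * real L)"
      and growth: "\<And>u. u \<in> sphere 0 1 \<Longrightarrow> cmod (Q u) \<le> \<kappa> * (1 + L * norm (u - z)) ^ s * cmod (Q z)"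
      by auto
    show "emeasure lborel {l\<in>{0..1}. cmod (Q (sgn (z + (l * \<tau>) *\<^sub>R e))) < \<epsilon> * cmod (Q z)} \<le> ennreal \<delta>"
    proof (cases "Q z = 0")
      case True
      then show ?thesis by simp
    next
      case False
      obtain P where P: "degree P \<le> (s + 2) * L" "cmod (poly P 1) = cmod (Q z)"
        "\<And>w. cmod w = 1 \<Longrightarrow> cmod (poly P w) \<le> \<kappa> * 3 ^ s * cmod (Q z)"
        "\<And>w. cmod w = 1 \<Longrightarrow> cmod (poly P w) \<le> cmod (Q (Re w *\<^sub>R z + Im w *\<^sub>R e))"
        by (rule damped_circle_poly[OF Q L z growth]) (assumption, rule that)
      define W where "W l = (1 + \<i> * (l * \<tau>)) / csqrt (1 + (l * \<tau>)\<^sup>2)" for l :: complex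
      define F where "F l = poly P (W l) / Q z" for l
      have small: "cmod (l * complex_of_real \<tau>) \<le> 1 / (2 * real L)" if "l \<in> ball 0 2" for l :: complex
      proof -
        have "cmod (l * complex_of_real \<tau>) \<le> 2 * (1 / (4 * real L))"
          using that \<tau> unfolding norm_mult by (intro mult_mono) auto
        then show ?thesis by simp
      qed
      have W_holo: "W holomorphic_on ball 0 2"
        unfolding W_def
      proof (intro holomorphic_intros)
        fix l :: complex assume l: "l \<in> ball 0 2"
        have pos: "0 < Re (1 + (l * \<tau>)\<^sup>2)" by (rule circle_parameter(1)[OF L small[OF l]])
        then show "1 + (l * \<tau>)\<^sup>2 \<notin> \<real>\<^sub>\<le>\<^sub>0" by (auto simp: complex_nonpos_Reals_iff)
        show "csqrt (1 + (l * \<tau>)\<^sup>2) \<noteq> 0" using pos by (metis csqrt_eq_0 less_irrefl zero_complex.simps(1))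
      qed
      have F_holo: "F holomorphic_on ball 0 2"
        unfolding F_def using False by (intro holomorphic_intros W_holo) auto
      have F_bound: "cmod (F l) \<le> M" if l: "l \<in> ball 0 2" for l
      proof -
        have W: "cmod (W l) \<le> exp (1 / L)" unfolding W_def by (rule circle_parameter(2)[OF L small[OF l]])
        have H: "0 \<le> \<kappa> * 3 ^ s * cmod (Q z)" using P(3)[of 1] by (auto intro: order_trans[OF norm_ge_zero])
        have "cmod (poly P (W l)) \<le> \<kappa> * 3 ^ s * cmod (Q z) * max 1 (cmod (W l)) ^ ((s + 2) * L)"
          by (rule poly_norm_le_of_circle[OF P(1,3)])
        also have "\<dots> \<le> \<kappa> * 3 ^ s * cmod (Q z) * exp (1 / L) ^ ((s + 2) * L)"
          using W H by (intro mult_left_mono power_mono) auto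
        also have "exp (1 / L) ^ ((s + 2) * L) = exp (s + 2)"
          using L by (simp add: exp_of_nat_mult[symmetric] add_divide_distrib)
        finally show ?thesis using False by (simp add: F_def M_def norm_divide divide_le_eq mult_ac)
      qed
      have F0: "cmod (F 0) = 1" using P(2) False by (simp add: F_def W_def norm_divide)
      \<comment> \<open>Damping only lowers the modulus on the circle, so small values of
        \<open>Q\<close> are small values of \<open>F\<close>.\<close>
      have sub: "{l\<in>{0..1}. cmod (Q (sgn (z + (l * \<tau>) *\<^sub>R e))) < \<epsilon> * cmod (Q z)}
          \<subseteq> {x\<in>{0..1}. cmod (F (complex_of_real x)) < \<epsilon>}"
      proof safe
        fix l :: real assume l: "l \<in> {0..1}" "cmod (Q (sgn (z + (l * \<tau>) *\<^sub>R e))) < \<epsilon> * cmod (Q z)"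
        define t where "t = l * \<tau>"
        define r where "r = sqrt (1 + t\<^sup>2)"
        have r: "0 < r" "r * r = 1 + t * t" by (auto simp: r_def add_pos_nonneg power2_eq_square[symmetric])
        have "csqrt (1 + (complex_of_real l * complex_of_real \<tau>)\<^sup>2) = complex_of_real r"
        proof -
          have "1 + (complex_of_real l * complex_of_real \<tau>)\<^sup>2 = complex_of_real (1 + t\<^sup>2)"
            by (simp add: t_def)
          then show ?thesis by (simp only: r_def) (subst csqrt_of_real_nonneg, auto)
        qed
        then have W: "W (complex_of_real l) = Complex (1 / r) (t / r)"
          unfolding W_def t_def by (simp add: complex_eq_iff)
        have "cmod (W l) ^ 2 = (1 + t * t) / (r * r)"
          unfolding W cmod_power2 by (simp add: power2_eq_square add_divide_distrib)
        then have "cmod (W l) ^ 2 = 1\<^sup>2" using r(1) by (simp only: r(2)[symmetric]) simp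
        then have W1: "cmod (W l) = 1" by (simp add: power2_eq_imp_eq)
        have "norm (z + t *\<^sub>R e) ^ 2 = r ^ 2"
          unfolding power2_norm_eq_inner using z
          by (simp add: inner_add_left inner_add_right inner_commute norm_eq_1 r(2) power2_eq_square)
        then have "norm (z + t *\<^sub>R e) = r" using r(1) by (simp add: power2_eq_imp_eq)
        then have "sgn (z + t *\<^sub>R e) = Re (W l) *\<^sub>R z + Im (W l) *\<^sub>R e"
          unfolding W sgn_div_norm by (simp add: scaleR_add_right divide_inverse mult.commute)
        then have "cmod (poly P (W l)) \<le> cmod (Q (sgn (z + t *\<^sub>R e)))" using P(4)[OF W1] by simp
        then show "cmod (F (complex_of_real l)) < \<epsilon>"
          using l(2) False by (simp add: F_def norm_divide divide_less_eq t_def)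
      qed
      have "emeasure lborel {l\<in>{0..1}. cmod (Q (sgn (z + (l * \<tau>) *\<^sub>R e))) < \<epsilon> * cmod (Q z)}
         \<le> emeasure lborel {x\<in>{0..1}. cmod (F (complex_of_real x)) < \<epsilon>}"
      proof (rule emeasure_mono[OF sub])
        have "continuous_on (complex_of_real ` {0..1}) F"
          by (rule continuous_on_subset[OF holomorphic_on_imp_continuous_on[OF F_holo]]) auto
        then have "continuous_on {0..1} (\<lambda>x. cmod (F (complex_of_real x)))"
          by (intro continuous_on_norm, elim continuous_on_compose2) (auto intro: continuous_intros)
        then show "{x\<in>{0..1}. cmod (F (complex_of_real x)) < \<epsilon>} \<in> sets lborel"
          unfolding sets_lborel by (rule sublevel_borel_on) auto
      qed
      also have "\<dots> \<le> ennreal \<delta>" by (rule \<epsilon>(2)[OF F_holo F_bound F0])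
      finally show ?thesis .
    qed
  qed
qed

section \<open>Rotation invariance, stretchings and cones\<close>

text \<open>The surface measure before completion, pushed to the whole space: it lives on the Polish
  space \<open>real ^ 'n\<close> with all Borel sets, as the covering arguments require.\<close>

definition sphere_measure :: "(real ^ 'n) measure" where
  "sphere_measure = scale_measure (of_nat CARD('n))
     (distr (restrict_space lborel (cball 0 1 - {0})) borel sgn)"

abbreviation "\<sigma> \<equiv> measure sphere_measure"

lemma sets_sphere_measure [simp]: "sets sphere_measure = sets borel"
  by (simp add: sphere_measure_def)

lemma space_sphere_measure [simp]: "space sphere_measure = UNIV"
  by (simp add: sphere_measure_def space_scale_measure)

lemma sgn_borel_measurable: "sgn \<in> borel_measurable (borel :: (real ^ 'n) measure)"
  unfolding sgn_div_norm by measurable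

lemma emeasure_sphere_measure:
  fixes A :: "(real ^ 'n) set"
  assumes "A \<in> sets borel"
  shows "emeasure sphere_measure A =
    of_nat CARD('n) * emeasure lborel {x \<in> cball 0 1. x \<noteq> 0 \<and> sgn x \<in> A}"
proof -
  let ?D = "cball 0 1 - {0} :: (real ^ 'n) set"
  have m: "sgn \<in> restrict_space lborel ?D \<rightarrow>\<^sub>M borel"
    using sgn_borel_measurable by (intro measurable_restrict_space1) simp
  have "emeasure (distr (restrict_space lborel ?D) borel sgn) A =
      emeasure (restrict_space lborel ?D) (sgn -` A \<inter> ?D)"
    using assms m by (subst emeasure_distr) (auto simp: space_restrict_space)
  also have "\<dots> = emeasure lborel (sgn -` A \<inter> ?D)"
    by (intro emeasure_restrict_space) (auto intro: borel_closed)
  also have "sgn -` A \<inter> ?D = {x \<in> cball 0 1. x \<noteq> 0 \<and> sgn x \<in> A}"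
    by auto
  finally show ?thesis
    by (simp add: sphere_measure_def)
qed

lemma surface_measure_eq_completion:
  "surface_measure = completion (restrict_space sphere_measure (sphere 0 1 :: (real ^ 'n) set))"
proof -
  let ?N = "scale_measure (of_nat CARD('n))
     (distr (restrict_space lborel (cball 0 1 - {0})) (restrict_space borel (sphere 0 1)) sgn) :: (real ^ 'n) measure"
  have "?N = restrict_space sphere_measure (sphere 0 1)"
  proof (rule measure_eqI)
    show sets: "sets ?N = sets (restrict_space sphere_measure (sphere 0 1))"
      by (simp add: sets_restrict_space)
    fix A assume "A \<in> sets ?N"
    then have A: "A \<in> sets borel" "A \<subseteq> sphere 0 1" by (auto simp: sets_restrict_space)
    have "emeasure ?N A = emeasure surface_measure A"
      unfolding surface_measure_def using \<open>A \<in> sets ?N\<close> by simp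
    then show "emeasure ?N A = emeasure (restrict_space sphere_measure (sphere 0 1)) A"
      using A by (simp add: emeasure_surface_measure emeasure_restrict_space emeasure_sphere_measure borel_closed)
  qed
  then show ?thesis by (simp add: surface_measure_def)
qed

lemma finite_sphere_measure: "finite_measure (sphere_measure :: (real ^ 'n) measure)"
proof
  have "emeasure lborel {x \<in> cball 0 1. x \<noteq> 0 \<and> sgn x \<in> (UNIV :: (real ^ 'n) set)} \<le> emeasure lborel (cball 0 1 :: (real ^ 'n) set)"
    by (intro emeasure_mono) auto
  also have "\<dots> < \<infinity>" by (intro emeasure_bounded_finite) auto
  finally show "emeasure sphere_measure (space (sphere_measure :: (real ^ 'n) measure)) \<noteq> \<infinity>"
    by (simp add: emeasure_sphere_measure ennreal_mult_eq_top_iff)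
qed

interpretation sm: finite_measure "sphere_measure :: (real ^ 'n) measure"
  by (rule finite_sphere_measure)

lemma sphere_measure_outside: "\<sigma> (- sphere 0 1 :: (real ^ 'n) set) = 0"
proof -
  have "{x \<in> cball 0 1. x \<noteq> 0 \<and> sgn x \<in> (- sphere 0 1 :: (real ^ 'n) set)} = {}"
    by (auto simp: norm_sgn)
  then have "emeasure sphere_measure (- sphere 0 1 :: (real ^ 'n) set) = 0"
    by (subst emeasure_sphere_measure) (auto simp: Compl_eq_Diff_UNIV simp del: Collect_empty_eq intro!: sets.Diff)
  then show ?thesis by (simp add: Sigma_Algebra.measure_def)
qed

text \<open>A linear map that moves directions along the great circles through \<open>z\<close>,
  multiplying the tangent of the angle to \<open>z\<close> by \<open>l\<close>. It serves as a
  substitute for geodesic dilation of a cap with a constant Jacobian.\<close>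

definition stretch :: "real ^ 'n \<Rightarrow> real \<Rightarrow> real ^ 'n \<Rightarrow> real ^ 'n" where
  "stretch z l x = (x \<bullet> z) *\<^sub>R z + l *\<^sub>R (x - (x \<bullet> z) *\<^sub>R z)"

text \<open>Both \<open>lborel\<close> and its image under \<open>f\<close> are translation invariant, and Fubini shows that such
  measures are proportional; the unit ball fixes the factor.\<close>

lemma lborel_distr_orthogonal:
  fixes f :: "'a::euclidean_space \<Rightarrow> 'a"
  assumes f: "orthogonal_transformation f"
  shows "distr lborel borel f = lborel"
proof (rule measure_eqI)
  let ?M = "distr lborel borel f" and ?B = "ball 0 1 :: 'a set"
  have lin: "linear f" and inj: "inj f" and surj: "surj f"
    by (rule orthogonal_transformation_linear[OF f] orthogonal_transformation_inj[OF f]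
      orthogonal_transformation_surj[OF f])+
  have [measurable]: "f \<in> borel_measurable borel"
    using lin by (intro borel_measurable_continuous_onI linear_continuous_on linear_conv_bounded_linear[THEN iffD1])
  have isom: "dist (f x) (f y) = dist x y" for x y
    using f orthogonal_transformation_isometry by blast
  have M: "emeasure ?M A = emeasure lborel (f -` A)" if "A \<in> sets borel" for A
    using that by (subst emeasure_distr) auto
  have ball_M: "emeasure ?M (ball y r) = emeasure lborel (ball 0 r :: 'a set)" for y r
  proof -
    obtain b where b: "y = f b" using surj by blast
    have "f -` ball y r = ball b r" by (auto simp: b isom)
    moreover have "emeasure lborel (ball b r) = emeasure lborel (ball 0 r :: 'a set)"
    proof -
      have "emeasure lborel (ball 0 r :: 'a set) = emeasure (distr lborel borel ((+) (- b))) (ball 0 r)"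
        by (simp add: lborel_distr_plus)
      also have "\<dots> = emeasure lborel ((+) (- b) -` ball 0 r)" by (subst emeasure_distr) auto
      also have "(+) (- b) -` ball 0 r = ball b r" by (auto simp: dist_norm norm_minus_commute)
      finally show ?thesis by simp
    qed
    ultimately show ?thesis by (simp add: M)
  qed
  have shift_L: "(\<integral>\<^sup>+y. h (x + y) \<partial>lborel) = (\<integral>\<^sup>+y. h y \<partial>lborel)"
    if [measurable]: "h \<in> borel_measurable borel" for h and x :: 'a
    by (subst (2) lborel_distr_plus[of x, symmetric]) (simp add: nn_integral_distr)
  have shift_M: "emeasure ?M {x. x + y \<in> A} = emeasure ?M A" if A: "A \<in> sets borel" for A y
  proof -
    obtain b where b: "y = f b" using surj by blast
    have [measurable]: "{x. x + y \<in> A} \<in> sets borel" using A by measurable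
    then have "emeasure ?M {x. x + y \<in> A} = emeasure lborel (f -` {x. x + y \<in> A})" by (rule M)
    also have "f -` {x. x + y \<in> A} = (+) b -` (f -` A)"
      unfolding b by (auto simp: linear_add[OF lin] add.commute)
    also have "emeasure lborel ((+) b -` (f -` A)) = emeasure (distr lborel borel ((+) b)) (f -` A)"
      using A measurable_sets[of f borel borel A] by (subst emeasure_distr) auto
    also have "\<dots> = emeasure ?M A" by (simp add: lborel_distr_plus M[OF A])
    finally show ?thesis .
  qed
  interpret M: sigma_finite_measure ?M
  proof
    show "\<exists>A. countable A \<and> A \<subseteq> sets ?M \<and> \<Union> A = space ?M \<and> (\<forall>a\<in>A. emeasure ?M a \<noteq> \<infinity>)"
    proof (intro exI[of _ "range (\<lambda>n. ball 0 (real n))"] conjI ballI)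
      show "\<Union> (range (\<lambda>n. ball 0 (real n))) = space ?M" using reals_Archimedean2 by auto
      fix a assume "a \<in> range (\<lambda>n. ball (0::'a) (real n))"
      then show "emeasure ?M a \<noteq> \<infinity>"
        using emeasure_lborel_ball_finite by (auto simp: ball_M less_top)
    qed auto
  qed
  interpret P: pair_sigma_finite lborel ?M ..
  fix A assume "A \<in> sets ?M"
  then have A [measurable]: "A \<in> sets borel" by simp
  have ind: "(\<lambda>p. indicator S (g p) :: ennreal) \<in> borel_measurable (lborel \<Otimes>\<^sub>M ?M)"
    if "g \<in> (borel \<Otimes>\<^sub>M borel) \<rightarrow>\<^sub>M borel" "S \<in> sets borel" for g and S :: "'a set"
  proof -
    have "sets (lborel \<Otimes>\<^sub>M ?M) = sets (borel \<Otimes>\<^sub>M borel)" by (intro sets_pair_measure_cong) auto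
    then have "g \<in> (lborel \<Otimes>\<^sub>M ?M) \<rightarrow>\<^sub>M borel" using that(1) measurable_cong_sets by blast
    from measurable_compose[OF this borel_measurable_indicator[OF that(2)]] show ?thesis .
  qed
  have ind1: "case_prod (\<lambda>y x. indicator ?B y * indicator A (x + y) :: ennreal) \<in> borel_measurable (lborel \<Otimes>\<^sub>M ?M)"
    unfolding case_prod_beta using ind[of fst ?B] ind[of "\<lambda>p. snd p + fst p" A]
    by (intro borel_measurable_times_ennreal) auto
  have ind2: "case_prod (\<lambda>y x. indicator ?B (y - x) * indicator A y :: ennreal) \<in> borel_measurable (lborel \<Otimes>\<^sub>M ?M)"
    unfolding case_prod_beta using ind[of "\<lambda>p. fst p - snd p" ?B] ind[of fst A]
    by (intro borel_measurable_times_ennreal) auto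
  have "emeasure lborel ?B * emeasure ?M A = (\<integral>\<^sup>+y. indicator ?B y * emeasure ?M A \<partial>lborel)"
    by (subst nn_integral_multc) (auto intro!: borel_measurable_indicator)
  also have "\<dots> = (\<integral>\<^sup>+y. indicator ?B y * (\<integral>\<^sup>+x. indicator A (x + y) \<partial>?M) \<partial>lborel)"
  proof -
    have "(\<integral>\<^sup>+x. indicator A (x + y) \<partial>?M) = emeasure ?M A" for y
    proof -
      have [measurable]: "{x. x + y \<in> A} \<in> sets borel" using A by measurable
      have "(\<integral>\<^sup>+x. indicator A (x + y) \<partial>?M) = (\<integral>\<^sup>+x. indicator {x. x + y \<in> A} x \<partial>?M)"
        by (intro nn_integral_cong) (auto simp: indicator_def)
      then show ?thesis by (simp add: shift_M[OF A])
    qed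
    then show ?thesis by simp
  qed
  also have "\<dots> = (\<integral>\<^sup>+y. (\<integral>\<^sup>+x. indicator ?B y * indicator A (x + y) \<partial>?M) \<partial>lborel)"
    by (intro nn_integral_cong nn_integral_cmult[symmetric]) measurable
  also have "\<dots> = (\<integral>\<^sup>+x. (\<integral>\<^sup>+y. indicator ?B y * indicator A (x + y) \<partial>lborel) \<partial>?M)"
    by (rule P.Fubini'[OF ind1, symmetric])
  also have "\<dots> = (\<integral>\<^sup>+x. (\<integral>\<^sup>+y. indicator ?B (y - x) * indicator A y \<partial>lborel) \<partial>?M)"
  proof (rule nn_integral_cong)
    fix x :: 'a
    let ?h = "\<lambda>y. indicator ?B (y - x) * indicator A y :: ennreal"
    have "(\<lambda>y. indicator ?B (y - x) :: ennreal) \<in> borel_measurable borel"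
      by (rule measurable_compose[of _ borel borel, OF _ borel_measurable_indicator]) auto
    then have "?h \<in> borel_measurable borel"
      using borel_measurable_indicator[OF A] by (rule borel_measurable_times_ennreal)
    from shift_L[OF this, of x]
    show "(\<integral>\<^sup>+y. indicator ?B y * indicator A (x + y) \<partial>lborel) = (\<integral>\<^sup>+y. ?h y \<partial>lborel)" by simp
  qed
  also have "\<dots> = (\<integral>\<^sup>+y. (\<integral>\<^sup>+x. indicator ?B (y - x) * indicator A y \<partial>?M) \<partial>lborel)"
    by (rule P.Fubini'[OF ind2])
  also have "\<dots> = (\<integral>\<^sup>+y. emeasure lborel ?B * indicator A y \<partial>lborel)"
  proof (intro nn_integral_cong)
    fix y :: 'a
    have "y - x \<in> ?B \<longleftrightarrow> x \<in> ball y 1" for x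
      unfolding mem_ball dist_norm by (simp add: norm_minus_commute)
    then have "(\<integral>\<^sup>+x. indicator ?B (y - x) * indicator A y \<partial>?M) = (\<integral>\<^sup>+x. indicator (ball y 1) x * indicator A y \<partial>?M)"
      by (simp add: indicator_def)
    also have "\<dots> = emeasure ?M (ball y 1) * indicator A y" by (subst nn_integral_multc) (auto intro!: borel_measurable_indicator)
    finally show "(\<integral>\<^sup>+x. indicator ?B (y - x) * indicator A y \<partial>?M) = emeasure lborel ?B * indicator A y"
      by (simp add: ball_M)
  qed
  also have "\<dots> = emeasure lborel ?B * emeasure lborel A"
    by (simp add: nn_integral_cmult)
  finally have "emeasure lborel ?B * emeasure ?M A = emeasure lborel ?B * emeasure lborel A" .
  moreover have "emeasure lborel ?B \<noteq> 0" "emeasure lborel ?B \<noteq> \<infinity>"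
    using emeasure_lborel_ball_finite[of 0 1] by (auto simp: emeasure_ball less_top unit_ball_vol_pos less_imp_neq[symmetric])
  ultimately show "emeasure ?M A = emeasure lborel A"
    by (auto simp: ennreal_mult_cancel_left)
qed simp

text \<open>A rotation taking a coordinate vector to \<open>z\<close> makes the map diagonal, with
  one entry 1 and the other entries \<open>l\<close>.\<close>

lemma emeasure_stretch_vimage:
  fixes z :: "real ^ 'n"
  assumes z: "norm z = 1" and l: "0 < l" and S: "S \<in> sets borel"
  shows "emeasure lborel S = ennreal (l ^ (CARD('n) - 1)) * emeasure lborel {x. stretch z l x \<in> S}"
proof -
  obtain k :: 'n where True by simp
  let ?e = "axis k 1 :: real ^ 'n"
  obtain f where f: "orthogonal_transformation f" "f ?e = z"
    using orthogonal_transformation_exists_1[of ?e z] z by auto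
  have lin: "linear f" using f(1) by (rule orthogonal_transformation_linear)
  have f_borel [measurable]: "f \<in> borel_measurable borel"
    using lin by (intro borel_measurable_continuous_onI linear_continuous_on linear_conv_bounded_linear[THEN iffD1])
  have st_borel [measurable]: "stretch v l \<in> borel_measurable borel" for v :: "real ^ 'n"
    unfolding stretch_def by (intro borel_measurable_continuous_onI continuous_intros)
  have rot: "emeasure lborel (f -` A) = emeasure lborel A" if "A \<in> sets borel" for A
    using that by (subst (2) lborel_distr_orthogonal[OF f(1), symmetric]) (simp add: emeasure_distr)
  have eq: "stretch z l (f y) = f (stretch ?e l y)" for y
  proof -
    have "f y \<bullet> z = y \<bullet> ?e" using f by (metis orthogonal_transformation_def)
    then show ?thesis
      using lin f(2) by (simp add: stretch_def linear_add linear_diff linear_scale)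
  qed
  define S' where "S' = f -` S"
  have S': "S' \<in> sets borel" using measurable_sets[OF f_borel S] by (simp add: S'_def)
  have pre: "{x. stretch z l x \<in> S} \<in> sets borel" using measurable_sets[OF st_borel S] by (simp add: vimage_def)
  define c where "c j = (if j = ?e then 1 else l)" for j :: "real ^ 'n"
  have e_Basis: "?e \<in> Basis" by (simp add: axis_in_Basis_iff)
  have st: "stretch ?e l = (\<lambda>x. 0 + (\<Sum>j\<in>Basis. (c j * (x \<bullet> j)) *\<^sub>R j))"
  proof (rule ext, rule euclidean_eqI)
    fix x and b :: "real ^ 'n" assume b: "b \<in> Basis"
    have "(\<Sum>j\<in>Basis. (c j * (x \<bullet> j)) *\<^sub>R j) \<bullet> b = c b * (x \<bullet> b)"
      by (simp only: inner_sum_left_Basis[OF b])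
    moreover have "stretch ?e l x \<bullet> b = c b * (x \<bullet> b)"
      using b e_Basis by (auto simp: stretch_def c_def inner_add_left inner_diff_left inner_Basis)
    ultimately show "stretch ?e l x \<bullet> b = (0 + (\<Sum>j\<in>Basis. (c j * (x \<bullet> j)) *\<^sub>R j)) \<bullet> b" by simp
  qed
  have "lborel = density (distr lborel borel (stretch ?e l)) (\<lambda>_. \<Prod>j\<in>Basis. \<bar>c j\<bar>)"
    unfolding st using l by (intro lborel_affine_euclidean) (auto simp: c_def)
  moreover have "(\<Prod>j\<in>Basis. \<bar>c j\<bar>) = l ^ (CARD('n) - 1)"
  proof -
    have "(\<Prod>j\<in>Basis. \<bar>c j\<bar>) = \<bar>c ?e\<bar> * (\<Prod>j\<in>Basis - {?e}. \<bar>c j\<bar>)"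
      using e_Basis by (intro prod.remove) auto
    also have "(\<Prod>j\<in>Basis - {?e}. \<bar>c j\<bar>) = (\<Prod>j\<in>(Basis :: (real ^ 'n) set) - {?e}. l)"
      using l by (intro prod.cong) (auto simp: c_def)
    also have "\<dots> = l ^ (CARD('n) - 1)" using e_Basis by (simp add: card_Diff_singleton)
    finally show ?thesis by (simp add: c_def)
  qed
  ultimately have L: "lborel = density (distr lborel borel (stretch ?e l)) (\<lambda>_. ennreal (l ^ (CARD('n) - 1)))"
    by simp
  have "emeasure lborel S = emeasure lborel S'" using rot[OF S] by (simp add: S'_def)
  also have "\<dots> = ennreal (l ^ (CARD('n) - 1)) * emeasure (distr lborel borel (stretch ?e l)) S'"
    by (subst L) (use S' in \<open>simp add: emeasure_density_const\<close>)
  also have "emeasure (distr lborel borel (stretch ?e l)) S' = emeasure lborel (stretch ?e l -` S')"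
    using S' by (subst emeasure_distr) auto
  also have "stretch ?e l -` S' = f -` {x. stretch z l x \<in> S}"
    by (auto simp: S'_def eq)
  also have "emeasure lborel \<dots> = emeasure lborel {x. stretch z l x \<in> S}" by (rule rot[OF pre])
  finally show ?thesis .
qed

text \<open>Cut off by the hyperplane \<open>x \<bullet> z = 1\<close> rather than by the unit
  sphere, because \<open>stretch z l\<close> preserves \<open>x \<bullet> z\<close> but not the
  norm. Volumes of such cones over caps then scale exactly.\<close>

definition cone_over :: "real ^ 'n \<Rightarrow> (real ^ 'n) set \<Rightarrow> (real ^ 'n) set" where
  "cone_over z A = {x. 0 < x \<bullet> z \<and> x \<bullet> z \<le> 1 \<and> sgn x \<in> A}"

text \<open>For positive \<open>t\<close>, the cap of angular radius \<open>arctan t\<close>; with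
  the tangent as parameter, stretching by \<open>l\<close> turns \<open>t\<close> into
  \<open>l * t\<close>.\<close>

definition tan_cap :: "real ^ 'n \<Rightarrow> real \<Rightarrow> (real ^ 'n) set" where
  "tan_cap z t = {u \<in> sphere 0 1. norm (u - (u \<bullet> z) *\<^sub>R z) < t * (u \<bullet> z)}"

lemma tan_cap_borel: "tan_cap z t \<in> sets borel"
proof -
  have "open {u. norm (u - (u \<bullet> z) *\<^sub>R z) < t * (u \<bullet> z)}"
    by (intro open_Collect_less continuous_intros)
  then have "sphere 0 1 \<inter> {u. norm (u - (u \<bullet> z) *\<^sub>R z) < t * (u \<bullet> z)} \<in> sets borel"
    by (intro sets.Int) (auto intro: borel_closed borel_open)
  also have "sphere 0 1 \<inter> {u. norm (u - (u \<bullet> z) *\<^sub>R z) < t * (u \<bullet> z)} = tan_cap z t"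
    by (auto simp: tan_cap_def)
  finally show ?thesis .
qed

lemma tan_cap_pos: "u \<in> tan_cap z t \<Longrightarrow> 0 < t \<Longrightarrow> 0 < u \<bullet> z"
proof -
  assume "u \<in> tan_cap z t" "0 < t"
  then have "0 < t * (u \<bullet> z)"
    using order.strict_trans1[OF norm_ge_zero] by (auto simp: tan_cap_def)
  then show ?thesis using \<open>0 < t\<close> by (rule zero_less_mult_pos)
qed

lemma tan_cap_mono: "t \<le> t' \<Longrightarrow> 0 < t \<Longrightarrow> tan_cap z t \<subseteq> tan_cap z t'"
proof
  fix u assume t: "t \<le> t'" "0 < t" and u: "u \<in> tan_cap z t"
  then have "t * (u \<bullet> z) \<le> t' * (u \<bullet> z)" using tan_cap_pos[OF u] by (intro mult_right_mono) auto
  then show "u \<in> tan_cap z t'" using u by (auto simp: tan_cap_def)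
qed

lemma cone_over_borel: "A \<in> sets borel \<Longrightarrow> cone_over z A \<in> sets borel"
proof -
  assume A: "A \<in> sets borel"
  have "cone_over z A = {x. 0 < x \<bullet> z} \<inter> {x. x \<bullet> z \<le> 1} \<inter> (sgn -` A \<inter> space borel)"
    by (auto simp: cone_over_def)
  also have "\<dots> \<in> sets borel"
    by (intro sets.Int measurable_sets[OF sgn_borel_measurable A] borel_open borel_closed
      open_Collect_less closed_Collect_le continuous_intros)
  finally show ?thesis .
qed

lemma perp_sgn: "sgn x - (sgn x \<bullet> z) *\<^sub>R z = (1 / norm x) *\<^sub>R (x - (x \<bullet> z) *\<^sub>R z)"
  unfolding sgn_div_norm inner_scaleR_left by (simp add: scaleR_diff_right divide_inverse)

lemma cone_over_tan_cap:
  assumes "0 < t"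
  shows "cone_over z (tan_cap z t) = {x. x \<bullet> z \<le> 1 \<and> norm (x - (x \<bullet> z) *\<^sub>R z) < t * (x \<bullet> z)}"
proof -
  have "sgn x \<in> tan_cap z t \<longleftrightarrow> norm (x - (x \<bullet> z) *\<^sub>R z) < t * (x \<bullet> z)" if "0 < x \<bullet> z" for x
  proof -
    have x: "0 < norm x" using that by auto
    have "sgn x \<in> tan_cap z t \<longleftrightarrow> norm (x - (x \<bullet> z) *\<^sub>R z) / norm x < t * (x \<bullet> z) / norm x"
      using x by (simp add: tan_cap_def norm_sgn perp_sgn) (simp add: sgn_div_norm divide_inverse mult_ac)
    also have "\<dots> \<longleftrightarrow> norm (x - (x \<bullet> z) *\<^sub>R z) < t * (x \<bullet> z)"
      using x by (simp add: divide_less_cancel)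
    finally show ?thesis .
  qed
  moreover have "0 < x \<bullet> z" if "norm (x - (x \<bullet> z) *\<^sub>R z) < t * (x \<bullet> z)" for x
    using order.strict_trans1[OF norm_ge_zero that] assms by (rule zero_less_mult_pos)
  ultimately show ?thesis unfolding cone_over_def by blast
qed

lemma norm_le_of_tan_cap:
  fixes x z :: "real ^ 'n"
  assumes "norm z = 1" "0 < t" "t \<le> 1" "0 < x \<bullet> z" "sgn x \<in> tan_cap z t"
  shows "norm x \<le> 2 * (x \<bullet> z)"
proof -
  have x: "0 < norm x" using assms(4) by auto
  have "norm (sgn x - (sgn x \<bullet> z) *\<^sub>R z) < t * (sgn x \<bullet> z)"
    using assms(5) by (simp add: tan_cap_def)
  then have "norm (x - (x \<bullet> z) *\<^sub>R z) / norm x < t * (x \<bullet> z) / norm x"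
    by (simp add: perp_sgn) (simp add: sgn_div_norm divide_inverse mult_ac)
  then have "norm (x - (x \<bullet> z) *\<^sub>R z) < t * (x \<bullet> z)" using x by (simp add: divide_less_cancel)
  also have "\<dots> \<le> 1 * (x \<bullet> z)" using assms by (intro mult_right_mono) auto
  finally have "norm (x - (x \<bullet> z) *\<^sub>R z) \<le> x \<bullet> z" by simp
  moreover have "norm x \<le> norm (x - (x \<bullet> z) *\<^sub>R z) + norm ((x \<bullet> z) *\<^sub>R z)"
    using norm_triangle_ineq[of "x - (x \<bullet> z) *\<^sub>R z" "(x \<bullet> z) *\<^sub>R z"] by simp
  ultimately show ?thesis using assms by simp
qed

lemma cone_over_subset_cball:
  fixes z :: "real ^ 'n"
  assumes "norm z = 1" "0 < t" "t \<le> 1" "A \<subseteq> tan_cap z t"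
  shows "cone_over z A \<subseteq> cball 0 2"
proof
  fix x assume "x \<in> cone_over z A"
  then show "x \<in> cball 0 2"
    using norm_le_of_tan_cap[OF assms(1-3), of x] assms(4) by (auto simp: cone_over_def)
qed

lemma stretch_inner:
  assumes "norm z = 1" shows "stretch z l x \<bullet> z = x \<bullet> z"
  using assms by (simp add: stretch_def inner_add_left inner_diff_left norm_eq_1)

lemma stretch_perp:
  assumes "norm z = 1" shows "stretch z l x - (stretch z l x \<bullet> z) *\<^sub>R z = l *\<^sub>R (x - (x \<bullet> z) *\<^sub>R z)"
  unfolding stretch_inner[OF assms] by (simp add: stretch_def)

lemma norm_perp_square:
  fixes u z :: "real ^ 'n"
  assumes "norm u = 1" "norm z = 1"
  shows "(norm (u - (u \<bullet> z) *\<^sub>R z))\<^sup>2 = 1 - (u \<bullet> z)\<^sup>2"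
  unfolding power2_norm_eq_inner using assms
  by (simp add: inner_diff_left inner_diff_right norm_eq_1 inner_commute power2_eq_square)

lemma dist_sphere_square:
  fixes u z :: "real ^ 'n"
  assumes "norm u = 1" "norm z = 1"
  shows "(dist z u)\<^sup>2 = 2 * (1 - u \<bullet> z)"
  unfolding dist_norm power2_norm_eq_inner using assms
  by (simp add: inner_diff_left inner_diff_right norm_eq_1 inner_commute)

lemma ball_subset_tan_cap:
  fixes z :: "real ^ 'n"
  assumes z: "norm z = 1" and s: "s \<le> 1 / 2"
  shows "sphere 0 1 \<inter> ball z s \<subseteq> tan_cap z (2 * s)"
proof
  fix u assume "u \<in> sphere 0 1 \<inter> ball z s"
  then have u: "norm u = 1" "dist z u < s" by auto
  have s0: "0 < s" using u(2) zero_le_dist[of z u] by linarith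
  have "(dist z u)\<^sup>2 \<le> (1 / 2)\<^sup>2" using u(2) s by (intro power_mono) auto
  then have c: "1 / 2 \<le> u \<bullet> z" unfolding dist_sphere_square[OF u(1) z] by (simp add: power2_eq_square)
  have c1: "u \<bullet> z \<le> 1" using norm_cauchy_schwarz[of u z] u z by simp
  have "(norm (u - (u \<bullet> z) *\<^sub>R z))\<^sup>2 \<le> (dist z u)\<^sup>2"
    unfolding norm_perp_square[OF u(1) z] dist_sphere_square[OF u(1) z]
    using mult_mono[of "1 - u \<bullet> z" "1 - u \<bullet> z" "1 + u \<bullet> z" 2] c c1
    by (simp add: power2_eq_square algebra_simps)
  then have "norm (u - (u \<bullet> z) *\<^sub>R z) \<le> dist z u" by (rule power2_le_imp_le) simp
  also have "\<dots> < s" by (rule u(2))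
  also have "\<dots> \<le> 2 * s * (u \<bullet> z)" using c s0 mult_left_mono[of "1 / 2" "u \<bullet> z" "2 * s"] by simp
  finally show "u \<in> tan_cap z (2 * s)" using u(1) by (simp add: tan_cap_def)
qed

lemma tan_cap_subset_ball:
  fixes z :: "real ^ 'n"
  assumes z: "norm z = 1" and t: "0 < t"
  shows "tan_cap z t \<subseteq> sphere 0 1 \<inter> ball z (2 * t)"
proof
  fix u assume u': "u \<in> tan_cap z t"
  then have u: "norm u = 1" "norm (u - (u \<bullet> z) *\<^sub>R z) < t * (u \<bullet> z)" by (auto simp: tan_cap_def)
  have c: "0 < u \<bullet> z" by (rule tan_cap_pos[OF u' t])
  have c1: "u \<bullet> z \<le> 1" using norm_cauchy_schwarz[of u z] u z by simp
  have "1 - u \<bullet> z \<le> (1 - u \<bullet> z) * (1 + u \<bullet> z)"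
    using c c1 mult_left_mono[of 1 "1 + u \<bullet> z" "1 - u \<bullet> z"] by simp
  then have "(dist z u)\<^sup>2 \<le> (2 * norm (u - (u \<bullet> z) *\<^sub>R z))\<^sup>2"
    unfolding power_mult_distrib norm_perp_square[OF u(1) z] dist_sphere_square[OF u(1) z]
    using c1 by (simp add: power2_eq_square algebra_simps)
  then have "dist z u \<le> 2 * norm (u - (u \<bullet> z) *\<^sub>R z)" by (rule power2_le_imp_le) simp
  also have "\<dots> < 2 * (t * (u \<bullet> z))" using u(2) by simp
  also have "\<dots> \<le> 2 * t" using c1 t by (simp add: mult_left_le)
  finally show "u \<in> sphere 0 1 \<inter> ball z (2 * t)" using u(1) by simp
qed

section \<open>Caps compared in measure with the cones over them\<close>

lemma emeasure_lborel_subset_cball_finite: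
  fixes A :: "'a::euclidean_space set"
  assumes "A \<subseteq> cball c r"
  shows "emeasure lborel A \<noteq> \<infinity>"
proof -
  have "emeasure lborel A \<le> emeasure lborel (cball c r)"
    using assms by (rule emeasure_mono) simp
  also have "\<dots> < \<infinity>" by (rule emeasure_lborel_cball_finite)
  finally show ?thesis by simp
qed

lemma measure_lborel_mono:
  fixes A :: "'a::euclidean_space set"
  assumes "A \<subseteq> B" "B \<subseteq> cball c r" "A \<in> sets borel" "B \<in> sets borel"
  shows "measure lborel A \<le> measure lborel B"
proof (rule measure_mono_fmeasurable[OF assms(1)])
  show "B \<in> fmeasurable lborel"
    using assms(4) emeasure_lborel_subset_cball_finite[OF assms(2)] by (intro fmeasurableI) (simp_all add: less_top)
qed (use assms(3) in simp)

lemma measure_sphere_measure: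
  fixes A :: "(real ^ 'n) set"
  assumes "A \<in> sets borel"
  shows "\<sigma> A = CARD('n) * measure lborel {x \<in> cball 0 1. x \<noteq> 0 \<and> sgn x \<in> A}"
  unfolding Sigma_Algebra.measure_def emeasure_sphere_measure[OF assms]
  by (simp add: enn2real_mult)

lemma sector_borel:
  fixes A :: "(real ^ 'n) set"
  assumes "A \<in> sets borel" shows "{x \<in> cball 0 1. x \<noteq> 0 \<and> sgn x \<in> A} \<in> sets borel"
proof -
  have "{x \<in> cball 0 1. x \<noteq> 0 \<and> sgn x \<in> A} = (cball 0 1 - {0}) \<inter> (sgn -` A \<inter> space borel)" by auto
  also have "\<dots> \<in> sets borel"
    by (intro sets.Int measurable_sets[OF sgn_borel_measurable assms] sets.Diff) auto
  finally show ?thesis .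
qed

lemma sphere_measure_le_cone:
  fixes z :: "real ^ 'n"
  assumes z: "norm z = 1" and t: "0 < t" "t \<le> 1" and A: "A \<in> sets borel" "A \<subseteq> tan_cap z t"
  shows "\<sigma> A \<le> CARD('n) * measure lborel (cone_over z A)"
  unfolding measure_sphere_measure[OF A(1)]
proof (intro mult_left_mono measure_lborel_mono)
  show "{x \<in> cball 0 1. x \<noteq> 0 \<and> sgn x \<in> A} \<subseteq> cone_over z A"
  proof safe
    fix x assume x: "x \<in> cball 0 1" "x \<noteq> 0" "sgn x \<in> A"
    have "0 < sgn x \<bullet> z" using x(3) A(2) t(1) tan_cap_pos by blast
    then have "0 < x \<bullet> z" using x(2) by (simp add: sgn_div_norm zero_less_mult_iff)
    moreover have "x \<bullet> z \<le> 1" using norm_cauchy_schwarz[of x z] x(1) z by simp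
    ultimately show "x \<in> cone_over z A" using x(3) by (simp add: cone_over_def)
  qed
  show "cone_over z A \<subseteq> cball 0 2" by (rule cone_over_subset_cball[OF z t A(2)])
qed (use A in \<open>auto intro: cone_over_borel sector_borel\<close>)

text \<open>The cone lies in the ball of radius 2, so halving it moves it into the unit sector over
  \<open>A\<close>; the factor is the Jacobian of this dilation.\<close>

lemma cone_le_sphere_measure:
  fixes z :: "real ^ 'n"
  assumes z: "norm z = 1" and t: "0 < t" "t \<le> 1" and A: "A \<in> sets borel" "A \<subseteq> tan_cap z t"
  shows "CARD('n) * measure lborel (cone_over z A) \<le> 2 ^ CARD('n) * \<sigma> A"
proof -
  let ?S = "{x \<in> cball 0 1. x \<noteq> 0 \<and> sgn x \<in> A}"
  have S: "?S \<in> sets borel" by (rule sector_borel[OF A(1)])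
  have half: "(\<lambda>x :: real ^ 'n. (1 / 2) *\<^sub>R x) \<in> borel_measurable borel"
    by (intro borel_measurable_continuous_onI continuous_intros)
  have "emeasure lborel ?S = ennreal ((1 / 2) ^ CARD('n)) * emeasure (distr lborel borel (\<lambda>x. 0 + (1 / 2) *\<^sub>R x)) ?S"
    by (subst lborel_affine[of "1 / 2" 0]) (use S in \<open>auto simp: emeasure_density_const\<close>)
  also have "emeasure (distr lborel borel (\<lambda>x. 0 + (1 / 2) *\<^sub>R x)) ?S = emeasure lborel ((\<lambda>x. (1 / 2) *\<^sub>R x) -` ?S)"
    using S half by (subst emeasure_distr) auto
  finally have S_eq: "emeasure lborel ?S = ennreal ((1 / 2) ^ CARD('n)) * emeasure lborel ((\<lambda>x. (1 / 2) *\<^sub>R x) -` ?S)" .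
  have "emeasure lborel (cone_over z A) \<le> emeasure lborel ((\<lambda>x. (1 / 2) *\<^sub>R x) -` ?S)"
  proof (rule emeasure_mono)
    show "cone_over z A \<subseteq> (\<lambda>x. (1 / 2) *\<^sub>R x) -` ?S"
    proof
      fix x assume "x \<in> cone_over z A"
      then have x: "0 < x \<bullet> z" "x \<bullet> z \<le> 1" "sgn x \<in> A" by (auto simp: cone_over_def)
      have "norm x \<le> 2" using norm_le_of_tan_cap[OF z t x(1)] x A(2) by fastforce
      then show "x \<in> (\<lambda>x. (1 / 2) *\<^sub>R x) -` ?S" using x by (auto simp: sgn_scaleR)
    qed
    show "(\<lambda>x. (1 / 2) *\<^sub>R x) -` ?S \<in> sets lborel" using measurable_sets[OF half S] by simp
  qed
  then have "ennreal ((1 / 2) ^ CARD('n)) * emeasure lborel (cone_over z A) \<le> emeasure lborel ?S"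
    unfolding S_eq by (rule mult_left_mono) simp
  moreover have "emeasure lborel (cone_over z A) \<noteq> \<infinity>" "emeasure lborel ?S \<noteq> \<infinity>"
    by (rule emeasure_lborel_subset_cball_finite[OF cone_over_subset_cball[OF z t A(2)]],
        rule emeasure_lborel_subset_cball_finite[of _ 0 1], auto)
  ultimately have "(1 / 2) ^ CARD('n) * measure lborel (cone_over z A) \<le> measure lborel ?S"
    by (simp add: emeasure_eq_ennreal_measure ennreal_mult[symmetric])
  then have "measure lborel (cone_over z A) \<le> 2 ^ CARD('n) * measure lborel ?S"
    by (simp add: power_divide field_simps)
  then show ?thesis
    unfolding measure_sphere_measure[OF A(1)] by (simp add: mult.left_commute mult_left_mono)
qed

text \<open>\<open>stretch z t\<close> carries the cone over the cap with tangent 1 onto this one.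
  The exactness of the power is what makes differences of nested cones small in
  \<open>tan_cap_annulus\<close>.\<close>

lemma cone_over_tan_cap_scale:
  fixes z :: "real ^ 'n"
  assumes z: "norm z = 1" and t: "0 < t"
  shows "measure lborel (cone_over z (tan_cap z t)) = t ^ (CARD('n) - 1) * measure lborel (cone_over z (tan_cap z 1))"
proof -
  have "norm (stretch z t x - (x \<bullet> z) *\<^sub>R z) = t * norm (x - (x \<bullet> z) *\<^sub>R z)" for x
    using t by (simp add: stretch_def)
  then have "{x. stretch z t x \<in> cone_over z (tan_cap z t)} = cone_over z (tan_cap z 1)"
    unfolding cone_over_tan_cap[OF t] cone_over_tan_cap[OF zero_less_one]
    using t by (simp add: stretch_inner[OF z])
  then have "emeasure lborel (cone_over z (tan_cap z t)) = ennreal (t ^ (CARD('n) - 1)) * emeasure lborel (cone_over z (tan_cap z 1))"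
    using emeasure_stretch_vimage[OF z t cone_over_borel[OF tan_cap_borel]] by metis
  then show ?thesis using t by (simp add: Sigma_Algebra.measure_def enn2real_mult)
qed

lemma cone_volume_bounds:
  fixes z :: "real ^ 'n"
  assumes z: "norm z = 1"
  shows "measure lborel (ball 0 (1 / 8) :: (real ^ 'n) set) \<le> measure lborel (cone_over z (tan_cap z 1))"
    "measure lborel (cone_over z (tan_cap z 1)) \<le> measure lborel (cball 0 2 :: (real ^ 'n) set)"
proof -
  have sub: "cone_over z (tan_cap z 1) \<subseteq> cball 0 2" by (rule cone_over_subset_cball[OF z]) auto
  have bor: "cone_over z (tan_cap z 1) \<in> sets borel" by (rule cone_over_borel[OF tan_cap_borel])
  show "measure lborel (cone_over z (tan_cap z 1)) \<le> measure lborel (cball 0 2 :: (real ^ 'n) set)"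
    by (rule measure_lborel_mono[OF sub]) (use bor in auto)
  have "measure lborel (ball 0 (1 / 8) :: (real ^ 'n) set) = measure lborel (ball ((1 / 2) *\<^sub>R z) (1 / 8))"
    by (simp add: content_ball)
  also have "\<dots> \<le> measure lborel (cone_over z (tan_cap z 1))"
  proof (rule measure_lborel_mono[OF _ sub _ bor])
    show "ball ((1 / 2) *\<^sub>R z) (1 / 8) \<subseteq> cone_over z (tan_cap z 1)"
    proof
      fix x assume "x \<in> ball ((1 / 2) *\<^sub>R z) (1 / 8)"
      define y where "y = x - (1 / 2) *\<^sub>R z"
      have y: "norm y < 1 / 8" using \<open>x \<in> _\<close> by (simp add: y_def dist_norm norm_minus_commute)
      have x: "x = (1 / 2) *\<^sub>R z + y" by (simp add: y_def)
      have yz: "\<bar>y \<bullet> z\<bar> \<le> norm y" using Cauchy_Schwarz_ineq2[of y z] z by simp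
      have xz: "x \<bullet> z = 1 / 2 + y \<bullet> z" using z by (simp add: x inner_add_left norm_eq_1)
      have "norm (x - (x \<bullet> z) *\<^sub>R z) = norm (y - (y \<bullet> z) *\<^sub>R z)"
        unfolding xz by (simp add: x algebra_simps)
      also have "\<dots> \<le> norm y + norm ((y \<bullet> z) *\<^sub>R z)" by (rule norm_triangle_ineq4)
      also have "\<dots> \<le> 2 * norm y" using yz z by simp
      also have "\<dots> < x \<bullet> z" using y yz unfolding xz by linarith
      finally show "x \<in> cone_over z (tan_cap z 1)"
        unfolding cone_over_tan_cap[OF zero_less_one] using y yz xz by auto
    qed
  qed auto
  finally show "measure lborel (ball 0 (1 / 8) :: (real ^ 'n) set) \<le> measure lborel (cone_over z (tan_cap z 1))" .
qed

text \<open>The cone over the annulus is a difference of two exactly scaling cones; only then are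
  cones compared with caps, so the loss \<open>2 ^ CARD('n)\<close> multiplies a factor that tends
  to 0 as \<open>l\<close> tends to 1.\<close>

lemma tan_cap_annulus:
  fixes z :: "real ^ 'n"
  assumes z: "norm z = 1" and t: "0 < t" "t \<le> 1" and l: "0 < l" "l \<le> 1"
  shows "\<sigma> (tan_cap z t - tan_cap z (l * t))
    \<le> 2 ^ CARD('n) * (1 - l ^ (CARD('n) - 1)) * \<sigma> (tan_cap z t)"
proof -
  have lt: "0 < l * t" "l * t \<le> t" using t l by (auto simp: mult_le_cancel_right1)
  have l1: "l ^ (CARD('n) - 1) \<le> 1" using l by (intro power_le_one) auto
  have sub: "tan_cap z (l * t) \<subseteq> tan_cap z t" by (rule tan_cap_mono[OF lt(2,1)])
  have "\<sigma> (tan_cap z t - tan_cap z (l * t)) \<le> CARD('n) * measure lborel (cone_over z (tan_cap z t - tan_cap z (l * t)))"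
    by (rule sphere_measure_le_cone[OF z t]) (auto intro: sets.Diff tan_cap_borel)
  also have "cone_over z (tan_cap z t - tan_cap z (l * t)) = cone_over z (tan_cap z t) - cone_over z (tan_cap z (l * t))"
    by (auto simp: cone_over_def)
  also have "measure lborel \<dots> = measure lborel (cone_over z (tan_cap z t)) - measure lborel (cone_over z (tan_cap z (l * t)))"
  proof (rule measure_Diff)
    show "emeasure lborel (cone_over z (tan_cap z t)) \<noteq> \<infinity>"
      by (rule emeasure_lborel_subset_cball_finite[OF cone_over_subset_cball[OF z t order_refl]])
    show "cone_over z (tan_cap z (l * t)) \<subseteq> cone_over z (tan_cap z t)"
      using sub by (auto simp: cone_over_def)
  qed (auto intro: cone_over_borel tan_cap_borel)
  also have "\<dots> = (1 - l ^ (CARD('n) - 1)) * measure lborel (cone_over z (tan_cap z t))"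
    unfolding cone_over_tan_cap_scale[OF z lt(1)] cone_over_tan_cap_scale[OF z t(1)]
    by (simp add: power_mult_distrib algebra_simps)
  also have "CARD('n) * \<dots> = (1 - l ^ (CARD('n) - 1)) * (CARD('n) * measure lborel (cone_over z (tan_cap z t)))"
    by simp
  also have "\<dots> \<le> (1 - l ^ (CARD('n) - 1)) * (2 ^ CARD('n) * \<sigma> (tan_cap z t))"
    using l1 by (intro mult_left_mono cone_le_sphere_measure[OF z t]) (auto intro: tan_cap_borel)
  finally show ?thesis by (simp add: mult_ac)
qed

section \<open>Balls and great circles through a point\<close>

lemma sphere_measure_null_borel:
  fixes A :: "(real ^ 'n) set"
  assumes "A \<inter> sphere 0 1 = {}"
  shows "\<sigma> A = 0"
proof -
  have "\<sigma> A \<le> \<sigma> (- sphere 0 1 :: (real ^ 'n) set)"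
    using assms by (intro sm.finite_measure_mono) (auto intro: borel_closed)
  then show ?thesis using sphere_measure_outside[where 'n='n] measure_nonneg[of sphere_measure A] by linarith
qed

lemma sphere_measure_Int_sphere:
  fixes A :: "(real ^ 'n) set"
  assumes A: "A \<in> sets borel"
  shows "\<sigma> (A \<inter> sphere 0 1) = \<sigma> A"
proof -
  have "\<sigma> ((A \<inter> sphere 0 1) \<union> (A - sphere 0 1)) = \<sigma> (A \<inter> sphere 0 1) + \<sigma> (A - sphere 0 1)"
    using A by (intro sm.finite_measure_Union) (auto intro: sets.Int sets.Diff)
  moreover have "\<sigma> (A - sphere 0 1) = 0"
    by (rule sphere_measure_null_borel) auto
  ultimately show ?thesis by (simp add: Int_Diff_Un)
qed

text \<open>Ahlfors regularity of the sphere. The lower bound stops at the diameter 2, past which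
  the measure no longer grows; for radii above 1/2 the upper bound comes from the total mass
  \<open>T\<close>.\<close>

lemma sphere_measure_ball_bounds:
  shows "\<exists>a1>0. \<exists>a2>0. \<forall>z :: real ^ 'n. norm z = 1 \<longrightarrow>
    (\<forall>s>0. \<sigma> (ball z s) \<le> a2 * s ^ (CARD('n) - 1)) \<and>
    (\<forall>s. 0 < s \<and> s \<le> 2 \<longrightarrow> a1 * s ^ (CARD('n) - 1) \<le> \<sigma> (ball z s))"
proof -
  define d where "d = CARD('n) - 1"
  define v1 where "v1 = measure lborel (ball 0 (1 / 8) :: (real ^ 'n) set)"
  define v2 where "v2 = measure lborel (cball 0 2 :: (real ^ 'n) set)"
  define T where "T = \<sigma> (UNIV :: (real ^ 'n) set)"
  define a1 where "a1 = CARD('n) * v1 / (2 ^ CARD('n) * 4 ^ d)"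
  define a2 where "a2 = (CARD('n) * v2 + T) * 2 ^ d"
  have v: "0 < v1" "0 < v2" by (simp_all add: v1_def v2_def content_cball_pos)
  have T: "0 \<le> T" by (simp add: T_def)
  have a1: "0 < a1" using v by (simp add: a1_def)
  have a2: "0 < a2" using v T by (simp add: a2_def add_pos_nonneg)
  show ?thesis
  proof (rule exI[of _ a1], rule conjI, rule a1, rule exI[of _ a2], rule conjI, rule a2, intro allI impI conjI)
    fix z :: "real ^ 'n" assume z: "norm z = 1"
    fix s :: real assume s: "0 < s"
    have d_def': "CARD('n) - Suc 0 = d" by (simp add: d_def)
    show "\<sigma> (ball z s) \<le> a2 * s ^ (CARD('n) - 1)"
    proof (cases "s \<le> 1 / 2")
      case True
      have "\<sigma> (ball z s) = \<sigma> (ball z s \<inter> sphere 0 1)"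
        by (rule sphere_measure_Int_sphere[symmetric]) simp
      also have "\<dots> \<le> \<sigma> (tan_cap z (2 * s))"
        using ball_subset_tan_cap[OF z True] tan_cap_borel by (intro sm.finite_measure_mono) auto
      also have "\<dots> \<le> CARD('n) * measure lborel (cone_over z (tan_cap z (2 * s)))"
        using s True tan_cap_borel by (intro sphere_measure_le_cone[OF z, of "2 * s"]) auto
      also have "\<dots> = CARD('n) * ((2 * s) ^ d * measure lborel (cone_over z (tan_cap z 1)))"
        using s cone_over_tan_cap_scale[OF z, of "2 * s"] by (simp add: d_def)
      also have "\<dots> \<le> CARD('n) * ((2 * s) ^ d * v2)"
        using s cone_volume_bounds(2)[OF z] by (intro mult_left_mono) (auto simp: v2_def)
      also have "\<dots> = (CARD('n) * v2) * 2 ^ d * s ^ d" by (simp add: power_mult_distrib)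
      also have "\<dots> \<le> a2 * s ^ d"
        unfolding a2_def using T s by (intro mult_right_mono) auto
      finally show ?thesis by (simp add: d_def)
    next
      case False
      have "\<sigma> (ball z s) \<le> T * 1" unfolding T_def by (simp, intro sm.finite_measure_mono) auto
      also have "\<dots> \<le> T * (2 * s) ^ d" using False T by (intro mult_left_mono one_le_power) auto
      also have "\<dots> = T * 2 ^ d * s ^ d" by (simp add: power_mult_distrib)
      also have "\<dots> \<le> a2 * s ^ d"
        unfolding a2_def using v s by (intro mult_right_mono) auto
      finally show ?thesis by (simp add: d_def)
    qed
  next
    fix z :: "real ^ 'n" and s :: real assume z: "norm z = 1" and s: "0 < s \<and> s \<le> 2"
    then have t: "0 < s / 4" "s / 4 \<le> 1" by auto
    have "CARD('n) * ((s / 4) ^ d * v1) \<le> CARD('n) * ((s / 4) ^ d * measure lborel (cone_over z (tan_cap z 1)))"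
      using t cone_volume_bounds(1)[OF z] by (intro mult_left_mono) (auto simp: v1_def)
    also have "\<dots> = CARD('n) * measure lborel (cone_over z (tan_cap z (s / 4)))"
      unfolding cone_over_tan_cap_scale[OF z t(1)] by (simp add: d_def)
    also have "\<dots> \<le> 2 ^ CARD('n) * \<sigma> (tan_cap z (s / 4))"
      using tan_cap_borel by (intro cone_le_sphere_measure[OF z t]) auto
    also have "\<dots> \<le> 2 ^ CARD('n) * \<sigma> (ball z s)"
      using tan_cap_subset_ball[OF z t(1)] s subset_ball[of "2 * (s / 4)" s z]
      by (intro mult_left_mono sm.finite_measure_mono) (auto simp del: subset_ball)
    finally have "a1 * s ^ d \<le> \<sigma> (ball z s)"
      by (simp add: a1_def power_divide field_simps)
    then show "a1 * s ^ (CARD('n) - 1) \<le> \<sigma> (ball z s)" by (simp add: d_def)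
  qed
qed

lemma sphere_subset_ball:
  fixes z :: "real ^ 'n"
  assumes "norm z = 1" "2 < s" shows "sphere 0 1 \<subseteq> ball z s"
proof
  fix u :: "real ^ 'n" assume "u \<in> sphere 0 1"
  then show "u \<in> ball z s" using norm_triangle_ineq4[of z u] assms by (auto simp: dist_norm)
qed

lemma sphere_measure_doubling:
  "\<exists>D. doubling_measure sphere_measure (sphere 0 1 :: (real ^ 'n) set) D"
proof -
  obtain a1 a2 where a: "0 < a1" "0 < a2"
    "\<And>(z :: real ^ 'n) s. norm z = 1 \<Longrightarrow> 0 < s \<Longrightarrow> \<sigma> (ball z s) \<le> a2 * s ^ (CARD('n) - 1)"
    "\<And>(z :: real ^ 'n) s. norm z = 1 \<Longrightarrow> 0 < s \<Longrightarrow> s \<le> 2 \<Longrightarrow> a1 * s ^ (CARD('n) - 1) \<le> \<sigma> (ball z s)"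
    using sphere_measure_ball_bounds[where 'n='n] by blast
  define D where "D = max 1 (a2 * 2 ^ (CARD('n) - 1) / a1)"
  have full: "\<sigma> (UNIV :: (real ^ 'n) set) \<le> \<sigma> (ball z s)"
    if "norm z = 1" "2 < s" for z :: "real ^ 'n" and s
  proof -
    have "\<sigma> (UNIV :: (real ^ 'n) set) = \<sigma> (UNIV \<inter> sphere 0 1 :: (real ^ 'n) set)"
      by (rule sphere_measure_Int_sphere[symmetric]) simp
    also have "\<dots> \<le> \<sigma> (ball z s)"
      using sphere_subset_ball[OF that] by (intro sm.finite_measure_mono) auto
    finally show ?thesis .
  qed
  have "doubling_measure sphere_measure (sphere 0 1 :: (real ^ 'n) set) D"
  proof (unfold_locales)
    show "\<sigma> (- sphere 0 1 :: (real ^ 'n) set) = 0" by (rule sphere_measure_outside)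
    show "1 \<le> D" by (simp add: D_def)
    fix z :: "real ^ 'n" and s :: real assume "z \<in> sphere 0 1" and s: "0 < s"
    then have z: "norm z = 1" by simp
    show "\<sigma> (ball z (2 * s)) \<le> D * \<sigma> (ball z s)"
    proof (cases "s \<le> 2")
      case True
      have "\<sigma> (ball z (2 * s)) \<le> a2 * (2 * s) ^ (CARD('n) - 1)" using s by (intro a(3) z) simp
      also have "\<dots> = (a2 * 2 ^ (CARD('n) - 1) / a1) * (a1 * s ^ (CARD('n) - 1))"
        using a(1) by (simp add: power_mult_distrib)
      also have "\<dots> \<le> (a2 * 2 ^ (CARD('n) - 1) / a1) * \<sigma> (ball z s)"
        using a(1,2) by (intro mult_left_mono a(4)[OF z s True]) auto
      also have "\<dots> \<le> D * \<sigma> (ball z s)" by (intro mult_right_mono) (auto simp: D_def)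
      finally show ?thesis .
    next
      case False
      have "\<sigma> (ball z (2 * s)) \<le> \<sigma> (UNIV :: (real ^ 'n) set)"
        by (intro sm.finite_measure_mono) auto
      also have "\<dots> \<le> 1 * \<sigma> (ball z s)" using full[OF z] False by simp
      also have "\<dots> \<le> D * \<sigma> (ball z s)" by (intro mult_right_mono) (auto simp: D_def)
      finally show ?thesis .
    qed
    show "0 < \<sigma> (ball z s)"
    proof -
      have "0 < a1 * (min s 2) ^ (CARD('n) - 1)" using a(1) s by simp
      also have "\<dots> \<le> \<sigma> (ball z (min s 2))" using s by (intro a(4) z) auto
      also have "\<dots> \<le> \<sigma> (ball z s)" by (intro sm.finite_measure_mono subset_ball) auto
      finally show ?thesis .
    qed
  qed (auto intro: borel_closed)
  then show ?thesis ..
qed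

text \<open>Disintegrates the measure of a cap along the great circles through its center: by Fubini for
  \<open>(l, x) \<mapsto> stretch z l x\<close>, with no need of polar coordinates.\<close>

lemma sphere_measure_le_of_rays:
  fixes z :: "real ^ 'n" and t \<delta> :: real
  assumes n: "2 \<le> CARD('n)" and z: "norm z = 1" and t: "0 < t" "t \<le> 1" and A: "A \<in> sets borel" and \<delta>: "0 \<le> \<delta>"
    and rays: "\<And>e \<tau>. norm e = 1 \<Longrightarrow> z \<bullet> e = 0 \<Longrightarrow> 0 \<le> \<tau> \<Longrightarrow> \<tau> \<le> t \<Longrightarrow>
      emeasure lborel {l\<in>{0..1}. sgn (z + (l * \<tau>) *\<^sub>R e) \<in> A} \<le> ennreal \<delta>"
  shows "\<sigma> (A \<inter> tan_cap z (t / 2)) \<le> 2 * CARD('n) * \<delta> * measure lborel (cone_over z (tan_cap z t))"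
proof -
  let ?K = "cone_over z (tan_cap z t)" and ?S = "cone_over z (A \<inter> tan_cap z (t / 2))"
  have K: "?K \<in> sets borel" by (rule cone_over_borel[OF tan_cap_borel])
  have A2: "A \<inter> tan_cap z (t / 2) \<in> sets borel" by (intro sets.Int A tan_cap_borel)
  have S: "?S \<in> sets borel" by (rule cone_over_borel[OF A2])
  define G where "G = {p :: real \<times> (real ^ 'n). fst p \<in> {0..1} \<and> snd p \<in> ?K \<and> sgn (stretch z (fst p) (snd p)) \<in> A}"
  have st: "(\<lambda>p. sgn (stretch z (fst p) (snd p))) \<in> borel_measurable (borel :: (real \<times> (real ^ 'n)) measure)"
    by (rule measurable_compose[OF _ sgn_borel_measurable])
       (unfold stretch_def, intro borel_measurable_continuous_onI continuous_intros)
  have G: "G \<in> sets borel"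
  proof -
    have "G = (fst -` {0..1} \<inter> space borel) \<inter> (snd -` ?K \<inter> space borel) \<inter>
        ((\<lambda>p. sgn (stretch z (fst p) (snd p))) -` A \<inter> space borel)"
      by (auto simp: G_def)
    also have "\<dots> \<in> sets borel"
      by (intro sets.Int measurable_sets[OF st A] measurable_sets[OF _ K]
          measurable_sets[of fst borel borel "{0..1}"] borel_measurable_continuous_onI continuous_intros) auto
    finally show ?thesis .
  qed
  have Gm: "case_prod (\<lambda>l x. indicator G (l, x) :: ennreal) \<in> borel_measurable (lborel \<Otimes>\<^sub>M lborel)"
    using G by (auto simp: lborel_prod intro!: borel_measurable_indicator)
  have slice: "(\<integral>\<^sup>+l. indicator G (l, x) \<partial>lborel) \<le> ennreal \<delta> * indicator ?K x" for x
  proof (cases "x \<in> ?K")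
    case False
    then show ?thesis by (auto simp: G_def indicator_def)
  next
    case True
    then have x: "0 < x \<bullet> z" "x \<bullet> z \<le> 1" "norm (x - (x \<bullet> z) *\<^sub>R z) < t * (x \<bullet> z)"
      using cone_over_tan_cap[OF t(1), of z] by (auto simp: cone_over_def)
    define c where "c = x \<bullet> z"
    define y where "y = x - c *\<^sub>R z"
    have yz: "z \<bullet> y = 0" using z by (simp add: y_def c_def inner_diff_right norm_eq_1 inner_commute)
    \<comment> \<open>On the axis, where \<open>y = 0\<close>, any unit vector orthogonal to
      \<open>z\<close> will do; it exists in dimension at least 2.\<close>
    obtain e where e: "norm e = 1" "z \<bullet> e = 0" "norm y *\<^sub>R e = y"
    proof (cases "y = 0")
      case True
      obtain v where v: "v \<noteq> 0" "orthogonal z v" using orthogonal_to_vector_exists[of z] n by auto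
      show ?thesis
        by (rule that[of "sgn v"]) (use v True in \<open>auto simp: norm_sgn orthogonal_def sgn_div_norm\<close>)
    next
      case False
      show ?thesis
        by (rule that[of "sgn y"]) (use yz False in \<open>auto simp: norm_sgn sgn_div_norm\<close>)
    qed
    define \<tau> where "\<tau> = norm y / c"
    have c: "0 < c" using x(1) by (simp add: c_def)
    have \<tau>: "0 \<le> \<tau>" "\<tau> \<le> t" using x(3) c by (auto simp: \<tau>_def y_def c_def divide_le_eq)
    \<comment> \<open>As \<open>l\<close> varies the direction runs along one great circle; \<tau>
      is the tangent of the angle between \<open>x\<close> and \<open>z\<close>. This is where the
      hypothesis on rays applies.\<close>
    have dir: "sgn (stretch z l x) = sgn (z + (l * \<tau>) *\<^sub>R e)" for l
    proof -
      have "(c * \<tau>) *\<^sub>R e = y" using e(3) c by (simp add: \<tau>_def)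
      then have "stretch z l x = c *\<^sub>R (z + (l * \<tau>) *\<^sub>R e)"
        unfolding stretch_def by (simp add: c_def[symmetric] y_def[symmetric] scaleR_add_right)
          (metis mult.left_commute scaleR_scaleR)
      then show ?thesis using c by (simp add: sgn_scaleR)
    qed
    have "(\<integral>\<^sup>+l. indicator G (l, x) \<partial>lborel) = (\<integral>\<^sup>+l. indicator {l\<in>{0..1}. sgn (z + (l * \<tau>) *\<^sub>R e) \<in> A} l \<partial>lborel)"
      using True by (intro nn_integral_cong) (simp add: G_def indicator_def dir)
    also have "\<dots> = emeasure lborel {l\<in>{0..1}. sgn (z + (l * \<tau>) *\<^sub>R e) \<in> A}"
    proof (rule nn_integral_indicator)
      have m: "(\<lambda>l. sgn (z + (l * \<tau>) *\<^sub>R e)) \<in> borel_measurable borel"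
        by (rule measurable_compose[OF _ sgn_borel_measurable]) (intro borel_measurable_continuous_onI continuous_intros)
      have "{l\<in>{0..1}. sgn (z + (l * \<tau>) *\<^sub>R e) \<in> A} = {0..1} \<inter> ((\<lambda>l. sgn (z + (l * \<tau>) *\<^sub>R e)) -` A \<inter> space borel)" by auto
      also have "\<dots> \<in> sets borel" by (intro sets.Int measurable_sets[OF m A]) auto
      finally show "{l\<in>{0..1}. sgn (z + (l * \<tau>) *\<^sub>R e) \<in> A} \<in> sets lborel" by simp
    qed
    also have "\<dots> \<le> ennreal \<delta>" by (rule rays[OF e(1,2) \<tau>])
    finally show ?thesis using True by simp
  qed
  \<comment> \<open>For \<open>l\<close> at least 1/2 the preimage of the cone over half the cap
    stays within \<open>?K\<close>, and the Jacobian is at most 1. The length 1/2 of this range of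
    \<open>l\<close> is the source of the factor 2 in the conclusion.\<close>
  have lower: "emeasure lborel ?S * indicator {1/2..1} l \<le> (\<integral>\<^sup>+x. indicator G (l, x) \<partial>lborel)" for l :: real
  proof (cases "l \<in> {1/2..1}")
    case False
    then show ?thesis by simp
  next
    case True
    then have l: "0 < l" "l \<le> 1" "1 / 2 \<le> l" by auto
    have pre: "{x. stretch z l x \<in> ?S} \<subseteq> {x. (l, x) \<in> G}"
    proof safe
      fix x assume "stretch z l x \<in> ?S"
      then have x: "0 < x \<bullet> z" "x \<bullet> z \<le> 1" "sgn (stretch z l x) \<in> A" "stretch z l x \<in> cone_over z (tan_cap z (t / 2))"
        by (auto simp: cone_over_def stretch_inner[OF z])
      have "norm (stretch z l x - (stretch z l x \<bullet> z) *\<^sub>R z) < t / 2 * (stretch z l x \<bullet> z)"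
        using x(4) t cone_over_tan_cap[of "t / 2" z] by auto
      then have "l * norm (x - (x \<bullet> z) *\<^sub>R z) < t / 2 * (x \<bullet> z)"
        using l unfolding stretch_perp[OF z] by (simp add: stretch_inner[OF z])
      moreover have "1 / 2 * norm (x - (x \<bullet> z) *\<^sub>R z) \<le> l * norm (x - (x \<bullet> z) *\<^sub>R z)"
        using l by (intro mult_right_mono) auto
      ultimately have "norm (x - (x \<bullet> z) *\<^sub>R z) < t * (x \<bullet> z)" by simp
      then have "x \<in> ?K" unfolding cone_over_tan_cap[OF t(1)] using x by auto
      then show "(l, x) \<in> G" using x l by (auto simp: G_def)
    qed
    have Gl: "{x. (l, x) \<in> G} \<in> sets borel"
    proof -
      have m: "(\<lambda>x :: real ^ 'n. (l, x)) \<in> borel \<rightarrow>\<^sub>M borel"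
        by (intro borel_measurable_continuous_onI continuous_intros)
      from measurable_sets[OF m G] show ?thesis by (simp add: vimage_def)
    qed
    have "emeasure lborel ?S = ennreal (l ^ (CARD('n) - 1)) * emeasure lborel {x. stretch z l x \<in> ?S}"
      by (rule emeasure_stretch_vimage[OF z l(1) S])
    also have "\<dots> \<le> 1 * emeasure lborel {x. stretch z l x \<in> ?S}"
      using l by (intro mult_right_mono) (auto simp: power_le_one)
    also have "\<dots> \<le> emeasure lborel {x. (l, x) \<in> G}"
      using emeasure_mono[OF pre] Gl by simp
    also have "\<dots> = (\<integral>\<^sup>+x. indicator {x. (l, x) \<in> G} x \<partial>lborel)"
      using Gl by (intro nn_integral_indicator[symmetric]) simp
    also have "\<dots> = (\<integral>\<^sup>+x. indicator G (l, x) \<partial>lborel)"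
      by (intro nn_integral_cong) (simp add: indicator_def)
    finally show ?thesis using True by simp
  qed
  have "emeasure lborel ?S * ennreal (1 / 2) = (\<integral>\<^sup>+l. emeasure lborel ?S * indicator {1/2..1::real} l \<partial>lborel)"
    by (subst nn_integral_cmult_indicator) auto
  also have "\<dots> \<le> (\<integral>\<^sup>+l. (\<integral>\<^sup>+x. indicator G (l, x) \<partial>lborel) \<partial>lborel)"
    by (intro nn_integral_mono lower)
  also have "\<dots> = (\<integral>\<^sup>+x. (\<integral>\<^sup>+l. indicator G (l, x) \<partial>lborel) \<partial>lborel)"
    by (rule lborel_pair.Fubini'[OF Gm, symmetric])
  also have "\<dots> \<le> (\<integral>\<^sup>+x. ennreal \<delta> * indicator ?K x \<partial>lborel)"
    by (intro nn_integral_mono slice)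
  also have "\<dots> = ennreal \<delta> * emeasure lborel ?K"
    using K by (subst nn_integral_cmult_indicator) auto
  finally have le: "emeasure lborel ?S * ennreal (1 / 2) \<le> ennreal \<delta> * emeasure lborel ?K" .
  have t2: "0 < t / 2" "t / 2 \<le> 1" using t by auto
  have "emeasure lborel ?S \<noteq> \<infinity>"
    by (rule emeasure_lborel_subset_cball_finite[OF cone_over_subset_cball[OF z t2]]) auto
  moreover have "emeasure lborel ?K \<noteq> \<infinity>"
    by (rule emeasure_lborel_subset_cball_finite[OF cone_over_subset_cball[OF z t order_refl]])
  ultimately have "measure lborel ?S * (1 / 2) \<le> \<delta> * measure lborel ?K"
    using le \<delta> by (simp add: emeasure_eq_ennreal_measure ennreal_mult[symmetric] del: ennreal_half)
  then have "measure lborel ?S \<le> 2 * \<delta> * measure lborel ?K" by simp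
  then have "CARD('n) * measure lborel ?S \<le> CARD('n) * (2 * \<delta> * measure lborel ?K)"
    by (intro mult_left_mono) auto
  moreover have "\<sigma> (A \<inter> tan_cap z (t / 2)) \<le> CARD('n) * measure lborel ?S"
    by (rule sphere_measure_le_cone[OF z t2 A2]) auto
  ultimately show ?thesis by (simp only: mult_ac)
qed

section \<open>Doubling of reverse Hoelder weights\<close>

text \<open>Reverse Hoelder at the scale of one cap makes thin annuli light, which gives doubling.\<close>

lemma weight_local_doubling:
  fixes w :: "real ^ 'n \<Rightarrow> real"
  defines "N \<equiv> density sphere_measure (\<lambda>x. ennreal (w x))"
  assumes w: "w \<in> borel_measurable borel" "\<And>x. 0 \<le> w x" and N: "finite_measure N" and C: "1 \<le> C"
    and rh: "\<And>z t. norm z = 1 \<Longrightarrow> 0 < t \<Longrightarrow> t \<le> 1 \<Longrightarrow>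
      AE u in sphere_measure. u \<in> tan_cap z t \<longrightarrow> w u * \<sigma> (tan_cap z t) \<le> C * measure N (tan_cap z t)"
  shows "\<exists>D\<ge>1. \<forall>z s. norm z = 1 \<and> 0 < s \<and> s \<le> 1 / 8 \<longrightarrow> measure N (ball z (2 * s)) \<le> D * measure N (ball z s)"
proof -
  interpret N: finite_measure N by (rule N)
  have sets_N: "sets N = sets borel" by (simp add: N_def)
  have w_sm: "w \<in> borel_measurable sphere_measure"
    by (subst measurable_cong_sets[OF sets_sphere_measure refl]) (rule w(1))
  have null_N: "null_sets sphere_measure \<subseteq> null_sets N"
    using absolutely_continuousI_density[of "\<lambda>x. ennreal (w x)" sphere_measure] w_sm
    by (auto simp: absolutely_continuous_def N_def)
  let ?n = "CARD('n)"
  have n1: "1 \<le> real ?n" by (simp add: Suc_leI)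
  \<comment> \<open>Chosen so that an annulus of relative size \<open>2 ^ ?n * \<eta>\<close>
    carries, by reverse Hoelder, at most half of the mass. Bernoulli's inequality shows that the
    ratio \<open>l = 1 - \<eta> / ?n\<close> yields such an annulus.\<close>
  define \<eta> where "\<eta> = 1 / (2 * C * 2 ^ ?n)"
  define l where "l = 1 - \<eta> / ?n"
  have C2: "1 \<le> C * 2 ^ ?n" using C mult_mono[of 1 C 1 "2 ^ ?n :: real"] by simp
  have \<eta>: "0 < \<eta>" "\<eta> \<le> 1 / 2" using C C2 by (auto simp: \<eta>_def divide_le_eq)
  have \<eta>n: "0 < \<eta> / ?n" "\<eta> / ?n \<le> 1 / 2"
  proof -
    show "0 < \<eta> / ?n" using \<eta> by simp
    have "\<eta> / ?n \<le> \<eta> / 1" using \<eta> n1 by (intro divide_left_mono) auto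
    then show "\<eta> / ?n \<le> 1 / 2" using \<eta>(2) by linarith
  qed
  have l: "0 < l" "l < 1" unfolding l_def using \<eta>n by linarith+
  have ld: "1 - l ^ (?n - 1) \<le> \<eta>"
  proof -
    have "1 + real (?n - 1) * (- (\<eta> / ?n)) \<le> (1 + - (\<eta> / ?n)) ^ (?n - 1)"
      using \<eta>n by (intro Bernoulli_inequality) auto
    moreover have "real (?n - 1) * (\<eta> / ?n) \<le> ?n * (\<eta> / ?n)" using \<eta>n by (intro mult_right_mono) auto
    ultimately show ?thesis by (simp add: l_def)
  qed
  have step: "measure N (tan_cap z t) \<le> 2 * measure N (tan_cap z (l * t))" if z: "norm z = 1" and t: "0 < t" "t \<le> 1" for z t
  proof (cases "\<sigma> (tan_cap z t) = 0")
    case True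
    then have "emeasure sphere_measure (tan_cap z t) = 0" by (simp add: sm.emeasure_eq_measure)
    then have "tan_cap z t \<in> null_sets sphere_measure" by (intro null_setsI) (simp_all add: tan_cap_borel)
    then have "tan_cap z t \<in> null_sets N"
      using null_N by blast
    then show ?thesis by (simp add: measure_eq_emeasure_eq_ennreal null_setsD1 Sigma_Algebra.measure_def)
  next
    case False
    let ?b = "\<sigma> (tan_cap z t)" and ?v = "measure N (tan_cap z t)"
    let ?A = "tan_cap z t - tan_cap z (l * t)"
    have b: "0 < ?b" using False by (simp add: zero_less_measure_iff)
    have lt: "0 < l * t" "l * t \<le> t" using l t by (auto simp: mult_le_cancel_right1)
    have sub: "tan_cap z (l * t) \<subseteq> tan_cap z t" by (rule tan_cap_mono[OF lt(2,1)])
    have "measure N ?A \<le> (C * ?v / ?b) * \<sigma> ?A"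
      unfolding N_def
    proof (rule finite_measure.measure_density_le[OF finite_sphere_measure])
      show "AE u in sphere_measure. u \<in> ?A \<longrightarrow> w u \<le> C * measure (density sphere_measure (\<lambda>x. ennreal (w x))) (tan_cap z t) / ?b"
        using rh[OF z t] unfolding N_def by eventually_elim (use b in \<open>simp add: pos_le_divide_eq\<close>)
    qed (use w w_sm C b in \<open>auto intro: sets.Diff tan_cap_borel\<close>)
    also have "\<dots> \<le> (C * ?v / ?b) * (2 ^ ?n * (1 - l ^ (?n - 1)) * ?b)"
      using C b l by (intro mult_left_mono tan_cap_annulus[OF z t]) auto
    also have "\<dots> = (C * 2 ^ ?n * (1 - l ^ (?n - 1))) * ?v" using b by simp
    also have "\<dots> \<le> (C * 2 ^ ?n * \<eta>) * ?v"
      using ld C by (intro mult_right_mono mult_left_mono) auto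
    also have "\<dots> = ?v / 2" using C by (simp add: \<eta>_def)
    finally have "measure N ?A \<le> ?v / 2" .
    moreover have "measure N ?A = ?v - measure N (tan_cap z (l * t))"
      using sub by (intro N.finite_measure_Diff) (auto simp: sets_N tan_cap_borel)
    ultimately show ?thesis by simp
  qed
  \<comment> \<open>\<open>k\<close> shrinkings lead from tangent \<open>4 * s\<close>, whose cap
    covers the part of \<open>ball z (2 * s)\<close> on the sphere, to at most \<open>s / 2\<close>,
    whose cap lies in \<open>ball z s\<close>. The restriction \<open>s \<le> 1 / 8\<close> keeps
    \<open>4 * s\<close> within the range of tangents handled.\<close>
  obtain k where k: "l ^ k \<le> 1 / 8" using real_arch_pow_inv[of "1 / 8" l] l by (auto intro: less_imp_le)
  have iter: "measure N (tan_cap z t) \<le> 2 ^ j * measure N (tan_cap z (l ^ j * t))" if z: "norm z = 1" and t: "0 < t" "t \<le> 1" for z t j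
  proof (induction j)
    case (Suc j)
    have "0 < l ^ j * t" "l ^ j * t \<le> 1"
      using l t mult_mono[of "l ^ j" 1 t 1] by (auto simp: power_le_one)
    from step[OF z this] have "2 ^ j * measure N (tan_cap z (l ^ j * t)) \<le> 2 ^ j * (2 * measure N (tan_cap z (l * (l ^ j * t))))"
      by (intro mult_left_mono) auto
    from order_trans[OF Suc this] show ?case by (simp add: mult.assoc mult.left_commute)
  qed simp
  show ?thesis
  proof (intro exI[of _ "2 ^ k"] conjI allI impI)
    fix z :: "real ^ 'n" and s :: real assume "norm z = 1 \<and> 0 < s \<and> s \<le> 1 / 8"
    then have z: "norm z = 1" and s: "0 < s" "s \<le> 1 / 8" by auto
    have out: "measure N (ball z (2 * s) - sphere 0 1) = 0"
    proof -
      have "\<sigma> (ball z (2 * s) - sphere 0 1) = 0"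
        by (rule sphere_measure_null_borel) auto
      then have "ball z (2 * s) - sphere 0 1 \<in> null_sets sphere_measure"
        by (intro null_setsI) (auto simp: sm.emeasure_eq_measure)
      then have "ball z (2 * s) - sphere 0 1 \<in> null_sets N"
        using null_N by blast
      then show ?thesis by (simp add: null_setsD1 Sigma_Algebra.measure_def)
    qed
    have "measure N (ball z (2 * s)) \<le> measure N (ball z (2 * s) \<inter> sphere 0 1) + measure N (ball z (2 * s) - sphere 0 1)"
      using measure_Un_le[of "ball z (2 * s) \<inter> sphere 0 1" N "ball z (2 * s) - sphere 0 1"]
      by (simp add: sets_N Int_Diff_Un)
    also have "\<dots> = measure N (ball z (2 * s) \<inter> sphere 0 1)" using out by simp
    also have "\<dots> \<le> measure N (tan_cap z (4 * s))"
      using ball_subset_tan_cap[OF z, of "2 * s"] s tan_cap_borel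
      by (intro N.finite_measure_mono) (auto simp: sets_N)
    also have "\<dots> \<le> 2 ^ k * measure N (tan_cap z (l ^ k * (4 * s)))"
      using s by (intro iter z) auto
    also have "\<dots> \<le> 2 ^ k * measure N (ball z s)"
    proof (intro mult_left_mono N.finite_measure_mono)
      have "tan_cap z (l ^ k * (4 * s)) \<subseteq> tan_cap z (s / 2)"
        using k s l mult_right_mono[of "l ^ k" "1 / 8" "4 * s"] by (intro tan_cap_mono) auto
      also have "\<dots> \<subseteq> ball z s" using tan_cap_subset_ball[OF z, of "s / 2"] s by auto
      finally show "tan_cap z (l ^ k * (4 * s)) \<subseteq> ball z s" .
    qed (auto simp: sets_N)
    finally show "measure N (ball z (2 * s)) \<le> 2 ^ k * measure N (ball z s)" .
  qed simp
qed

text \<open>By connectedness of the sphere no ball is null, and by compactness balls of a fixed radius have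
  measure bounded below.\<close>

lemma doubling_of_local:
  fixes N :: "(real ^ 'n) measure"
  assumes n: "2 \<le> CARD('n)" and "finite_measure N" and sets_N: "sets N = sets borel" and out: "measure N (- sphere 0 1) = 0"
    and pos: "measure N UNIV > 0" and D0: "1 \<le> D0"
    and loc: "\<And>z s. norm z = 1 \<Longrightarrow> 0 < s \<Longrightarrow> s \<le> 1 / 8 \<Longrightarrow> measure N (ball z (2 * s)) \<le> D0 * measure N (ball z s)"
  shows "(\<exists>D\<ge>1. \<forall>z s. norm z = 1 \<and> 0 < s \<longrightarrow> measure N (ball z (2 * s)) \<le> D * measure N (ball z s))"
    and "\<And>z s. norm z = 1 \<Longrightarrow> 0 < s \<Longrightarrow> 0 < measure N (ball z s)"
proof -
  interpret N: finite_measure N by fact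
  have mono: "measure N A \<le> measure N B" if "A \<subseteq> B" "B \<in> sets borel" for A B
    using that by (intro N.finite_measure_mono) (auto simp: sets_N)
  let ?S = "sphere 0 1 :: (real ^ 'n) set"
  \<comment> \<open>Doubling propagates nullity upwards from an arbitrarily small ball to the fixed
    radius 1/8, so the set of centers of null balls is open and closed with a uniform step.\<close>
  have zero_big: "measure N (ball z (1 / 8)) = 0" if z: "norm z = 1" and s: "0 < s" "measure N (ball z s) = 0" for z s
  proof -
    have it: "measure N (ball z (1 / 8)) \<le> D0 ^ m * measure N (ball z (1 / 8 / 2 ^ m))" for m
    proof (induction m)
      case (Suc m)
      have "1 / 8 / 2 ^ Suc m \<le> (1 / 8 :: real)"
        using one_le_power[of "2 :: real" "Suc m"] by (subst divide_le_eq) (simp del: power_Suc)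
      then have "measure N (ball z (2 * (1 / 8 / 2 ^ Suc m))) \<le> D0 * measure N (ball z (1 / 8 / 2 ^ Suc m))"
        by (intro loc z) auto
      then have "D0 ^ m * measure N (ball z (1 / 8 / 2 ^ m)) \<le> D0 ^ m * (D0 * measure N (ball z (1 / 8 / 2 ^ Suc m)))"
        using D0 by (intro mult_left_mono) auto
      with Suc show ?case by (simp add: mult_ac)
    qed simp
    obtain m where "(1 / 2) ^ m < 8 * s" using real_arch_pow_inv[of "8 * s" "1 / 2"] s(1) by auto
    then have "1 / 8 / 2 ^ m \<le> s" by (simp add: power_divide field_simps)
    then have "measure N (ball z (1 / 8 / 2 ^ m)) \<le> measure N (ball z s)" by (intro mono subset_ball) auto
    then have "measure N (ball z (1 / 8 / 2 ^ m)) = 0" using s(2) by (simp add: measure_le_0_iff)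
    with it[of m] show ?thesis by (simp add: measure_le_0_iff)
  qed
  define Z where "Z = {z \<in> ?S. \<exists>s>0. measure N (ball z s) = 0}"
  have Zeq: "Z = {z \<in> ?S. measure N (ball z (1 / 8)) = 0}"
    unfolding Z_def using zero_big by (auto intro!: exI[of _ "1 / 8"])
  have near: "z' \<in> Z" if "z \<in> Z" "z' \<in> ?S" "dist z z' < 1 / 8" for z z'
  proof -
    have "ball z' (1 / 8 - dist z z') \<subseteq> ball z (1 / 8)"
    proof
      fix y assume "y \<in> ball z' (1 / 8 - dist z z')"
      then show "y \<in> ball z (1 / 8)" using dist_triangle[of z y z'] by auto
    qed
    then have "measure N (ball z' (1 / 8 - dist z z')) \<le> measure N (ball z (1 / 8))" by (intro mono) auto
    also have "\<dots> = 0" using that(1) unfolding Zeq by simp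
    finally have "measure N (ball z' (1 / 8 - dist z z')) = 0" by (simp add: measure_le_0_iff)
    then show ?thesis unfolding Z_def using that(2,3) by (auto intro!: exI[of _ "1 / 8 - dist z z'"])
  qed
  have op: "openin (top_of_set ?S) Z"
    unfolding openin_euclidean_subtopology_iff
  proof (intro conjI ballI)
    show "Z \<subseteq> ?S" by (auto simp: Z_def)
    fix x assume "x \<in> Z"
    with near show "\<exists>e>0. \<forall>x'\<in>?S. dist x' x < e \<longrightarrow> x' \<in> Z"
      by (intro exI[of _ "1 / 8"] conjI ballI impI) (simp_all add: dist_commute)
  qed
  have op': "openin (top_of_set ?S) (?S - Z)"
    unfolding openin_euclidean_subtopology_iff
  proof (intro conjI ballI)
    show "?S - Z \<subseteq> ?S" by blast
    fix x assume "x \<in> ?S - Z"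
    with near show "\<exists>e>0. \<forall>x'\<in>?S. dist x' x < e \<longrightarrow> x' \<in> ?S - Z"
      by (intro exI[of _ "1 / 8"] conjI ballI impI) auto
  qed
  have cl: "closedin (top_of_set ?S) Z"
  proof -
    have "Z \<subseteq> ?S" by (auto simp: Z_def)
    then show ?thesis using op' by (simp add: closedin_def)
  qed
  have "connected ?S" by (rule connected_sphere) (use n in simp)
  then have "Z = {} \<or> Z = ?S" using op cl unfolding connected_clopen by blast
  moreover have "Z \<noteq> ?S"
  proof
    assume ZS: "Z = ?S"
    obtain F where F: "F \<subseteq> ?S" "finite F" "?S \<subseteq> (\<Union>z\<in>F. ball z (1 / 8))"
      by (rule compactE_image[OF compact_sphere, of ?S "\<lambda>z. ball z (1 / 8)"]) auto
    have "measure N ?S \<le> measure N (\<Union>z\<in>F. ball z (1 / 8))" using F by (intro mono) auto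
    also have "\<dots> \<le> (\<Sum>z\<in>F. measure N (ball z (1 / 8)))"
      using F by (intro N.finite_measure_subadditive_finite) (auto simp: sets_N)
    also have "\<dots> = 0" using F(1) ZS unfolding Zeq by (intro sum.neutral) auto
    finally have "measure N ?S \<le> 0" .
    moreover have "measure N UNIV \<le> measure N ?S + measure N (- ?S)"
      using measure_Un_le[of ?S N "- ?S"] by (simp add: sets_N borel_closed)
    ultimately show False using pos out by simp
  qed
  ultimately have Z: "Z = {}" by blast
  show P: "0 < measure N (ball z s)" if "norm z = 1" "0 < s" for z s
    using Z that by (force simp: Z_def zero_less_measure_iff)
  obtain F where F: "F \<subseteq> ?S" "finite F" "?S \<subseteq> (\<Union>z\<in>F. ball z (1 / 16))"
    by (rule compactE_image[OF compact_sphere, of ?S "\<lambda>z. ball z (1 / 16)"]) auto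
  have "F \<noteq> {}" using F(3) by auto
  define b where "b = Min ((\<lambda>z. measure N (ball z (1 / 16))) ` F)"
  have b: "0 < b" unfolding b_def using F \<open>F \<noteq> {}\<close> P by (subst Min_gr_iff) auto
  have low: "b \<le> measure N (ball z (1 / 8))" if z: "norm z = 1" for z
  proof -
    obtain f where f: "f \<in> F" "dist f z < 1 / 16" using F(3) z by (force simp: subset_iff)
    have "ball f (1 / 16) \<subseteq> ball z (1 / 8)"
    proof
      fix y assume "y \<in> ball f (1 / 16)"
      then show "y \<in> ball z (1 / 8)" using f(2) dist_triangle[of z y f] by (auto simp: dist_commute)
    qed
    then have "measure N (ball f (1 / 16)) \<le> measure N (ball z (1 / 8))" by (intro mono) auto
    moreover have "b \<le> measure N (ball f (1 / 16))" unfolding b_def using F(2) f(1) by (intro Min_le) auto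
    ultimately show ?thesis by simp
  qed
  \<comment> \<open>Local doubling covers radii up to 1/8; above that the total mass is compared
    with the uniform lower bound \<open>b\<close>.\<close>
  define D where "D = max D0 (measure N UNIV / b)"
  show "\<exists>D\<ge>1. \<forall>z s. norm z = 1 \<and> 0 < s \<longrightarrow> measure N (ball z (2 * s)) \<le> D * measure N (ball z s)"
  proof (intro exI[of _ D] conjI allI impI)
    show "1 \<le> D" using D0 by (simp add: D_def)
    fix z :: "real ^ 'n" and s :: real assume "norm z = 1 \<and> 0 < s"
    then have z: "norm z = 1" and s: "0 < s" by auto
    show "measure N (ball z (2 * s)) \<le> D * measure N (ball z s)"
    proof (cases "s \<le> 1 / 8")
      case True
      have "measure N (ball z (2 * s)) \<le> D0 * measure N (ball z s)" by (rule loc[OF z s True])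
      also have "\<dots> \<le> D * measure N (ball z s)" by (intro mult_right_mono) (auto simp: D_def)
      finally show ?thesis .
    next
      case False
      have "measure N (ball z (2 * s)) \<le> measure N UNIV" by (intro mono) auto
      also have "\<dots> = (measure N UNIV / b) * b" using b by simp
      also have "\<dots> \<le> (measure N UNIV / b) * measure N (ball z s)"
      proof (intro mult_left_mono)
        have "measure N (ball z (1 / 8)) \<le> measure N (ball z s)" using False by (intro mono subset_ball) auto
        with low[OF z] show "b \<le> measure N (ball z s)" by simp
      qed (use b in auto)
      also have "\<dots> \<le> D * measure N (ball z s)" by (intro mult_right_mono) (auto simp: D_def)
      finally show ?thesis .
    qed
  qed
qed

section \<open>Small values of spherical polynomials\<close>

lemma continuous_on_spherical_poly:
  fixes Q :: "real ^ 'n \<Rightarrow> complex"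
  assumes "Q \<in> spherical_polys L"
  shows "continuous_on (sphere 0 1) Q"
proof -
  from assms obtain c where c: "\<And>x. x \<in> sphere 0 1 \<Longrightarrow>
     Q x = (\<Sum>\<alpha> | (\<Sum>i\<in>UNIV. \<alpha> i) \<le> L. c \<alpha> * of_real (\<Prod>i\<in>UNIV. (x $ i) ^ \<alpha> i))"
    unfolding spherical_polys_def by blast
  have "continuous_on (sphere 0 1) (\<lambda>x :: real ^ 'n. \<Sum>\<alpha> | (\<Sum>i\<in>UNIV. \<alpha> i) \<le> L. c \<alpha> * of_real (\<Prod>i\<in>UNIV. (x $ i) ^ \<alpha> i))"
    by (intro continuous_intros)
  then show ?thesis by (rule continuous_on_eq) (simp only: c)
qed

text \<open>Integrates the estimate along great circles over all directions by
  \<open>sphere_measure_le_of_rays\<close>, with constants independent of \<open>L\<close>,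
  \<open>Q\<close> and \<open>z\<close>.\<close>

lemma spherical_poly_small_values:
  fixes \<kappa> \<delta> :: real and s :: nat
  assumes n: "2 \<le> CARD('n)" and \<delta>: "0 < \<delta>"
  shows "\<exists>\<epsilon>>0. \<forall>L\<ge>1. \<forall>Q\<in>spherical_polys L. \<forall>z :: real ^ 'n.
    norm z = 1 \<and> (\<forall>u\<in>sphere 0 1. cmod (Q u) \<le> \<kappa> * (1 + real L * norm (u - z)) ^ s * cmod (Q z)) \<longrightarrow>
    \<sigma> ({u \<in> sphere 0 1. cmod (Q u) < \<epsilon> * cmod (Q z)} \<inter> ball z (1 / (16 * real L)))
      \<le> \<delta> * \<sigma> (ball z (1 / (16 * real L)))"
proof -
  obtain D where "doubling_measure sphere_measure (sphere 0 1 :: (real ^ 'n) set) D"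
    using sphere_measure_doubling by blast
  then interpret D: doubling_measure "sphere_measure :: (real ^ 'n) measure" "sphere 0 1" D .
  \<comment> \<open>Total loss between rays and balls: 2 from the disintegration, then the ratio of
    the cones for \<open>t\<close> and \<open>t / 2\<close>, the passage from cone to cap, and two
    doublings from cap to ball.\<close>
  define c where "c = 2 * 2 ^ (CARD('n) - 1) * 2 ^ CARD('n) * D\<^sup>2"
  have c: "0 < c" using D.D_ge_1 by (simp add: c_def)
  obtain \<epsilon> where \<epsilon>: "0 < \<epsilon>" and E: "\<forall>L\<ge>1. \<forall>Q\<in>spherical_polys L. \<forall>z e :: real ^ 'n. \<forall>\<tau>.
    norm z = 1 \<and> norm e = 1 \<and> z \<bullet> e = 0 \<and> 0 \<le> \<tau> \<and> \<tau> \<le> 1 / (4 * real L) \<and>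
    (\<forall>u\<in>sphere 0 1. cmod (Q u) \<le> \<kappa> * (1 + real L * norm (u - z)) ^ s * cmod (Q z)) \<longrightarrow>
    emeasure lborel {l\<in>{0..1}. cmod (Q (sgn (z + (l * \<tau>) *\<^sub>R e))) < \<epsilon> * cmod (Q z)} \<le> ennreal (\<delta> / c)"
    using ray_small_values[of "\<delta> / c" \<kappa> s, where 'n='n] \<delta> c by auto
  show ?thesis
  proof (intro exI[of _ \<epsilon>] conjI allI ballI impI \<epsilon>)
    fix L :: nat and Q and z :: "real ^ 'n"
    assume L: "1 \<le> L" and Q: "Q \<in> spherical_polys L"
      and *: "norm z = 1 \<and> (\<forall>u\<in>sphere 0 1. cmod (Q u) \<le> \<kappa> * (1 + real L * norm (u - z)) ^ s * cmod (Q z))"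
    then have z: "norm z = 1" by simp
    define t where "t = 1 / (4 * real L)"
    have t: "0 < t" "t \<le> 1" using L by (auto simp: t_def divide_le_eq)
    have t2: "0 < t / 2" "t / 2 \<le> 1" using t by auto
    \<comment> \<open>Rays are controlled up to tangent \<open>1 / (4 * L)\<close>; the
      disintegration halves this, and fitting a chordal ball into a tangent cap halves it
      again.\<close>
    define h where "h = 1 / (16 * real L)"
    have h: "0 < h" "t / 2 = 2 * h" "h \<le> 1 / 2" using L by (auto simp: h_def t_def field_simps)
    define A where "A = {u \<in> sphere 0 1. cmod (Q u) < \<epsilon> * cmod (Q z)}"
    have A: "A \<in> sets borel"
      unfolding A_def by (intro sublevel_borel_on continuous_on_norm continuous_on_spherical_poly[OF Q]) (auto intro: borel_closed)
    have rays: "emeasure lborel {l\<in>{0..1}. sgn (z + (l * \<tau>) *\<^sub>R e) \<in> A} \<le> ennreal (\<delta> / c)"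
      if e: "norm e = 1" "z \<bullet> e = 0" and \<tau>: "0 \<le> \<tau>" "\<tau> \<le> t" for e \<tau>
    proof -
      have "sgn (z + x *\<^sub>R e) \<in> sphere 0 1" for x
      proof -
        have "(z + x *\<^sub>R e) \<bullet> z = 1" using z e by (simp add: inner_add_left norm_eq_1 inner_commute[of e z])
        then have "z + x *\<^sub>R e \<noteq> 0" by auto
        then show ?thesis by (simp add: norm_sgn)
      qed
      then have "{l\<in>{0..1}. sgn (z + (l * \<tau>) *\<^sub>R e) \<in> A} = {l\<in>{0..1}. cmod (Q (sgn (z + (l * \<tau>) *\<^sub>R e))) < \<epsilon> * cmod (Q z)}"
        unfolding A_def by blast
      then show ?thesis using E L Q * e \<tau> by (simp add: t_def)
    qed
    have "\<sigma> (A \<inter> ball z h) \<le> \<sigma> (A \<inter> tan_cap z (t / 2))"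
    proof (rule sm.finite_measure_mono)
      have "A \<subseteq> sphere 0 1" by (auto simp: A_def)
      then show "A \<inter> ball z h \<subseteq> A \<inter> tan_cap z (t / 2)"
        using ball_subset_tan_cap[OF z h(3)] unfolding h(2) by blast
      show "A \<inter> tan_cap z (t / 2) \<in> sets sphere_measure"
        unfolding sets_sphere_measure by (rule sets.Int[OF A tan_cap_borel])
    qed
    also have "\<dots> \<le> 2 * CARD('n) * (\<delta> / c) * measure lborel (cone_over z (tan_cap z t))"
    proof (rule sphere_measure_le_of_rays[OF n z t A])
      show "0 \<le> \<delta> / c" using \<delta> c by simp
    qed (rule rays)
    also have "measure lborel (cone_over z (tan_cap z t)) = 2 ^ (CARD('n) - 1) * measure lborel (cone_over z (tan_cap z (t / 2)))"
      unfolding cone_over_tan_cap_scale[OF z t(1)] cone_over_tan_cap_scale[OF z t2(1)] by (simp add: power_divide)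
    also have "2 * CARD('n) * (\<delta> / c) * \<dots> = 2 * 2 ^ (CARD('n) - 1) * (\<delta> / c) * (CARD('n) * measure lborel (cone_over z (tan_cap z (t / 2))))"
      by simp
    also have "\<dots> \<le> 2 * 2 ^ (CARD('n) - 1) * (\<delta> / c) * (2 ^ CARD('n) * \<sigma> (tan_cap z (t / 2)))"
      using \<delta> c tan_cap_borel by (intro mult_left_mono cone_le_sphere_measure[OF z t2]) auto
    also have "\<dots> \<le> 2 * 2 ^ (CARD('n) - 1) * (\<delta> / c) * (2 ^ CARD('n) * (D\<^sup>2 * \<sigma> (ball z h)))"
    proof (intro mult_left_mono)
      have "tan_cap z (t / 2) \<subseteq> ball z (2\<^sup>2 * h)" using tan_cap_subset_ball[OF z t2(1)] unfolding h(2) by auto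
      then have "\<sigma> (tan_cap z (t / 2)) \<le> \<sigma> (ball z (2\<^sup>2 * h))"
        by (intro sm.finite_measure_mono) auto
      also have "\<dots> \<le> D\<^sup>2 * \<sigma> (ball z h)" using z h(1) by (intro D.doubling_pow) auto
      finally show "\<sigma> (tan_cap z (t / 2)) \<le> D\<^sup>2 * \<sigma> (ball z h)" .
    qed (use \<delta> c in auto)
    also have "\<dots> = (c * (\<delta> / c)) * \<sigma> (ball z h)" by (simp add: c_def mult_ac)
    also have "\<dots> = \<delta> * \<sigma> (ball z h)" using c by simp
    finally show "\<sigma> ({u \<in> sphere 0 1. cmod (Q u) < \<epsilon> * cmod (Q z)} \<inter> ball z (1 / (16 * real L)))
      \<le> \<delta> * \<sigma> (ball z (1 / (16 * real L)))" unfolding A_def h_def .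
  qed
qed

section \<open>Chordal versus geodesic distance on the sphere\<close>

lemma half_le_sin:
  fixes x :: real
  assumes "0 \<le> x" "x \<le> pi / 2"
  shows "x / 2 \<le> sin x"
proof -
  have c: "0 < cos (x / 2)" using assms pi_gt_zero by (intro cos_gt_zero_pi) linarith+
  have cx: "0 \<le> cos x" using assms pi_gt_zero by (intro cos_ge_zero) linarith+
  have s: "0 \<le> sin (x / 2)" using assms pi_gt_zero by (intro sin_ge_zero) linarith+
  \<comment> \<open>Multiplied by \<open>2 * (cos (x / 2))\<^sup>2 = 1 + cos x\<close>, this becomes
    \<open>x / 2 * (1 + cos x) \<le> sin x\<close>.\<close>
  have "\<bar>x / 2\<bar> \<le> \<bar>tan (x / 2)\<bar>" using assms pi_gt_zero by (intro abs_tan_ge) linarith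
  then have "x / 2 \<le> sin (x / 2) / cos (x / 2)" using assms c s by (simp add: tan_def)
  then have "x / 2 * cos (x / 2) \<le> sin (x / 2)" using c by (simp add: le_divide_eq)
  then have "x / 2 * cos (x / 2) * (2 * cos (x / 2)) \<le> sin (x / 2) * (2 * cos (x / 2))"
    using c by (intro mult_right_mono) auto
  moreover have "sin (x / 2) * (2 * cos (x / 2)) = sin x" using sin_double[of "x / 2"] by simp
  moreover have "x / 2 * (1 + cos x) = x / 2 * cos (x / 2) * (2 * cos (x / 2))"
    using cos_double_cos[of "x / 2"] by (simp add: power2_eq_square)
  ultimately have "x / 2 * (1 + cos x) \<le> sin x" by (simp only:)
  moreover have "x / 2 * 1 \<le> x / 2 * (1 + cos x)" using assms cx by (intro mult_left_mono) auto
  ultimately show ?thesis by simp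
qed

lemma sphere_inner_bounds:
  fixes y z :: "real ^ 'n"
  assumes "norm y = 1" "norm z = 1" shows "-1 \<le> z \<bullet> y" "z \<bullet> y \<le> 1"
  using Cauchy_Schwarz_ineq2[of z y] assms by auto

lemma dist_eq_geodesic:
  fixes y z :: "real ^ 'n"
  assumes "norm y = 1" "norm z = 1"
  shows "dist z y = 2 * sin (geodesic_dist z y / 2)"
proof -
  have b: "0 \<le> geodesic_dist z y" "geodesic_dist z y \<le> pi"
    using sphere_inner_bounds[OF assms] by (auto simp: geodesic_dist_def arccos_lbound arccos_ubound)
  have "(dist z y)\<^sup>2 = 2 * (1 - cos (geodesic_dist z y))"
    using dist_sphere_square[of y z] assms sphere_inner_bounds[OF assms] by (simp add: geodesic_dist_def inner_commute)
  also have "\<dots> = (2 * sin (geodesic_dist z y / 2))\<^sup>2"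
    using cos_double_sin[of "geodesic_dist z y / 2"] by (simp add: power_mult_distrib)
  finally show ?thesis by (rule power2_eq_imp_eq) (use b in \<open>auto intro!: sin_ge_zero\<close>)
qed

lemma dist_le_geodesic:
  fixes y z :: "real ^ 'n"
  assumes "norm y = 1" "norm z = 1" shows "dist z y \<le> geodesic_dist z y"
proof -
  have "0 \<le> geodesic_dist z y"
    using sphere_inner_bounds[OF assms] by (auto simp: geodesic_dist_def arccos_lbound)
  then show ?thesis unfolding dist_eq_geodesic[OF assms] using sin_x_le_x[of "geodesic_dist z y / 2"] by simp
qed

lemma geodesic_le_dist:
  fixes y z :: "real ^ 'n"
  assumes "norm y = 1" "norm z = 1" shows "geodesic_dist z y \<le> 2 * dist z y"
proof -
  have "0 \<le> geodesic_dist z y" "geodesic_dist z y \<le> pi"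
    using sphere_inner_bounds[OF assms] by (auto simp: geodesic_dist_def arccos_lbound arccos_ubound)
  then show ?thesis unfolding dist_eq_geodesic[OF assms] using half_le_sin[of "geodesic_dist z y / 2"] by simp
qed

text \<open>Rotates \<open>z\<close> towards \<open>y\<close> by the angle \<psi> in a plane
  containing both; when \<open>y\<close> is \<open>z\<close> or its antipode, any orthogonal
  direction spans such a plane. It supplies the intermediate centers of the chains of balls.\<close>

lemma geodesic_point:
  fixes y z :: "real ^ 'n"
  assumes n: "2 \<le> CARD('n)" and y: "norm y = 1" and z: "norm z = 1" and \<psi>: "0 \<le> \<psi>" "\<psi> \<le> geodesic_dist z y"
  obtains p where "norm p = 1" "geodesic_dist z p = \<psi>" "dist p y \<le> geodesic_dist z y - \<psi>"
proof -
  define \<phi> where "\<phi> = geodesic_dist z y"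
  have b: "0 \<le> \<phi>" "\<phi> \<le> pi" "cos \<phi> = z \<bullet> y"
    using sphere_inner_bounds[OF y z] by (auto simp: \<phi>_def geodesic_dist_def arccos_lbound arccos_ubound)
  define q where "q = y - (y \<bullet> z) *\<^sub>R z"
  have qz: "z \<bullet> q = 0" using z by (simp add: q_def inner_diff_right norm_eq_1 inner_commute)
  have "(norm q)\<^sup>2 = (sin \<phi>)\<^sup>2"
    unfolding q_def norm_perp_square[OF y z] using b(3) by (simp add: sin_squared_eq inner_commute)
  then have q: "norm q = sin \<phi>" by (rule power2_eq_imp_eq) (use b in \<open>auto intro!: sin_ge_zero\<close>)
  obtain e where e: "norm e = 1" "z \<bullet> e = 0" "norm q *\<^sub>R e = q"
  proof (cases "q = 0")
    case True
    obtain v where v: "v \<noteq> 0" "orthogonal z v" using orthogonal_to_vector_exists[of z] n by auto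
    show ?thesis
      by (rule that[of "sgn v"]) (use v True in \<open>auto simp: norm_sgn orthogonal_def sgn_div_norm\<close>)
  next
    case False
    show ?thesis
      by (rule that[of "sgn q"]) (use qz False in \<open>auto simp: norm_sgn sgn_div_norm\<close>)
  qed
  have y_eq: "y = cos \<phi> *\<^sub>R z + sin \<phi> *\<^sub>R e"
    using e(3) unfolding q b(3) by (simp add: q_def inner_commute)
  define p where "p = cos \<psi> *\<^sub>R z + sin \<psi> *\<^sub>R e"
  have ip: "z \<bullet> z = 1" "e \<bullet> e = 1" "e \<bullet> z = 0" using z e by (auto simp: norm_eq_1 inner_commute)
  have pp: "p \<bullet> p = 1"
    using ip e(2) by (simp add: p_def inner_add_left inner_add_right power2_eq_square[symmetric])
  then have p: "norm p = 1" by (simp add: norm_eq_1)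
  have "z \<bullet> p = cos \<psi>" using ip e(2) by (simp add: p_def inner_add_right)
  then have gp: "geodesic_dist z p = \<psi>"
    using \<psi> b unfolding geodesic_dist_def by (auto simp: \<phi>_def geodesic_dist_def intro!: arccos_cos)
  have "p \<bullet> y = cos (\<phi> - \<psi>)"
    using ip e(2) by (simp add: p_def y_eq inner_add_left inner_add_right cos_diff mult_ac)
  then have "geodesic_dist p y = \<phi> - \<psi>"
    using \<psi> b unfolding geodesic_dist_def[of p] by (auto simp: \<phi>_def[symmetric] intro!: arccos_cos)
  then have "dist p y \<le> \<phi> - \<psi>" using dist_le_geodesic[OF y p] by simp
  with p gp that show ?thesis by (auto simp: \<phi>_def)
qed

section \<open>Spreading over caps\<close>

text \<open>The Borel set \<open>B\<close> contains the failures of \<open>P\<close> in the part of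
  \<open>U\<close> on the sphere, so measurability questions about \<open>P\<close> itself do not
  arise; \<open>B\<close> may reach outside \<open>U\<close>.\<close>

definition mostly :: "(real ^ 'n \<Rightarrow> bool) \<Rightarrow> real \<Rightarrow> (real ^ 'n) set \<Rightarrow> bool" where
  "mostly P \<delta> U \<longleftrightarrow> (\<exists>B\<in>sets borel. \<sigma> B \<le> \<delta> * \<sigma> U \<and>
     (\<forall>u \<in> sphere 0 1 \<inter> U - B. P u))"

lemma mostly_subset:
  assumes "mostly P \<delta> U" "V \<subseteq> U" "\<sigma> U \<le> c * \<sigma> V" "0 \<le> \<delta>"
  shows "mostly P (\<delta> * c) V"
proof -
  from assms(1) obtain B where B: "B \<in> sets borel" "\<sigma> B \<le> \<delta> * \<sigma> U"
     "\<forall>u \<in> sphere 0 1 \<inter> U - B. P u" unfolding mostly_def by blast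
  have "\<delta> * \<sigma> U \<le> \<delta> * (c * \<sigma> V)"
    using assms(3,4) by (rule mult_left_mono)
  with B assms(2) show ?thesis unfolding mostly_def by (intro bexI[of _ B]) (auto simp: mult.assoc)
qed

text \<open>Two balls whose centers are close overlap in a set of positive proportion, so a property that spreads
  from one point to most of a ball around it spreads along geodesics.\<close>

lemma spread_along_geodesic:
  fixes P :: "'i \<Rightarrow> real \<Rightarrow> real ^ 'n \<Rightarrow> bool" and h :: "'i \<Rightarrow> real" and k :: nat
  assumes n: "2 \<le> CARD('n)" and h: "\<And>i. i \<in> I \<Longrightarrow> 0 < h i"
    and step: "\<And>\<kappa> \<delta>. 0 < \<kappa> \<Longrightarrow> 0 < \<delta> \<Longrightarrow> \<exists>\<kappa>'>0. \<forall>i\<in>I. \<forall>z. norm z = 1 \<and> P i \<kappa> z \<longrightarrow> mostly (P i \<kappa>') \<delta> (ball z (h i))"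
    and \<kappa>: "0 < \<kappa>" and \<delta>: "0 < \<delta>"
  shows "\<exists>\<kappa>'>0. \<forall>i\<in>I. \<forall>z y. norm z = 1 \<and> norm y = 1 \<and> P i \<kappa> z \<and> geodesic_dist z y \<le> k * (h i / 4) \<longrightarrow>
     mostly (P i \<kappa>') \<delta> (ball y (h i / 2))"
  using \<delta>
proof (induction k arbitrary: \<delta>)
  case 0
  obtain D where "doubling_measure sphere_measure (sphere 0 1 :: (real ^ 'n) set) D"
    using sphere_measure_doubling by blast
  then interpret D: doubling_measure "sphere_measure :: (real ^ 'n) measure" "sphere 0 1" D .
  have D: "0 < D" using D.D_ge_1 by simp
  have "0 < \<delta> / D" using 0 D by simp
  from step[OF \<kappa> this] obtain \<kappa>' where \<kappa>': "0 < \<kappa>'" "\<forall>i\<in>I. \<forall>z. norm z = 1 \<and> P i \<kappa> z \<longrightarrow> mostly (P i \<kappa>') (\<delta> / D) (ball z (h i))"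
    by blast
  show ?case
  proof (intro exI[of _ \<kappa>'] conjI ballI allI impI \<kappa>'(1))
    fix i z y assume i: "i \<in> I" and *: "norm z = 1 \<and> norm y = 1 \<and> P i \<kappa> z \<and> geodesic_dist z y \<le> real 0 * (h i / 4)"
    have "dist z y \<le> geodesic_dist z y" using * by (intro dist_le_geodesic) auto
    moreover have "geodesic_dist z y \<le> 0" using * by simp
    ultimately have "dist z y \<le> 0" by linarith
    then have zy: "z = y" by simp
    have "mostly (P i \<kappa>') (\<delta> / D * D) (ball y (h i / 2))"
    proof (rule mostly_subset)
      show "mostly (P i \<kappa>') (\<delta> / D) (ball y (h i))" using \<kappa>'(2) i * zy by blast
      show "\<sigma> (ball y (h i)) \<le> D * \<sigma> (ball y (h i / 2))"
        using D.doubling[of y "h i / 2"] h[OF i] * by simp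
    qed (use h[OF i] 0 D in auto)
    then show "mostly (P i \<kappa>') \<delta> (ball y (h i / 2))" using D by simp
  qed
next
  case (Suc k)
  obtain D where "doubling_measure sphere_measure (sphere 0 1 :: (real ^ 'n) set) D"
    using sphere_measure_doubling by blast
  then interpret D: doubling_measure "sphere_measure :: (real ^ 'n) measure" "sphere 0 1" D .
  have D: "0 < D\<^sup>2" using D.D_ge_1 by simp
  \<comment> \<open>With this tolerance the exceptional set for the ball at \<open>p\<close> has at
    most half the measure of \<open>ball y (b / 4)\<close>, so some point \<open>q\<close> of that
    ball is good.\<close>
  have "0 < 1 / (2 * D\<^sup>2)" using D by simp
  from Suc.IH[OF this] obtain \<kappa>1 where \<kappa>1: "0 < \<kappa>1"
    "\<forall>i\<in>I. \<forall>z y. norm z = 1 \<and> norm y = 1 \<and> P i \<kappa> z \<and> geodesic_dist z y \<le> k * (h i / 4) \<longrightarrow>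
     mostly (P i \<kappa>1) (1 / (2 * D\<^sup>2)) (ball y (h i / 2))" by blast
  have "0 < \<delta> / D\<^sup>2" using Suc.prems D by simp
  from step[OF \<kappa>1(1) this] obtain \<kappa>' where \<kappa>': "0 < \<kappa>'"
    "\<forall>i\<in>I. \<forall>z. norm z = 1 \<and> P i \<kappa>1 z \<longrightarrow> mostly (P i \<kappa>') (\<delta> / D\<^sup>2) (ball z (h i))"
    by blast
  show ?case
  proof (intro exI[of _ \<kappa>'] conjI ballI allI impI \<kappa>'(1))
    fix i z y assume i: "i \<in> I" and *: "norm z = 1 \<and> norm y = 1 \<and> P i \<kappa> z \<and> geodesic_dist z y \<le> real (Suc k) * (h i / 4)"
    then have z: "norm z = 1" and y: "norm y = 1" and Pz: "P i \<kappa> z" and zy: "geodesic_dist z y \<le> real (Suc k) * (h i / 4)"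
      by auto
    define b where "b = h i"
    have b: "0 < b" using h[OF i] by (simp add: b_def)
    \<comment> \<open>One step short of \<open>y\<close> on the geodesic from \<open>z\<close>. The
      hypothesis \<open>step\<close> is then applied at the good point \<open>q\<close> near
      \<open>y\<close>, whose ball of radius \<open>b\<close> covers
      \<open>ball y (b / 2)\<close>.\<close>
    obtain p where p: "norm p = 1" "geodesic_dist z p \<le> k * (b / 4)" "dist p y \<le> b / 4"
    proof -
      define \<psi> where "\<psi> = min (geodesic_dist z y) (k * (b / 4))"
      have "0 \<le> geodesic_dist z y"
        using dist_le_geodesic[OF y z] zero_le_dist[of z y] by linarith
      then have \<psi>: "0 \<le> \<psi>" "\<psi> \<le> geodesic_dist z y" using b by (auto simp: \<psi>_def)
      obtain p where "norm p = 1" "geodesic_dist z p = \<psi>" "dist p y \<le> geodesic_dist z y - \<psi>"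
        using geodesic_point[OF n y z \<psi>] by blast
      then show thesis using zy b by (intro that[of p]) (auto simp: \<psi>_def b_def[symmetric] algebra_simps min_def split: if_splits)
    qed
    have "mostly (P i \<kappa>1) (1 / (2 * D\<^sup>2)) (ball p (b / 2))"
      using \<kappa>1(2) i z p(1,2) Pz by (simp add: b_def)
    then obtain B where B: "B \<in> sets borel" "\<sigma> B \<le> 1 / (2 * D\<^sup>2) * \<sigma> (ball p (b / 2))"
       "\<forall>u \<in> sphere 0 1 \<inter> ball p (b / 2) - B. P i \<kappa>1 u" unfolding mostly_def by blast
    have yb: "0 < \<sigma> (ball y (b / 4))" using y b by (intro D.ball_pos) auto
    have "ball p (b / 2) \<subseteq> ball y (2\<^sup>2 * (b / 4))"
    proof
      fix u assume "u \<in> ball p (b / 2)"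
      then show "u \<in> ball y (2\<^sup>2 * (b / 4))" using p(3) b dist_triangle[of y u p] by (auto simp: dist_commute)
    qed
    then have "\<sigma> (ball p (b / 2)) \<le> \<sigma> (ball y (2\<^sup>2 * (b / 4)))"
      by (intro sm.finite_measure_mono) auto
    also have "\<dots> \<le> D\<^sup>2 * \<sigma> (ball y (b / 4))" using y b by (intro D.doubling_pow) auto
    finally have "1 / (2 * D\<^sup>2) * \<sigma> (ball p (b / 2)) \<le> 1 / (2 * D\<^sup>2) * (D\<^sup>2 * \<sigma> (ball y (b / 4)))"
      using D by (intro mult_left_mono) auto
    also have "\<dots> = \<sigma> (ball y (b / 4)) / 2" using D by simp
    finally have Bs: "\<sigma> B < \<sigma> (ball y (b / 4))" using B(2) yb by linarith
    have "\<exists>q. q \<in> sphere 0 1 \<inter> ball y (b / 4) - B"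
    proof (rule ccontr)
      assume "\<not> ?thesis"
      then have "ball y (b / 4) \<inter> sphere 0 1 \<subseteq> B" by blast
      then have "\<sigma> (ball y (b / 4) \<inter> sphere 0 1) \<le> \<sigma> B"
        using B(1) by (intro sm.finite_measure_mono) auto
      then show False using Bs by (simp add: sphere_measure_Int_sphere)
    qed
    then obtain q where q: "norm q = 1" "dist y q < b / 4" "q \<notin> B" by auto
    have "q \<in> ball p (b / 2)" using q(2) p(3) dist_triangle[of p q y] by auto
    then have "P i \<kappa>1 q" using B(3) q by simp
    then have "mostly (P i \<kappa>') (\<delta> / D\<^sup>2) (ball q b)" using \<kappa>'(2) i q(1) by (simp add: b_def)
    then have "mostly (P i \<kappa>') (\<delta> / D\<^sup>2 * D\<^sup>2) (ball y (b / 2))"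
    proof (rule mostly_subset)
      show "ball y (b / 2) \<subseteq> ball q b"
      proof
        fix u assume "u \<in> ball y (b / 2)"
        then show "u \<in> ball q b" using q(2) b dist_triangle[of q u y] by (auto simp: dist_commute)
      qed
      have "ball q b \<subseteq> ball y (2\<^sup>2 * (b / 2))"
      proof
        fix u assume "u \<in> ball q b"
        then show "u \<in> ball y (2\<^sup>2 * (b / 2))" using q(2) b dist_triangle[of y u q] by (auto simp: dist_commute)
      qed
      then have "\<sigma> (ball q b) \<le> \<sigma> (ball y (2\<^sup>2 * (b / 2)))"
        by (intro sm.finite_measure_mono) auto
      also have "\<dots> \<le> D\<^sup>2 * \<sigma> (ball y (b / 2))" using y b by (intro D.doubling_pow) auto
      finally show "\<sigma> (ball q b) \<le> D\<^sup>2 * \<sigma> (ball y (b / 2))" .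
    qed (use Suc.prems D in auto)
    then show "mostly (P i \<kappa>') \<delta> (ball y (h i / 2))" using D by (simp add: b_def)
  qed
qed

text \<open>Balls of radius \<open>b / 2\<close> around the centers of a disjoint family of radius
  \<open>b / 6\<close> cover the sphere. Each exceptional set is charged to the small ball at its
  center, and disjointness bounds the sum by the measure of one larger ball.\<close>

lemma spread_over_cap:
  fixes P :: "'i \<Rightarrow> real \<Rightarrow> real ^ 'n \<Rightarrow> bool" and h :: "'i \<Rightarrow> real" and k :: nat
  assumes n: "2 \<le> CARD('n)" and h: "\<And>i. i \<in> I \<Longrightarrow> 0 < h i"
    and step: "\<And>\<kappa> \<delta>. 0 < \<kappa> \<Longrightarrow> 0 < \<delta> \<Longrightarrow> \<exists>\<kappa>'>0. \<forall>i\<in>I. \<forall>z. norm z = 1 \<and> P i \<kappa> z \<longrightarrow> mostly (P i \<kappa>') \<delta> (ball z (h i))"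
    and \<kappa>: "0 < \<kappa>" and \<delta>: "0 < \<delta>"
  shows "\<exists>\<kappa>'>0. \<forall>i\<in>I. \<forall>z. norm z = 1 \<and> P i \<kappa> z \<longrightarrow>
     (\<exists>B\<in>sets borel. \<sigma> B \<le> \<delta> * \<sigma> (ball z (k * (h i / 4) + 2 * h i)) \<and>
       (\<forall>u \<in> cap z (k * (h i / 4)) - B. P i \<kappa>' u))"
proof -
  obtain D where "doubling_measure sphere_measure (sphere 0 1 :: (real ^ 'n) set) D"
    using sphere_measure_doubling by blast
  then interpret D: doubling_measure "sphere_measure :: (real ^ 'n) measure" "sphere 0 1" D .
  have D: "0 < D\<^sup>2" using D.D_ge_1 by simp
  have "0 < \<delta> / D\<^sup>2" using \<delta> D by simp
  \<comment> \<open>Relevant centers have chordal distance below \<open>k * (b / 4) + b / 2\<close>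
    from \<open>z\<close>, hence geodesic distance at most twice that, which is
    \<open>2 * k + 4\<close> steps of \<open>b / 4\<close>.\<close>
  from spread_along_geodesic[where k = "2 * k + 4", OF n h step \<kappa> this]
  obtain \<kappa>' where \<kappa>': "0 < \<kappa>'" "\<forall>i\<in>I. \<forall>z y. norm z = 1 \<and> norm y = 1 \<and> P i \<kappa> z \<and>
      geodesic_dist z y \<le> (2 * k + 4 :: nat) * (h i / 4) \<longrightarrow> mostly (P i \<kappa>') (\<delta> / D\<^sup>2) (ball y (h i / 2))" by blast
  show ?thesis
  proof (intro exI[of _ \<kappa>'] conjI ballI allI impI \<kappa>'(1))
    fix i z assume i: "i \<in> I" and *: "norm z = 1 \<and> P i \<kappa> z"
    define b where "b = h i"
    have b: "0 < b" using h[OF i] by (simp add: b_def)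
    have z: "norm z = 1" using * by simp
    let ?S = "sphere 0 1 :: (real ^ 'n) set" and ?R = "k * (b / 4) + 2 * b"
    obtain F where F: "F \<subseteq> ?S" "finite F" "?S \<subseteq> (\<Union>y\<in>F. ball y (b / 6))"
      by (rule compactE_image[OF compact_sphere, of ?S "\<lambda>y. ball y (b / 6)"]) (use b in auto)
    from finite_disjoint_balls[OF F(2), of "\<lambda>y. y" "\<lambda>y. b / 6"] obtain J where J: "J \<subseteq> F"
      "disjoint_family_on (\<lambda>y. ball y (b / 6)) J" "(\<Union>y\<in>F. ball y (b / 6)) \<subseteq> (\<Union>y\<in>J. ball y (b / 2))"
      by auto
    define J' where "J' = {y \<in> J. dist z y < k * (b / 4) + b / 2}"
    have J': "finite J'" "J' \<subseteq> ?S" using J(1) F(1,2) by (auto simp: J'_def intro: finite_subset)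
    have "mostly (P i \<kappa>') (\<delta> / D\<^sup>2) (ball y (b / 2))" if y: "y \<in> J'" for y
    proof -
      have y1: "norm y = 1" using y J'(2) by auto
      have "geodesic_dist z y \<le> 2 * dist z y" by (rule geodesic_le_dist[OF y1 z])
      also have "\<dots> \<le> 2 * (k * (b / 4) + b / 2)" using y by (intro mult_left_mono) (auto simp: J'_def)
      also have "\<dots> = (2 * k + 4 :: nat) * (b / 4)" by (simp add: algebra_simps)
      finally show ?thesis using \<kappa>'(2) i * y1 unfolding b_def by blast
    qed
    then have "\<forall>y\<in>J'. \<exists>B. B \<in> sets borel \<and> \<sigma> B \<le> \<delta> / D\<^sup>2 * \<sigma> (ball y (b / 2)) \<and>
       (\<forall>u \<in> ?S \<inter> ball y (b / 2) - B. P i \<kappa>' u)" unfolding mostly_def by blast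
    then obtain B where B: "\<forall>y\<in>J'. B y \<in> sets borel \<and> \<sigma> (B y) \<le> \<delta> / D\<^sup>2 * \<sigma> (ball y (b / 2)) \<and>
       (\<forall>u \<in> ?S \<inter> ball y (b / 2) - B y. P i \<kappa>' u)" by (rule bchoice[THEN exE])
    have UB: "(\<Union>y\<in>J'. B y) \<in> sets borel" using B J'(1) by (intro sets.finite_UN) auto
    have "\<sigma> (\<Union>y\<in>J'. B y) \<le> (\<Sum>y\<in>J'. \<sigma> (B y))"
      using B J'(1) by (intro sm.finite_measure_subadditive_finite) auto
    also have "\<dots> \<le> (\<Sum>y\<in>J'. \<delta> * \<sigma> (ball y (b / 6)))"
    proof (rule sum_mono)
      fix y assume y: "y \<in> J'"
      have "\<sigma> (ball y (b / 2)) \<le> \<sigma> (ball y (2\<^sup>2 * (b / 6)))"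
        using b by (intro sm.finite_measure_mono subset_ball) auto
      also have "\<dots> \<le> D\<^sup>2 * \<sigma> (ball y (b / 6))"
        using y J'(2) b by (intro D.doubling_pow) auto
      finally have "\<delta> / D\<^sup>2 * \<sigma> (ball y (b / 2)) \<le> \<delta> / D\<^sup>2 * (D\<^sup>2 * \<sigma> (ball y (b / 6)))"
        using \<delta> D by (intro mult_left_mono) auto
      also have "\<dots> = \<delta> * \<sigma> (ball y (b / 6))" using D by simp
      finally show "\<sigma> (B y) \<le> \<delta> * \<sigma> (ball y (b / 6))"
        using B y by fastforce
    qed
    also have "\<dots> = \<delta> * (\<Sum>y\<in>J'. \<sigma> (ball y (b / 6)))" by (simp add: sum_distrib_left)
    also have "(\<Sum>y\<in>J'. \<sigma> (ball y (b / 6))) = \<sigma> (\<Union>y\<in>J'. ball y (b / 6))"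
      using J'(1) J(2) by (intro sm.finite_measure_finite_Union[symmetric]) (auto simp: disjoint_family_on_def J'_def)
    also have "\<dots> \<le> \<sigma> (ball z ?R)"
    proof (rule sm.finite_measure_mono)
      show "(\<Union>y\<in>J'. ball y (b / 6)) \<subseteq> ball z ?R"
      proof
        fix u assume "u \<in> (\<Union>y\<in>J'. ball y (b / 6))"
        then obtain y where y: "dist z y < k * (b / 4) + b / 2" "dist y u < b / 6" by (auto simp: J'_def)
        then show "u \<in> ball z ?R" using b dist_triangle[of z u y] by auto
      qed
    qed auto
    finally have mB: "\<sigma> (\<Union>y\<in>J'. B y) \<le> \<delta> * \<sigma> (ball z ?R)"
      using \<delta> by (simp add: mult_left_mono)
    have good: "P i \<kappa>' u" if u: "u \<in> cap z (k * (b / 4)) - (\<Union>y\<in>J'. B y)" for u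
    proof -
      have u1: "norm u = 1" "geodesic_dist z u < k * (b / 4)" using u by (auto simp: cap_def)
      have "u \<in> ?S" using u1(1) by simp
      then have "u \<in> (\<Union>y\<in>J. ball y (b / 2))" using F(3) J(3) by blast
      then obtain y where y: "y \<in> J" "dist y u < b / 2" by auto
      have "dist z y \<le> dist z u + dist y u" using dist_triangle[of z y u] by (simp add: dist_commute)
      also have "\<dots> < k * (b / 4) + b / 2" using dist_le_geodesic[OF u1(1) z] u1(2) y(2) by linarith
      finally have "y \<in> J'" using y(1) by (simp add: J'_def)
      then show ?thesis using B u u1(1) y(2) by auto
    qed
    show "\<exists>B\<in>sets borel. \<sigma> B \<le> \<delta> * \<sigma> (ball z (k * (h i / 4) + 2 * h i)) \<and>
       (\<forall>u \<in> cap z (k * (h i / 4)) - B. P i \<kappa>' u)"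
      unfolding b_def[symmetric] using UB mB good by blast
  qed
qed

section \<open>The sampling inequality\<close>

lemma cap_borel:
  assumes "norm z = 1"
  shows "cap z \<delta> \<in> sets borel"
  unfolding cap_def geodesic_dist_def
proof (rule sublevel_borel_on)
  show "continuous_on (sphere 0 1) (\<lambda>v. arccos (z \<bullet> v))"
    using sphere_inner_bounds[OF _ assms]
    by (intro continuous_on_arccos continuous_intros) auto
qed (simp add: borel_closed)

text \<open>Iterated doubling turns the constant \<open>Dw \<le> 2 ^ s\<close> into growth of order
  \<open>s\<close>. This exponent is the one that the kernel later damps.\<close>

lemma (in rh_weight) ball_growth:
  "\<exists>s. \<forall>u\<in>X. \<forall>z h. 0 < h \<longrightarrow> measure wM (ball z h) \<le> 2 ^ s * (1 + dist u z / h) ^ s * measure wM (ball u h)"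
proof -
  obtain s where s: "Dw \<le> 2 ^ s" using real_arch_pow[of 2 Dw] by (auto intro: less_imp_le)
  show ?thesis
  proof (intro exI[of _ s] ballI allI impI)
    fix u z and h :: real assume u: "u \<in> X" and h: "0 < h"
    define t where "t = 1 + dist u z / h"
    have t: "1 \<le> t" using h by (simp add: t_def)
    define k where "k = nat \<lceil>log 2 t\<rceil>"
    have lt: "0 \<le> log 2 t" using t by simp
    have "log 2 t \<le> k" unfolding k_def by linarith
    then have "2 powr (log 2 t) \<le> 2 powr k" by (intro powr_mono) auto
    then have k1: "t \<le> 2 ^ k" using t by (simp add: powr_realpow)
    have "real k \<le> log 2 t + 1" unfolding k_def using lt by linarith
    then have "2 powr k \<le> 2 powr (log 2 t + 1)" by (intro powr_mono) auto
    then have k2: "2 ^ k \<le> 2 * t" using t by (simp add: powr_realpow powr_add)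
    have "ball z h \<subseteq> ball u (2 ^ k * h)"
    proof
      fix x assume "x \<in> ball z h"
      then have "dist u x < dist u z + h" using dist_triangle[of u x z] by auto
      also have "\<dots> = t * h" using h by (simp add: t_def field_simps)
      also have "\<dots> \<le> 2 ^ k * h" using k1 h by (intro mult_right_mono) auto
      finally show "x \<in> ball u (2 ^ k * h)" by simp
    qed
    then have "measure wM (ball z h) \<le> measure wM (ball u (2 ^ k * h))" by (intro N_mono_borel) auto
    also have "\<dots> \<le> Dw ^ k * measure wM (ball u h)" by (rule w_doubling_pow[OF u h])
    also have "\<dots> \<le> (2 ^ s * t ^ s) * measure wM (ball u h)"
    proof (intro mult_right_mono)
      have "Dw ^ k \<le> (2 ^ s) ^ k" using s Dw_ge_1 by (intro power_mono) auto
      also have "\<dots> = (2 ^ k) ^ s" by (simp add: power_mult[symmetric] mult.commute)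
      also have "\<dots> \<le> (2 * t) ^ s" using k2 by (intro power_mono) auto
      finally show "Dw ^ k \<le> 2 ^ s * t ^ s" by (simp add: power_mult_distrib)
    qed simp
    finally show "measure wM (ball z h) \<le> 2 ^ s * (1 + dist u z / h) ^ s * measure wM (ball u h)"
      by (simp add: t_def)
  qed
qed

text \<open>\<open>S\<close> is a common yardstick: it dominates the weighted polynomial almost
  everywhere and is dominated by it on a cap outside a set \<open>B\<close> too small to contain a
  set of relative density \<rho>.\<close>

lemma rh_sampling:
  fixes w :: "real ^ 'n \<Rightarrow> real" and r \<rho> :: real
  assumes n: "2 \<le> CARD('n)" and rhw: "rh_weight sphere_measure (sphere 0 1) D w C Dw"
    and wpos: "\<And>z s. norm z = 1 \<Longrightarrow> 0 < s \<Longrightarrow> 0 < measure (density sphere_measure (\<lambda>x. ennreal (w x))) (ball z s)"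
    and r: "0 < r" and \<rho>: "0 < \<rho>"
  shows "\<exists>K1>0. \<exists>K2>0. \<forall>L\<ge>1. \<forall>Q\<in>spherical_polys L. \<exists>S\<ge>0. \<exists>z B. norm z = 1 \<and> B \<in> sets borel \<and>
    (AE u in sphere_measure. u \<in> sphere 0 1 \<longrightarrow> cmod (Q u) * w u \<le> K1 * S) \<and>
    \<sigma> B < \<rho> * \<sigma> (cap z (r / real L)) \<and>
    (\<forall>u \<in> cap z (r / real L) - B. K2 * S \<le> cmod (Q u) * w u)"
proof -
  interpret W: rh_weight "sphere_measure :: (real ^ 'n) measure" "sphere 0 1" D w C Dw by (rule rhw)
  define N where "N = W.wM"
  have N_pos: "0 < measure N (ball z s)" if "norm z = 1" "0 < s" for z s
    using wpos[OF that] by (simp add: N_def W.wM_def)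
  have C0: "0 < C" and D0: "0 < D" and Dw0: "0 < Dw" using W.C_ge_1 W.D_ge_1 W.Dw_ge_1 by auto
  obtain s where s': "\<forall>u\<in>sphere 0 1. \<forall>z h. 0 < h \<longrightarrow> measure N (ball z h) \<le> 2 ^ s * (1 + dist u z / h) ^ s * measure N (ball u h)"
    using W.ball_growth unfolding N_def by blast
  have s: "measure N (ball z h) \<le> 2 ^ s * (1 + dist u z / h) ^ s * measure N (ball u h)"
    if "norm u = 1" "0 < h" for u z h
    using s' that by simp
  obtain a1 a2 where a: "0 < a1" "0 < a2"
    "\<And>(z :: real ^ 'n) s. norm z = 1 \<Longrightarrow> 0 < s \<Longrightarrow> \<sigma> (ball z s) \<le> a2 * s ^ (CARD('n) - 1)"
    "\<And>(z :: real ^ 'n) s. norm z = 1 \<Longrightarrow> 0 < s \<Longrightarrow> s \<le> 2 \<Longrightarrow> a1 * s ^ (CARD('n) - 1) \<le> \<sigma> (ball z s)"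
    using sphere_measure_ball_bounds[where 'n='n] by blast
  define v where "v L u = measure N (ball u (1 / real L))" for L :: nat and u
  \<comment> \<open>Making the pair an index lets the spreading lemmas produce constants valid for
    all \<open>L\<close> and \<open>Q\<close> at once.\<close>
  define I where "I = {(L :: nat, Q :: real ^ 'n \<Rightarrow> complex). 1 \<le> L \<and> Q \<in> spherical_polys L}"
  define h where "h i = 1 / (16 * real (fst i))" for i :: "nat \<times> (real ^ 'n \<Rightarrow> complex)"
  define P where "P i \<kappa> z \<longleftrightarrow> (\<forall>u\<in>sphere 0 1. cmod (snd i u) * v (fst i) u \<le> \<kappa> * (cmod (snd i z) * v (fst i) z))"
    for i :: "nat \<times> (real ^ 'n \<Rightarrow> complex)" and \<kappa> :: real and z
  have h: "0 < h i" if "i \<in> I" for i using that by (auto simp: I_def h_def)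
  have v_growth: "v L z \<le> 2 ^ s * (1 + real L * norm (u - z)) ^ s * v L u" if "1 \<le> L" "norm u = 1" for L u z
    using s[OF that(2), of "1 / real L" z] that(1) by (simp add: v_def dist_norm mult.commute)
  have v_pos: "0 < v L u" if "1 \<le> L" "norm u = 1" for L u
    using N_pos[OF that(2), of "1 / real L"] that(1) by (simp add: v_def)
  \<comment> \<open>Near-maximality at \<open>z\<close> gives polynomial growth of \<open>Q\<close>
    after division by \<open>v\<close>. Then \<open>Q\<close> is rarely much smaller than at
    \<open>z\<close>, and wherever it is not, near-maximality persists with a worse
    constant.\<close>
  have step: "\<exists>\<kappa>'>0. \<forall>i\<in>I. \<forall>z. norm z = 1 \<and> P i \<kappa> z \<longrightarrow> mostly (P i \<kappa>') \<delta> (ball z (h i))"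
    if \<kappa>: "0 < \<kappa>" and \<delta>: "0 < \<delta>" for \<kappa> \<delta>
  proof -
    obtain \<epsilon> where \<epsilon>: "0 < \<epsilon>" and E: "\<forall>L\<ge>1. \<forall>Q\<in>spherical_polys L. \<forall>z :: real ^ 'n.
      norm z = 1 \<and> (\<forall>u\<in>sphere 0 1. cmod (Q u) \<le> (\<kappa> * 2 ^ s) * (1 + real L * norm (u - z)) ^ s * cmod (Q z)) \<longrightarrow>
      \<sigma> ({u \<in> sphere 0 1. cmod (Q u) < \<epsilon> * cmod (Q z)} \<inter> ball z (1 / (16 * real L)))
      \<le> \<delta> * \<sigma> (ball z (1 / (16 * real L)))"
      using spherical_poly_small_values[OF n \<delta>, of "\<kappa> * 2 ^ s" s] by blast
    \<comment> \<open>\<open>Q\<close> loses at most the factor \<epsilon>, and \<open>v\<close> at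
      most \<open>4 ^ s\<close> because \<open>L * norm (u - z)\<close> is at most 1 on this
      ball.\<close>
    define \<kappa>' where "\<kappa>' = \<kappa> * 4 ^ s / \<epsilon>"
    have \<kappa>': "0 < \<kappa>'" using \<kappa> \<epsilon> by (simp add: \<kappa>'_def)
    show ?thesis
    proof (intro exI[of _ \<kappa>'] conjI ballI allI impI \<kappa>')
      fix i z assume i: "i \<in> I" and *: "norm z = 1 \<and> P i \<kappa> z"
      obtain L Q where LQ: "i = (L, Q)" by (cases i)
      have L: "1 \<le> L" and Q: "Q \<in> spherical_polys L" using i by (auto simp: I_def LQ)
      have z: "norm z = 1" using * by simp
      have dom: "cmod (Q u) * v L u \<le> \<kappa> * (cmod (Q z) * v L z)" if "norm u = 1" for u
        using * that by (simp add: P_def LQ)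
      have growth: "cmod (Q u) \<le> (\<kappa> * 2 ^ s) * (1 + real L * norm (u - z)) ^ s * cmod (Q z)" if u: "norm u = 1" for u
      proof -
        have "cmod (Q u) * v L u \<le> \<kappa> * (cmod (Q z) * v L z)" by (rule dom[OF u])
        also have "\<dots> \<le> \<kappa> * (cmod (Q z) * (2 ^ s * (1 + real L * norm (u - z)) ^ s * v L u))"
          using \<kappa> by (intro mult_left_mono v_growth[OF L u]) auto
        also have "\<dots> = ((\<kappa> * 2 ^ s) * (1 + real L * norm (u - z)) ^ s * cmod (Q z)) * v L u"
          by (simp only: mult_ac)
        finally show ?thesis using v_pos[OF L u] by (simp only: mult_le_cancel_right_pos)
      qed
      define A where "A = {u \<in> sphere 0 1. cmod (Q u) < \<epsilon> * cmod (Q z)}"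
      define b where "b = 1 / (16 * real L)"
      have b: "0 < b" using L by (simp add: b_def)
      have A: "A \<in> sets borel"
        unfolding A_def by (intro sublevel_borel_on continuous_on_norm continuous_on_spherical_poly[OF Q]) (auto intro: borel_closed)
      have "\<sigma> (A \<inter> ball z b) \<le> \<delta> * \<sigma> (ball z b)"
        unfolding A_def b_def using E L Q z growth by simp
      moreover have "\<forall>u \<in> sphere 0 1 \<inter> ball z b - A \<inter> ball z b. P i \<kappa>' u"
      proof
        fix u assume u: "u \<in> sphere 0 1 \<inter> ball z b - A \<inter> ball z b"
        have u1: "norm u = 1" "dist z u < b" "\<epsilon> * cmod (Q z) \<le> cmod (Q u)" using u by (auto simp: A_def)
        have Lb: "real L * b \<le> 1" using L by (simp add: b_def)
        have "real L * norm (u - z) \<le> real L * b"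
          using u1(2) by (intro mult_left_mono) (auto simp: dist_norm norm_minus_commute)
        then have "real L * norm (u - z) \<le> 1" using Lb by linarith
        then have "(1 + real L * norm (u - z)) ^ s \<le> 2 ^ s" by (intro power_mono) auto
        then have "2 ^ s * (1 + real L * norm (u - z)) ^ s * v L u \<le> 2 ^ s * 2 ^ s * v L u"
          using v_pos[OF L u1(1)] by (intro mult_right_mono mult_left_mono) auto
        then have vz: "v L z \<le> 4 ^ s * v L u"
          using v_growth[OF L u1(1), of z] by (simp add: power_mult_distrib[symmetric])
        have Qz: "cmod (Q z) \<le> cmod (Q u) / \<epsilon>" using u1(3) \<epsilon> by (simp add: le_divide_eq mult.commute)
        have "cmod (Q u') * v L u' \<le> \<kappa>' * (cmod (Q u) * v L u)" if "norm u' = 1" for u'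
        proof -
          have "cmod (Q u') * v L u' \<le> \<kappa> * (cmod (Q z) * v L z)" by (rule dom[OF that])
          also have "\<dots> \<le> \<kappa> * (cmod (Q u) / \<epsilon> * (4 ^ s * v L u))"
            using \<kappa> \<epsilon> vz Qz v_pos[OF L z] by (intro mult_left_mono mult_mono) auto
          also have "\<dots> = \<kappa>' * (cmod (Q u) * v L u)" by (simp add: \<kappa>'_def)
          finally show ?thesis .
        qed
        then show "P i \<kappa>' u" by (simp add: P_def LQ)
      qed
      moreover have "A \<inter> ball z b \<in> sets borel" using A by (intro sets.Int) auto
      moreover have "h i = b" by (simp add: h_def LQ b_def)
      ultimately show "mostly (P i \<kappa>') \<delta> (ball z (h i))"
        unfolding mostly_def by metis
    qed
  qed
  obtain m where "max r 1 \<le> real m" using real_arch_simple by blast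
  then have m: "1 \<le> m" "r \<le> real m" by auto
  \<comment> \<open>After \<open>q\<close> doublings the ball of radius \<open>r / (4 * L)\<close>,
    whose trace on the sphere lies in the cap of radius \<open>r / L\<close>, contains
    \<open>ball z R\<close>.\<close>
  obtain q where q: "4 * (real m + 1) / r \<le> 2 ^ q"
    using real_arch_pow[of 2 "4 * (real m + 1) / r"] by (auto intro: less_imp_le)
  have Dq: "0 < D ^ q" using D0 by simp
  \<comment> \<open>Two exceptional sets of relative size \<delta> in \<open>ball z R\<close>
    together fill at most the share \<open>\<rho> / 2\<close> of the cap.\<close>
  define \<delta> where "\<delta> = \<rho> / (4 * D ^ q)"
  have \<delta>: "0 < \<delta>" using \<rho> Dq by (simp add: \<delta>_def)
  have two: "0 < (2::real)" by simp
  \<comment> \<open>With \<open>h = 1 / (16 * L)\<close>, the radius \<open>64 * m * (h / 4)\<close>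
    is \<open>m / L\<close>, at least \<open>r / L\<close>.\<close>
  from spread_over_cap[where k = "64 * m", OF n h step two \<delta>]
  obtain \<kappa> where \<kappa>: "0 < \<kappa>" and spread: "\<forall>i\<in>I. \<forall>z. norm z = 1 \<and> P i 2 z \<longrightarrow>
     (\<exists>B\<in>sets borel. \<sigma> B \<le> \<delta> * \<sigma> (ball z ((64 * m :: nat) * (h i / 4) + 2 * h i)) \<and>
       (\<forall>u \<in> cap z ((64 * m :: nat) * (h i / 4)) - B. P i \<kappa> u))" by blast
  obtain \<epsilon> where \<epsilon>: "0 < \<epsilon>" and sub: "\<forall>z\<in>sphere 0 1. \<forall>R>0.
    \<sigma> {u \<in> ball z R. w u * \<sigma> (ball z R) < \<epsilon> * measure N (ball z R)} \<le> \<delta> * \<sigma> (ball z R)"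
    using W.sublevel_small[OF \<delta>] unfolding N_def by blast
  define d where "d = CARD('n) - 1"
  define K1 where "K1 = C * Dw / a1"
  define K2 where "K2 = \<epsilon> / (2 * (\<kappa> * (a2 * (real m + 1) ^ d)))"
  have K: "0 < K1" "0 < K2" using C0 Dw0 a \<epsilon> \<kappa> by (auto simp: K1_def K2_def intro!: divide_pos_pos mult_pos_pos)
  show ?thesis
  proof (rule exI[of _ K1], rule conjI, rule K(1), rule exI[of _ K2], rule conjI, rule K(2), intro allI impI ballI)
    fix L :: nat and Q :: "real ^ 'n \<Rightarrow> complex" assume L: "1 \<le> L" and Q: "Q \<in> spherical_polys L"
    let ?i = "(L, Q)"
    have i: "?i \<in> I" using L Q by (simp add: I_def)
    have Lr: "0 < real L" using L by simp
    let ?S = "sphere 0 1 :: (real ^ 'n) set"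
    let ?f = "\<lambda>u. cmod (Q u) * v L u"
    have vle: "v L u \<le> measure N UNIV" for u unfolding v_def N_def by (intro W.N_mono_borel) auto
    have "compact (Q ` ?S)" by (intro compact_continuous_image continuous_on_spherical_poly[OF Q] compact_sphere)
    then obtain Qb where Qb: "\<forall>u\<in>?S. cmod (Q u) \<le> Qb"
      using compact_imp_bounded[of "Q ` ?S"] unfolding bounded_iff by auto
    obtain z where z: "norm z = 1" "P ?i 2 z"
    proof -
      define T where "T = (SUP u\<in>?S. ?f u)"
      have ne: "?S \<noteq> {}" by simp
      have bdd: "bdd_above (?f ` ?S)"
      proof (rule bdd_aboveI2)
        fix u assume "u \<in> ?S"
        with Qb have "cmod (Q u) \<le> Qb" by blast
        then have "cmod (Q u) \<le> \<bar>Qb\<bar>" by linarith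
        then show "?f u \<le> \<bar>Qb\<bar> * measure N UNIV"
          using vle[of u] by (intro mult_mono) (auto simp: v_def)
      qed
      have up: "?f u \<le> T" if "norm u = 1" for u
        unfolding T_def using that by (intro cSUP_upper bdd) auto
      obtain u0 where u0: "u0 \<in> ?S" using ne by blast
      have T0: "0 \<le> T" using up[of u0] u0 by (auto simp: v_def intro: order_trans[rotated])
      show thesis
      proof (cases "T = 0")
        case True
        show ?thesis
        proof (rule that[of u0])
          show "P ?i 2 u0" unfolding P_def
          proof
            fix u assume "u \<in> ?S"
            then have "?f u \<le> 0" using up[of u] True by simp
            also have "0 \<le> 2 * ?f u0" by (simp add: v_def)
            finally show "cmod (snd ?i u) * v (fst ?i) u \<le> 2 * (cmod (snd ?i u0) * v (fst ?i) u0)" by simp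
          qed
        qed (use u0 in simp)
      next
        case False
        then have "T / 2 < T" using T0 by simp
        then obtain z where z: "z \<in> ?S" "T / 2 < ?f z"
          unfolding T_def using less_cSUP_iff[OF ne bdd] by blast
        show ?thesis
        proof (rule that[of z])
          show "P ?i 2 z" unfolding P_def
          proof
            fix u assume "u \<in> ?S"
            then have "?f u \<le> T" using up[of u] by simp
            also have "T \<le> 2 * ?f z" using z(2) by simp
            finally show "cmod (snd ?i u) * v (fst ?i) u \<le> 2 * (cmod (snd ?i z) * v (fst ?i) z)" by simp
          qed
        qed (use z in simp)
      qed
    qed
    \<comment> \<open>An upper bound for \<open>\<bar>Q\<bar> v\<close> on the sphere; the witness
      for the statement is this value times \<open>real L ^ d\<close>.\<close>
    define S where "S = 2 * ?f z"
    have S0: "0 \<le> S" by (simp add: S_def v_def)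
    have S: "?f u \<le> S" if "norm u = 1" for u using z(2) that by (simp add: P_def S_def)
    have upper: "AE u in sphere_measure. u \<in> ?S \<longrightarrow> cmod (Q u) * w u \<le> K1 * (S * real L ^ d)"
    proof -
      \<comment> \<open>Each ball has its own exceptional null set in the reverse Hoelder condition,
        so balls centered at the varying point are unsuitable. A finite net is used, and doubling
        moves the center from the net point to \<open>u\<close>.\<close>
      obtain F where F: "F \<subseteq> ?S" "finite F" "?S \<subseteq> (\<Union>y\<in>F. ball y (1 / real L))"
        by (rule compactE_image[OF compact_sphere, of ?S "\<lambda>y. ball y (1 / real L)"]) (use Lr in auto)
      have "AE u in sphere_measure. \<forall>y\<in>F. u \<in> ball y (1 / real L) \<longrightarrow>
          w u \<le> C * measure N (ball y (1 / real L)) / \<sigma> (ball y (1 / real L))"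
        using W.rh_quotient F(1) Lr unfolding N_def by (subst AE_ball_countable) (auto intro: countable_finite[OF F(2)])
      then show ?thesis
      proof eventually_elim
        case (elim u)
        show ?case
        proof
          assume uS: "u \<in> ?S"
          then obtain y where y: "y \<in> F" "dist y u < 1 / real L" using F(3) by auto
          have y1: "norm y = 1" using y(1) F(1) by auto
          have u1: "norm u = 1" using uS by simp
          have "ball y (1 / real L) \<subseteq> ball u (2 * (1 / real L))"
          proof
            fix x assume "x \<in> ball y (1 / real L)"
            then show "x \<in> ball u (2 * (1 / real L))" using y(2) dist_triangle[of u x y] by (auto simp: dist_commute)
          qed
          then have "measure N (ball y (1 / real L)) \<le> measure N (ball u (2 * (1 / real L)))"
            unfolding N_def by (intro W.N_mono_borel) auto
          also have "\<dots> \<le> Dw * v L u" unfolding N_def v_def using Lr uS by (intro W.w_doubling) auto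
          finally have Ny: "measure N (ball y (1 / real L)) \<le> Dw * v L u" .
          have "a1 * (1 / real L) ^ d \<le> \<sigma> (ball y (1 / real L))"
            unfolding d_def using L by (intro a(4) y1) (auto simp: divide_le_eq)
          moreover have "0 < a1 * (1 / real L) ^ d" using a(1) Lr by simp
          ultimately have "C * measure N (ball y (1 / real L)) / \<sigma> (ball y (1 / real L))
              \<le> C * (Dw * v L u) / (a1 * (1 / real L) ^ d)"
            using Ny C0 Dw0 v_pos[OF L u1] by (intro frac_le mult_left_mono) auto
          also have "\<dots> = K1 * real L ^ d * v L u" by (simp add: K1_def power_divide)
          finally have "w u \<le> K1 * real L ^ d * v L u" using elim y by fastforce
          then have "cmod (Q u) * w u \<le> cmod (Q u) * (K1 * real L ^ d * v L u)" by (intro mult_left_mono) auto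
          also have "\<dots> = K1 * real L ^ d * ?f u" by (simp only: mult_ac)
          also have "\<dots> \<le> K1 * real L ^ d * S" using K(1) S[OF u1] by (intro mult_left_mono) auto
          finally show "cmod (Q u) * w u \<le> K1 * (S * real L ^ d)" by (simp only: mult_ac)
        qed
      qed
    qed
    \<comment> \<open>Leaves room around the cap of radius \<open>m / L\<close> for the margin
      \<open>2 * h\<close> and for the balls of radius \<open>1 / L\<close> that define
      \<open>v\<close>.\<close>
    define R where "R = (real m + 1) / real L"
    have R: "0 < R" using Lr by (simp add: R_def)
    have hm: "(64 * m :: nat) * (h ?i / 4) = real m / real L" by (simp add: h_def)
    have hR: "(64 * m :: nat) * (h ?i / 4) + 2 * h ?i \<le> R"
      unfolding hm R_def h_def using Lr by (simp add: add_divide_distrib divide_left_mono)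
    obtain B1 where B1: "B1 \<in> sets borel" "\<sigma> B1 \<le> \<delta> * \<sigma> (ball z R)"
       "\<forall>u \<in> cap z (real m / real L) - B1. P ?i \<kappa> u"
    proof -
      from spread[rule_format, OF i conjI[OF z]]
      obtain B1 where B1: "B1 \<in> sets borel" "\<sigma> B1 \<le> \<delta> * \<sigma> (ball z ((64 * m :: nat) * (h ?i / 4) + 2 * h ?i))"
        and good: "\<forall>u \<in> cap z ((64 * m :: nat) * (h ?i / 4)) - B1. P ?i \<kappa> u" by (elim bexE conjE)
      have "\<delta> * \<sigma> (ball z ((64 * m :: nat) * (h ?i / 4) + 2 * h ?i)) \<le> \<delta> * \<sigma> (ball z R)"
        using \<delta> hR by (intro mult_left_mono sm.finite_measure_mono subset_ball) auto
      then have "\<sigma> B1 \<le> \<delta> * \<sigma> (ball z R)" using B1(2) by linarith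
      then show thesis using that[OF B1(1)] good unfolding hm by blast
    qed
    \<comment> \<open>Outside this set \<open>w\<close> is at least \<epsilon> times its average
      over the single ball \<open>ball z R\<close>, and the mass of that ball dominates
      \<open>v\<close> at every point of the cap.\<close>
    define B2 where "B2 = {u \<in> ball z R. w u * \<sigma> (ball z R) < \<epsilon> * measure N (ball z R)}"
    have bR: "0 < \<sigma> (ball z R)" using z(1) R by (intro W.ball_pos) auto
    have B2: "B2 \<in> sets borel" "\<sigma> B2 \<le> \<delta> * \<sigma> (ball z R)"
    proof -
      have "B2 = {u \<in> ball z R. w u < \<epsilon> * measure N (ball z R) / \<sigma> (ball z R)}"
        unfolding B2_def using bR by (simp add: pos_less_divide_eq)
      then show "B2 \<in> sets borel" using W.sublevel_borel by simp
      show "\<sigma> B2 \<le> \<delta> * \<sigma> (ball z R)" unfolding B2_def using sub z(1) R by simp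
    qed
    define B where "B = B1 \<union> B2"
    have mB: "\<sigma> B < \<rho> * \<sigma> (cap z (r / real L))"
    proof -
      have c_sub: "sphere 0 1 \<inter> ball z (r / (4 * real L)) \<subseteq> cap z (r / real L)"
      proof
        fix u assume "u \<in> sphere 0 1 \<inter> ball z (r / (4 * real L))"
        then have u: "norm u = 1" "dist z u < r / (4 * real L)" by auto
        have "geodesic_dist z u \<le> 2 * dist z u" by (rule geodesic_le_dist[OF u(1) z(1)])
        also have "\<dots> < 2 * (r / (4 * real L))" using u(2) by simp
        also have "\<dots> \<le> r / real L" using r Lr by (simp add: field_simps)
        finally show "u \<in> cap z (r / real L)" using u(1) by (simp add: cap_def)
      qed
      have "\<sigma> (ball z R) \<le> \<sigma> (ball z (2 ^ q * (r / (4 * real L))))"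
      proof (intro sm.finite_measure_mono subset_ball)
        have "4 * (real m + 1) \<le> 2 ^ q * r" using q r by (simp add: divide_le_eq)
        then show "R \<le> 2 ^ q * (r / (4 * real L))" unfolding R_def using Lr by (simp add: divide_le_eq)
      qed auto
      also have "\<dots> \<le> D ^ q * \<sigma> (ball z (r / (4 * real L)))"
        using z(1) r Lr by (intro W.doubling_pow) auto
      also have "\<sigma> (ball z (r / (4 * real L))) = \<sigma> (ball z (r / (4 * real L)) \<inter> sphere 0 1)"
        by (rule sphere_measure_Int_sphere[symmetric]) simp
      also have "D ^ q * \<dots> \<le> D ^ q * \<sigma> (cap z (r / real L))"
        using Dq c_sub cap_borel[OF z(1)] by (intro mult_left_mono sm.finite_measure_mono) auto
      finally have RR: "\<sigma> (ball z R) \<le> D ^ q * \<sigma> (cap z (r / real L))" .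
      have cpos: "0 < \<sigma> (cap z (r / real L))"
        using RR bR Dq by (metis less_le_trans zero_less_mult_pos)
      have "\<sigma> B \<le> \<sigma> B1 + \<sigma> B2"
        unfolding B_def using B1 B2 by (intro measure_Un_le) auto
      also have "\<dots> \<le> 2 * \<delta> * \<sigma> (ball z R)" using B1 B2 by simp
      also have "\<dots> \<le> 2 * \<delta> * (D ^ q * \<sigma> (cap z (r / real L)))"
        using \<delta> RR by (intro mult_left_mono) auto
      also have "\<dots> = \<rho> / 2 * \<sigma> (cap z (r / real L))" using D0 by (simp add: \<delta>_def)
      also have "\<dots> < \<rho> * \<sigma> (cap z (r / real L))" using \<rho> cpos by simp
      finally show ?thesis .
    qed
    have lower: "K2 * (S * real L ^ d) \<le> cmod (Q u) * w u" if u: "u \<in> cap z (r / real L) - B" for u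
    proof -
      have u1: "norm u = 1" "geodesic_dist z u < r / real L" using u by (auto simp: cap_def)
      have rm: "r / real L \<le> real m / real L" using m(2) Lr by (simp add: divide_right_mono)
      have "u \<in> cap z (real m / real L) - B1" using u1 u rm by (auto simp: cap_def B_def)
      then have "P ?i \<kappa> u" using B1(3) by blast
      then have fz: "?f z \<le> \<kappa> * ?f u" using z(1) by (simp add: P_def)
      have du: "dist z u < real m / real L" using dist_le_geodesic[OF u1(1) z(1)] u1(2) rm by linarith
      have uR: "u \<in> ball z R"
        using du divide_right_mono[of "real m" "real m + 1" "real L"] Lr by (simp add: R_def)
      have "ball u (1 / real L) \<subseteq> ball z R"
      proof
        fix x assume "x \<in> ball u (1 / real L)"
        then have "dist z x < real m / real L + 1 / real L" using du dist_triangle[of z x u] by simp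
        then show "x \<in> ball z R" by (simp add: R_def add_divide_distrib)
      qed
      then have vu: "v L u \<le> measure N (ball z R)" unfolding v_def N_def by (intro W.N_mono_borel) auto
      have wu: "\<epsilon> * measure N (ball z R) \<le> w u * \<sigma> (ball z R)"
        using u uR by (auto simp: B_def B2_def)
      have "\<epsilon> * v L u \<le> \<epsilon> * measure N (ball z R)" using vu \<epsilon> by (intro mult_left_mono) auto
      also have "\<dots> \<le> w u * \<sigma> (ball z R)" by (rule wu)
      also have "\<dots> \<le> w u * (a2 * R ^ d)"
        unfolding d_def using z(1) R W.w_nonneg by (intro mult_left_mono a(3)) auto
      also have "\<dots> = w u * (a2 * (real m + 1) ^ d) / real L ^ d" by (simp add: R_def power_divide)
      finally have vw: "\<epsilon> * v L u * real L ^ d \<le> w u * (a2 * (real m + 1) ^ d)"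
        using Lr by (simp add: le_divide_eq)
      have "\<epsilon> * (?f z * real L ^ d) \<le> \<epsilon> * ((\<kappa> * ?f u) * real L ^ d)"
        using fz \<epsilon> by (intro mult_left_mono mult_right_mono) auto
      also have "\<dots> = \<kappa> * cmod (Q u) * (\<epsilon> * v L u * real L ^ d)" by (simp only: mult_ac)
      also have "\<dots> \<le> \<kappa> * cmod (Q u) * (w u * (a2 * (real m + 1) ^ d))"
        using vw \<kappa> by (intro mult_left_mono) auto
      also have "\<dots> = cmod (Q u) * w u * (\<kappa> * (a2 * (real m + 1) ^ d))" by (simp only: mult_ac)
      finally have "\<epsilon> * (?f z * real L ^ d) / (\<kappa> * (a2 * (real m + 1) ^ d)) \<le> cmod (Q u) * w u"
        using \<kappa> a(2) by (subst pos_divide_le_eq) (auto intro!: mult_pos_pos)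
      then show ?thesis by (simp add: K2_def S_def mult_ac)
    qed
    have "0 \<le> S * real L ^ d" using S0 by simp
    then show "\<exists>S\<ge>0. \<exists>z B. norm z = 1 \<and> B \<in> sets borel \<and>
      (AE u in sphere_measure. u \<in> sphere 0 1 \<longrightarrow> cmod (Q u) * w u \<le> K1 * S) \<and>
      \<sigma> B < \<rho> * \<sigma> (cap z (r / real L)) \<and>
      (\<forall>u \<in> cap z (r / real L) - B. K2 * S \<le> cmod (Q u) * w u)"
      using z(1) B1(1) B2(1) upper mB lower unfolding B_def
      by (intro exI[of _ "S * real L ^ d"] exI[of _ z] exI[of _ "B1 \<union> B2"] conjI ballI) auto
  qed
qed

section \<open>From the Borel measure back to the completed surface measure and to geodesic
  caps\<close>

lemma AE_surface_measure:
  "(AE u in surface_measure. P u) \<longleftrightarrow> (AE u :: real ^ 'n in sphere_measure. u \<in> sphere 0 1 \<longrightarrow> P u)"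
  unfolding surface_measure_eq_completion AE_completion_iff
  by (subst AE_restrict_space_iff) (auto intro: borel_closed)

lemma sets_surface_measure:
  fixes A :: "(real ^ 'n) set"
  assumes "A \<in> sets borel" "A \<subseteq> sphere 0 1"
  shows "A \<in> sets surface_measure" "measure surface_measure A = \<sigma> A"
proof -
  have A: "A \<in> sets (restrict_space sphere_measure (sphere 0 1))"
    using assms by (auto simp: sets_restrict_space)
  then show "A \<in> sets surface_measure" by (simp add: surface_measure_eq_completion)
  have "emeasure surface_measure A = emeasure (restrict_space sphere_measure (sphere 0 1)) A"
    unfolding surface_measure_eq_completion using A by simp
  also have "\<dots> = emeasure sphere_measure A"
    using assms by (intro emeasure_restrict_space) (auto intro: borel_closed)
  finally show "measure surface_measure A = \<sigma> A"
    by (simp add: Sigma_Algebra.measure_def)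
qed

lemma finite_surface_measure: "finite_measure (surface_measure :: (real ^ 'n) measure)"
proof
  have "sphere 0 1 \<in> sets (restrict_space sphere_measure (sphere 0 1 :: (real ^ 'n) set))"
    by (auto simp: sets_restrict_space)
  then have "emeasure surface_measure (sphere 0 1 :: (real ^ 'n) set) = emeasure sphere_measure (sphere 0 1 :: (real ^ 'n) set)"
    unfolding surface_measure_eq_completion
    by (simp add: emeasure_restrict_space borel_closed)
  then show "emeasure surface_measure (space (surface_measure :: (real ^ 'n) measure)) \<noteq> \<infinity>"
    by (simp add: sm.emeasure_eq_measure)
qed

text \<open>Makes the reverse Hoelder condition, given for geodesic caps, available on the caps for
  which annuli were estimated.\<close>

lemma cap_arctan:
  fixes z :: "real ^ 'n"
  assumes z: "norm z = 1" and t: "0 < t"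
  shows "cap z (arctan t) = tan_cap z t"
proof -
  have "geodesic_dist z u < arctan t \<longleftrightarrow> norm (u - (u \<bullet> z) *\<^sub>R z) < t * (u \<bullet> z)" if u: "norm u = 1" for u
  proof -
    define \<phi> where "\<phi> = geodesic_dist z u"
    have b: "0 \<le> \<phi>" "\<phi> \<le> pi" "cos \<phi> = u \<bullet> z"
      using sphere_inner_bounds[OF u z] by (auto simp: \<phi>_def geodesic_dist_def arccos_lbound arccos_ubound inner_commute)
    have "(norm (u - (u \<bullet> z) *\<^sub>R z))\<^sup>2 = (sin \<phi>)\<^sup>2"
      unfolding norm_perp_square[OF u z] using b(3) by (simp add: sin_squared_eq)
    then have s: "norm (u - (u \<bullet> z) *\<^sub>R z) = sin \<phi>"
      by (rule power2_eq_imp_eq) (use b in \<open>auto intro!: sin_ge_zero\<close>)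
    have "\<phi> < arctan t \<longleftrightarrow> sin \<phi> < t * cos \<phi>"
    proof
      assume *: "\<phi> < arctan t"
      then have p: "\<phi> < pi / 2" using arctan_ubound[of t] by linarith
      then have c: "0 < cos \<phi>" using b by (intro cos_gt_zero_pi) linarith+
      have "tan \<phi> < tan (arctan t)"
        using * b p arctan_ubound[of t] by (intro tan_monotone) linarith+
      then have "tan \<phi> < t" by (simp only: tan_arctan)
      then show "sin \<phi> < t * cos \<phi>" using c by (simp add: tan_def divide_less_eq)
    next
      assume *: "sin \<phi> < t * cos \<phi>"
      have "0 \<le> sin \<phi>" using b by (intro sin_ge_zero) auto
      then have "0 < t * cos \<phi>" using * by linarith
      then have c: "0 < cos \<phi>" using t by (rule zero_less_mult_pos)
      have p: "\<phi> < pi / 2"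
      proof (rule ccontr)
        assume "\<not> \<phi> < pi / 2"
        then have "cos \<phi> \<le> cos (pi / 2)" using b by (intro cos_monotone_0_pi_le) auto
        then show False using c by simp
      qed
      have "tan \<phi> < t" using * c by (simp add: tan_def divide_less_eq)
      then have "arctan (tan \<phi>) < arctan t" by (simp add: arctan_less_iff)
      then show "\<phi> < arctan t" using p b pi_gt_zero arctan_tan[of \<phi>] by simp
    qed
    then show ?thesis unfolding s b(3) unfolding \<phi>_def .
  qed
  then show ?thesis by (auto simp: cap_def tan_cap_def)
qed

text \<open>A chord \<open>s\<close> subtends the angle \<open>2 * arcsin (s / 2)\<close>. Beyond
  the diameter 2 the cap of radius 4 serves, as 4 exceeds pi.\<close>

lemma ball_Int_sphere_eq_cap:
  fixes z :: "real ^ 'n"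
  assumes z: "norm z = 1" and s: "0 < s"
  obtains \<delta> where "0 < \<delta>" "ball z s \<inter> sphere 0 1 = cap z \<delta>"
proof (cases "s \<le> 2")
  case False
  have "geodesic_dist z u < 4" if "norm u = 1" for u
    using sphere_inner_bounds[OF that z] arccos_ubound[of "z \<bullet> u"] pi_less_4 by (simp add: geodesic_dist_def)
  then have "ball z s \<inter> sphere 0 1 = cap z 4"
    using sphere_subset_ball[OF z, of s] False by (auto simp: cap_def)
  then show ?thesis by (intro that[of 4]) auto
next
  case True
  have as: "0 < arcsin (s / 2)" "arcsin (s / 2) \<le> pi / 2" "sin (arcsin (s / 2)) = s / 2"
    using s True arcsin_less_arcsin[of 0 "s / 2"] arcsin_ubound[of "s / 2"] by auto
  have "dist z u < s \<longleftrightarrow> geodesic_dist z u < 2 * arcsin (s / 2)" if u: "norm u = 1" for u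
  proof -
    have b: "0 \<le> geodesic_dist z u" "geodesic_dist z u \<le> pi"
      using sphere_inner_bounds[OF u z] by (auto simp: geodesic_dist_def arccos_lbound arccos_ubound)
    have "sin (geodesic_dist z u / 2) < sin (arcsin (s / 2)) \<longleftrightarrow> geodesic_dist z u / 2 < arcsin (s / 2)"
      using b as pi_gt_zero by (intro sin_mono_less_eq) linarith+
    then show ?thesis unfolding dist_eq_geodesic[OF u z] as(3) by auto
  qed
  then have "ball z s \<inter> sphere 0 1 = cap z (2 * arcsin (s / 2))" by (auto simp: cap_def)
  then show ?thesis using as(1) by (intro that[of "2 * arcsin (s / 2)"]) auto
qed

lemma measure_density_eq_integral:
  assumes w: "w \<in> borel_measurable M" "\<And>x. 0 \<le> w x" and A: "A \<in> sets M"
  shows "measure (density M (\<lambda>x. ennreal (w x))) A = (\<integral>x. indicator A x *\<^sub>R w x \<partial>M)"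
proof -
  have "emeasure (density M (\<lambda>x. ennreal (w x))) A = (\<integral>\<^sup>+x. ennreal (w x) * indicator A x \<partial>M)"
    using w A by (intro emeasure_density) auto
  also have "\<dots> = (\<integral>\<^sup>+x. ennreal (indicator A x *\<^sub>R w x) \<partial>M)"
    by (intro nn_integral_cong) (auto simp: indicator_def)
  finally have e: "emeasure (density M (\<lambda>x. ennreal (w x))) A = (\<integral>\<^sup>+x. ennreal (indicator A x *\<^sub>R w x) \<partial>M)" .
  have "(\<integral>x. indicator A x *\<^sub>R w x \<partial>M) = enn2real (\<integral>\<^sup>+x. ennreal (indicator A x *\<^sub>R w x) \<partial>M)"
    using w A by (intro integral_eq_nn_integral) (auto intro!: borel_measurable_scaleR borel_measurable_indicator)
  then show ?thesis unfolding Sigma_Algebra.measure_def e by simp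
qed

text \<open>The weight is measurable only for the completion. A Borel representative, extended by
  zero, meets the demands of the locales; multiplying the reverse Hoelder inequality out by the
  measure of the cap also covers null caps.\<close>

lemma RH_infinity_borel_version:
  fixes \<omega> :: "real ^ 'n \<Rightarrow> real"
  assumes "\<omega> \<in> RH_infinity"
  obtains w C where "w \<in> borel_measurable borel" "\<And>x. 0 \<le> w x" "\<And>x. x \<notin> sphere 0 1 \<Longrightarrow> w x = 0"
    "AE u in surface_measure. \<omega> u = w u" "integrable sphere_measure w" "1 \<le> C"
    "\<And>z \<delta>. norm z = 1 \<Longrightarrow> 0 < \<delta> \<Longrightarrow> AE u in sphere_measure. u \<in> cap z \<delta> \<longrightarrow>
        w u * \<sigma> (cap z \<delta>) \<le> C * measure (density sphere_measure (\<lambda>x. ennreal (w x))) (cap z \<delta>)"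
proof -
  let ?S = "sphere 0 1 :: (real ^ 'n) set"
  let ?R = "restrict_space sphere_measure ?S"
  have S: "?S \<inter> space sphere_measure \<in> sets sphere_measure" by (simp add: borel_closed)
  from assms obtain C0 where int: "integrable surface_measure \<omega>" and nn: "\<forall>u \<in> ?S. 0 \<le> \<omega> u" and C0: "0 < C0"
    and rh: "\<forall>z \<in> ?S. \<forall>\<delta> > 0. AE u in surface_measure. u \<in> cap z \<delta> \<longrightarrow>
        \<omega> u \<le> C0 / measure surface_measure (cap z \<delta>) * (LINT v:cap z \<delta>|surface_measure. \<omega> v)"
    unfolding RH_infinity_def by blast
  have "\<omega> \<in> borel_measurable (completion ?R)"
    using int by (simp add: surface_measure_eq_completion[symmetric])
  from completion_ex_borel_measurable_real[OF this]
  obtain g where g: "g \<in> borel_measurable ?R" "AE x in ?R. \<omega> x = g x" by blast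
  \<comment> \<open>The representative may be negative on a null set; the maximum with 0 repairs
    this and changes nothing where it equals \<omega>, which is nonnegative on the sphere.\<close>
  define w where "w x = max 0 (indicator ?S x *\<^sub>R g x)" for x
  have "(\<lambda>x. indicator ?S x *\<^sub>R g x) \<in> borel_measurable sphere_measure"
    using g(1) borel_measurable_restrict_space_iff[OF S, of g] by blast
  then have w_sm: "w \<in> borel_measurable sphere_measure" unfolding w_def by measurable
  then have w_borel: "w \<in> borel_measurable borel"
    by (subst (asm) measurable_cong_sets[OF sets_sphere_measure refl])
  have w0: "0 \<le> w x" for x by (simp add: w_def)
  have w_out: "w x = 0" if "x \<notin> ?S" for x using that by (simp add: w_def)
  have "AE x in sphere_measure. x \<in> ?S \<longrightarrow> \<omega> x = g x"
    using g(2) by (subst (asm) AE_restrict_space_iff[OF S])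
  then have "AE x in sphere_measure. x \<in> ?S \<longrightarrow> \<omega> x = w x"
  proof eventually_elim
    case (elim x)
    show ?case
    proof
      assume x: "x \<in> ?S"
      then have "0 \<le> \<omega> x" using nn by blast
      then show "\<omega> x = w x" using elim x by (simp add: w_def)
    qed
  qed
  then have eq: "AE x in surface_measure. \<omega> x = w x" by (simp only: AE_surface_measure)
  have w_R: "w \<in> borel_measurable ?R" using w_sm by (rule measurable_restrict_space1)
  have w_sf: "w \<in> borel_measurable surface_measure"
    unfolding surface_measure_eq_completion using w_R by (rule measurable_completion)
  have ind: "(\<lambda>x. indicator ?S x *\<^sub>R w x) = w"
  proof
    show "indicator ?S x *\<^sub>R w x = w x" for x by (cases "x \<in> ?S") (simp_all add: w_out)
  qed
  have "integrable surface_measure w"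
    by (rule integrable_cong_AE_imp[OF int w_sf eq])
  then have "integrable ?R w" unfolding surface_measure_eq_completion using w_R by (simp add: integrable_completion)
  then have w_int: "integrable sphere_measure w" by (simp only: integrable_restrict_space[OF S] ind)
  let ?N = "density sphere_measure (\<lambda>x. ennreal (w x))"
  have integral: "(LINT v:A|surface_measure. \<omega> v) = measure ?N A" if A: "A \<in> sets borel" "A \<subseteq> ?S" for A
  proof -
    have indA: "(\<lambda>x. indicator A x :: real) \<in> borel_measurable sphere_measure"
      using A by (intro borel_measurable_indicator) simp
    have iw: "(\<lambda>x. indicator A x *\<^sub>R w x) \<in> borel_measurable sphere_measure"
      by (intro borel_measurable_scaleR indA w_sm)
    have iw': "(\<lambda>x. indicator A x *\<^sub>R w x) \<in> borel_measurable ?R" using iw by (rule measurable_restrict_space1)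
    have "(LINT v:A|surface_measure. \<omega> v) = (\<integral>v. indicator A v *\<^sub>R w v \<partial>surface_measure)"
      unfolding set_lebesgue_integral_def
    proof (rule integral_cong_AE)
      show "(\<lambda>v. indicator A v *\<^sub>R \<omega> v) \<in> borel_measurable surface_measure"
        using sets_surface_measure(1)[OF A] int by (intro borel_measurable_scaleR borel_measurable_indicator) auto
      show "(\<lambda>v. indicator A v *\<^sub>R w v) \<in> borel_measurable surface_measure"
        using sets_surface_measure(1)[OF A] w_sf by (intro borel_measurable_scaleR borel_measurable_indicator) auto
      show "AE v in surface_measure. indicator A v *\<^sub>R \<omega> v = indicator A v *\<^sub>R w v"
        using eq by eventually_elim simp
    qed
    also have "\<dots> = (\<integral>v. indicator A v *\<^sub>R w v \<partial>?R)"
      unfolding surface_measure_eq_completion by (rule integral_completion[OF iw'])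
    also have "\<dots> = (\<integral>v. indicator ?S v *\<^sub>R (indicator A v *\<^sub>R w v) \<partial>sphere_measure)"
      by (rule integral_restrict_space[OF S])
    also have "\<dots> = (\<integral>v. indicator A v *\<^sub>R w v \<partial>sphere_measure)"
    proof (rule Bochner_Integration.integral_cong[OF refl])
      show "indicator ?S v *\<^sub>R (indicator A v *\<^sub>R w v) = indicator A v *\<^sub>R w v" for v
        by (cases "v \<in> ?S") (simp_all add: w_out)
    qed
    also have "\<dots> = measure ?N A"
      using A by (intro measure_density_eq_integral[symmetric] w_sm w0) simp
    finally show ?thesis .
  qed
  define C where "C = max 1 C0"
  have rh': "AE u in sphere_measure. u \<in> cap z \<delta> \<longrightarrow> w u * \<sigma> (cap z \<delta>) \<le> C * measure ?N (cap z \<delta>)"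
    if z: "norm z = 1" and \<delta>: "0 < \<delta>" for z \<delta>
  proof -
    have cb: "cap z \<delta> \<in> sets borel" "cap z \<delta> \<subseteq> ?S" using cap_borel[OF z] by (auto simp: cap_def)
    have "AE u in surface_measure. u \<in> cap z \<delta> \<longrightarrow>
        \<omega> u \<le> C0 / \<sigma> (cap z \<delta>) * measure ?N (cap z \<delta>)"
      using rh[rule_format, of z \<delta>] z \<delta> unfolding integral[OF cb] sets_surface_measure(2)[OF cb] by simp
    then have "AE u in surface_measure. u \<in> cap z \<delta> \<longrightarrow>
        w u \<le> C0 / \<sigma> (cap z \<delta>) * measure ?N (cap z \<delta>)"
      using eq by eventually_elim simp
    then have "AE u in sphere_measure. u \<in> ?S \<longrightarrow> u \<in> cap z \<delta> \<longrightarrow>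
        w u \<le> C0 / \<sigma> (cap z \<delta>) * measure ?N (cap z \<delta>)"
      by (simp only: AE_surface_measure)
    then show ?thesis
    proof eventually_elim
      case (elim u)
      show ?case
      proof
        assume u: "u \<in> cap z \<delta>"
        then have le: "w u \<le> C0 / \<sigma> (cap z \<delta>) * measure ?N (cap z \<delta>)" using elim cb(2) by blast
        show "w u * \<sigma> (cap z \<delta>) \<le> C * measure ?N (cap z \<delta>)"
        proof (cases "\<sigma> (cap z \<delta>) = 0")
          case True
          then show ?thesis by (simp add: C_def)
        next
          case False
          then have pos: "0 < \<sigma> (cap z \<delta>)" by (simp add: zero_less_measure_iff)
          from le have "w u * \<sigma> (cap z \<delta>) \<le> C0 * measure ?N (cap z \<delta>)"
            using pos by (simp add: field_simps)
          also have "\<dots> \<le> C * measure ?N (cap z \<delta>)" by (intro mult_right_mono) (auto simp: C_def)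
          finally show ?thesis .
        qed
      qed
    qed
  qed
  show ?thesis
    by (rule that[OF w_borel w0 w_out eq w_int _ rh']) (simp_all add: C_def)
qed

lemma RH_infinity_sampling:
  fixes \<omega> :: "real ^ 'n \<Rightarrow> real" and r \<rho> :: real
  assumes n: "2 \<le> CARD('n)" and \<omega>: "\<omega> \<in> RH_infinity" and r: "0 < r" and \<rho>: "0 < \<rho>"
  shows "\<exists>K1>0. \<exists>K2>0. \<forall>L\<ge>1. \<forall>Q\<in>spherical_polys L. \<exists>S\<ge>0. \<exists>z B. norm z = 1 \<and> B \<in> sets borel \<and> B \<subseteq> sphere 0 1 \<and>
    (AE u in surface_measure. cmod (Q u) * \<omega> u \<le> K1 * S) \<and>
    measure surface_measure B < \<rho> * measure surface_measure (cap z (r / real L)) \<and>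
    (AE u in surface_measure. u \<in> cap z (r / real L) - B \<longrightarrow> K2 * S \<le> cmod (Q u) * \<omega> u)"
proof -
  obtain w C where w: "w \<in> borel_measurable borel" "\<And>x. 0 \<le> w x" "\<And>x. x \<notin> sphere 0 1 \<Longrightarrow> w x = 0"
    and eq: "AE u in surface_measure. \<omega> u = w u" and int: "integrable sphere_measure w" and C: "1 \<le> C"
    and rh: "\<And>z \<delta>. norm z = 1 \<Longrightarrow> 0 < \<delta> \<Longrightarrow> AE u in sphere_measure. u \<in> cap z \<delta> \<longrightarrow>
        w u * \<sigma> (cap z \<delta>) \<le> C * measure (density sphere_measure (\<lambda>x. ennreal (w x))) (cap z \<delta>)"
    using RH_infinity_borel_version[OF \<omega>] by blast
  define N where "N = density sphere_measure (\<lambda>x. ennreal (w x))"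
  have capS: "cap z \<delta> \<subseteq> sphere 0 1" for z :: "real ^ 'n" and \<delta> by (auto simp: cap_def)
  have cap_m: "measure surface_measure (cap z \<delta>) = \<sigma> (cap z \<delta>)" if "norm z = 1" for z :: "real ^ 'n" and \<delta>
    by (rule sets_surface_measure(2)[OF cap_borel[OF that] capS])
  have "\<exists>K1>0. \<exists>K2>0. \<forall>L\<ge>1. \<forall>Q\<in>spherical_polys L. \<exists>S\<ge>0. \<exists>z B. norm z = 1 \<and> B \<in> sets borel \<and>
    (AE u in sphere_measure. u \<in> sphere 0 1 \<longrightarrow> cmod (Q u) * w u \<le> K1 * S) \<and>
    \<sigma> B < \<rho> * \<sigma> (cap z (r / real L)) \<and>
    (\<forall>u \<in> cap z (r / real L) - B. K2 * S \<le> cmod (Q u) * w u)"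
  proof -
    obtain D where D: "doubling_measure sphere_measure (sphere 0 1 :: (real ^ 'n) set) D"
      using sphere_measure_doubling by blast
    interpret W: weighted_doubling_measure "sphere_measure :: (real ^ 'n) measure" "sphere 0 1" D w C
      by (intro weighted_doubling_measure.intro D weighted_doubling_measure_axioms.intro w int C)
    have NW: "N = W.wM" by (simp add: N_def W.wM_def)
    have finN: "finite_measure N" unfolding NW by (rule W.finite_wM)
    have sets_N: "sets N = sets borel" unfolding NW by (rule W.sets_wM)
    have rh_tan: "AE u in sphere_measure. u \<in> tan_cap z t \<longrightarrow> w u * \<sigma> (tan_cap z t) \<le> C * measure N (tan_cap z t)"
      if z: "norm z = 1" and t: "0 < t" "t \<le> 1" for z t
      using rh[OF z, of "arctan t"] t unfolding cap_arctan[OF z t(1)] N_def by simp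
    show ?thesis
    \<comment> \<open>A weight that vanishes almost everywhere has no positive balls; then
      \<open>S = 0\<close> and \<open>B = {}\<close> work, since caps have positive measure.\<close>
    proof (cases "measure N UNIV = 0")
      case True
      have "emeasure N UNIV = 0" using True finite_measure.emeasure_eq_measure[OF finN, of UNIV] by simp
      then have "(\<integral>\<^sup>+x. ennreal (w x) \<partial>sphere_measure) = 0"
        unfolding N_def using W.w_measurable by (subst (asm) emeasure_density) auto
      then have "AE x in sphere_measure. ennreal (w x) = 0"
        using W.w_measurable by (subst (asm) nn_integral_0_iff_AE) auto
      then have w_zero: "AE x in sphere_measure. w x = 0"
        by eventually_elim (use w(2) in \<open>auto simp: ennreal_eq_0_iff intro: antisym\<close>)
      obtain z :: "real ^ 'n" where z: "norm z = 1" using vector_choose_size[of 1] by auto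
      have cpos: "0 < \<sigma> (cap z (r / real L))" if L: "1 \<le> L" for L :: nat
      proof -
        define s where "s = r / (2 * real L)"
        have s: "0 < s" using r L by (simp add: s_def)
        have "0 < \<sigma> (ball z s)" using z s by (intro W.ball_pos) auto
        also have "\<dots> = \<sigma> (ball z s \<inter> sphere 0 1)" by (simp add: sphere_measure_Int_sphere)
        also have "\<dots> \<le> \<sigma> (cap z (r / real L))"
        proof (rule sm.finite_measure_mono)
          show "ball z s \<inter> sphere 0 1 \<subseteq> cap z (r / real L)"
          proof
            fix u assume "u \<in> ball z s \<inter> sphere 0 1"
            then have u: "norm u = 1" "dist z u < s" by auto
            have "geodesic_dist z u < r / real L"
              using geodesic_le_dist[OF u(1) z] u(2) by (simp add: s_def)
            then show "u \<in> cap z (r / real L)" using u(1) by (simp add: cap_def)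
          qed
        qed (simp add: cap_borel[OF z])
        finally show ?thesis .
      qed
      show ?thesis
      proof (rule exI[of _ 1], rule conjI, simp, rule exI[of _ 1], rule conjI, simp, intro allI impI ballI)
        fix L :: nat and Q :: "real ^ 'n \<Rightarrow> complex" assume L: "1 \<le> L"
        have "AE u in sphere_measure. u \<in> sphere 0 1 \<longrightarrow> cmod (Q u) * w u \<le> 1 * 0"
          using w_zero by eventually_elim simp
        then show "\<exists>S\<ge>0. \<exists>z B. norm z = 1 \<and> B \<in> sets borel \<and>
          (AE u in sphere_measure. u \<in> sphere 0 1 \<longrightarrow> cmod (Q u) * w u \<le> 1 * S) \<and>
          \<sigma> B < \<rho> * \<sigma> (cap z (r / real L)) \<and>
          (\<forall>u \<in> cap z (r / real L) - B. 1 * S \<le> cmod (Q u) * w u)"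
          using z cpos[OF L] \<rho> w(2) by (intro exI[of _ 0] exI[of _ z] exI[of _ "{}"] conjI) auto
      qed
    next
      case False
      then have pos: "0 < measure N UNIV" by (simp add: zero_less_measure_iff)
      obtain D0 where D0: "1 \<le> D0" and loc: "\<forall>z s. norm z = 1 \<and> 0 < s \<and> s \<le> 1 / 8 \<longrightarrow> measure N (ball z (2 * s)) \<le> D0 * measure N (ball z s)"
        using weight_local_doubling[OF w(1,2) finN[unfolded N_def] C rh_tan[unfolded N_def]] unfolding N_def by blast
      have out: "measure N (- sphere 0 1) = 0"
      proof -
        have "measure N (- sphere 0 1) \<le> 0 * \<sigma> (- sphere 0 1 :: (real ^ 'n) set)"
          unfolding NW using w(3) by (intro W.N_le AE_I2) (auto simp: borel_closed)
        then show ?thesis using measure_nonneg[of N "- sphere 0 1"] by linarith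
      qed
      have loc': "measure N (ball z (2 * s)) \<le> D0 * measure N (ball z s)" if "norm z = 1" "0 < s" "s \<le> 1 / 8" for z s
        using loc that by blast
      obtain Dw where Dw: "1 \<le> Dw" "\<forall>z s. norm z = 1 \<and> 0 < s \<longrightarrow> measure N (ball z (2 * s)) \<le> Dw * measure N (ball z s)"
        using doubling_of_local(1)[OF n finN sets_N out pos D0 loc'] by blast
      have Npos: "0 < measure N (ball z s)" if "norm z = 1" "0 < s" for z s
        by (rule doubling_of_local(2)[OF n finN sets_N out pos D0 loc' that])
      have "rh_weight sphere_measure (sphere 0 1) D w C Dw"
      proof (intro rh_weight.intro rh_weight_axioms.intro W.weighted_doubling_measure_axioms)
        fix z :: "real ^ 'n" and s :: real assume "z \<in> sphere 0 1" and s: "0 < s"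
        then have z: "norm z = 1" by simp
        show "measure W.wM (ball z (2 * s)) \<le> Dw * measure W.wM (ball z s)"
          using Dw(2) z s unfolding NW by blast
        obtain \<delta> where \<delta>: "0 < \<delta>" "ball z s \<inter> sphere 0 1 = cap z \<delta>" by (rule ball_Int_sphere_eq_cap[OF z s])
        have e: "\<sigma> (cap z \<delta>) = \<sigma> (ball z s)"
          unfolding \<delta>(2)[symmetric] by (rule sphere_measure_Int_sphere) simp
        have le: "measure N (cap z \<delta>) \<le> measure W.wM (ball z s)"
          unfolding NW \<delta>(2)[symmetric] by (intro W.N_mono_borel) auto
        show "AE u in sphere_measure. u \<in> ball z s \<longrightarrow> w u * \<sigma> (ball z s) \<le> C * measure W.wM (ball z s)"
          using rh[OF z \<delta>(1)]
        proof eventually_elim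
          case (elim u)
          show ?case
          proof
            assume u: "u \<in> ball z s"
            show "w u * \<sigma> (ball z s) \<le> C * measure W.wM (ball z s)"
            proof (cases "u \<in> sphere 0 1")
              case True
              then have "u \<in> cap z \<delta>" using u \<delta>(2) by blast
              then have "w u * \<sigma> (ball z s) \<le> C * measure N (cap z \<delta>)"
                using elim e by (simp add: N_def)
              also have "\<dots> \<le> C * measure W.wM (ball z s)" using le C by (intro mult_left_mono) auto
              finally show ?thesis .
            next
              case False
              then show ?thesis using w(3) C by simp
            qed
          qed
        qed
      qed (rule Dw(1))
      then show ?thesis
        by (rule rh_sampling[OF n _ _ r \<rho>]) (use Npos in \<open>simp add: N_def\<close>)
    qed
  qed
  then obtain K1 K2 where K: "0 < K1" "0 < K2" and main: "\<forall>L\<ge>1. \<forall>Q\<in>spherical_polys L. \<exists>S\<ge>0. \<exists>z B. norm z = 1 \<and> B \<in> sets borel \<and>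
    (AE u in sphere_measure. u \<in> sphere 0 1 \<longrightarrow> cmod (Q u) * w u \<le> K1 * S) \<and>
    \<sigma> B < \<rho> * \<sigma> (cap z (r / real L)) \<and>
    (\<forall>u \<in> cap z (r / real L) - B. K2 * S \<le> cmod (Q u) * w u)" by blast
  show ?thesis
  proof (rule exI[of _ K1], rule conjI, rule K(1), rule exI[of _ K2], rule conjI, rule K(2), intro allI impI ballI)
    fix L :: nat and Q :: "real ^ 'n \<Rightarrow> complex" assume LQ: "1 \<le> L" "Q \<in> spherical_polys L"
    from main[rule_format, OF LQ] obtain S z B where S: "0 \<le> S" and z: "norm z = 1" and B: "B \<in> sets borel"
      and up: "AE u in sphere_measure. u \<in> sphere 0 1 \<longrightarrow> cmod (Q u) * w u \<le> K1 * S"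
      and mB: "\<sigma> B < \<rho> * \<sigma> (cap z (r / real L))"
      and low: "\<forall>u \<in> cap z (r / real L) - B. K2 * S \<le> cmod (Q u) * w u" by (elim exE conjE)
    have BS: "B \<inter> sphere 0 1 \<in> sets borel" "B \<inter> sphere 0 1 \<subseteq> sphere 0 1" using B by (auto simp: borel_closed)
    have "AE u in surface_measure. cmod (Q u) * w u \<le> K1 * S" unfolding AE_surface_measure by (rule up)
    then have "AE u in surface_measure. cmod (Q u) * \<omega> u \<le> K1 * S" using eq by eventually_elim simp
    moreover have "measure surface_measure (B \<inter> sphere 0 1) < \<rho> * measure surface_measure (cap z (r / real L))"
      unfolding sets_surface_measure(2)[OF BS] cap_m[OF z] sphere_measure_Int_sphere[OF B] by (rule mB)
    moreover have "AE u in surface_measure. u \<in> cap z (r / real L) - B \<inter> sphere 0 1 \<longrightarrow> K2 * S \<le> cmod (Q u) * \<omega> u"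
      using eq
    proof eventually_elim
      case (elim u)
      show ?case
      proof
        assume "u \<in> cap z (r / real L) - B \<inter> sphere 0 1"
        then have "u \<in> cap z (r / real L) - B" using capS by blast
        then have "K2 * S \<le> cmod (Q u) * w u" using low by blast
        then show "K2 * S \<le> cmod (Q u) * \<omega> u" using elim by simp
      qed
    qed
    ultimately show "\<exists>S\<ge>0. \<exists>z B. norm z = 1 \<and> B \<in> sets borel \<and> B \<subseteq> sphere 0 1 \<and>
      (AE u in surface_measure. cmod (Q u) * \<omega> u \<le> K1 * S) \<and>
      measure surface_measure B < \<rho> * measure surface_measure (cap z (r / real L)) \<and>
      (AE u in surface_measure. u \<in> cap z (r / real L) - B \<longrightarrow> K2 * S \<le> cmod (Q u) * \<omega> u)"
      using S z BS by blast
  qed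
qed

theorem corollary3p3:
  fixes d :: nat
    and E :: "nat \<Rightarrow> (real ^ 'n) set"
    and \<omega> :: "real ^ 'n \<Rightarrow> real"
  assumes "d \<ge> 1" and "CARD('n) = d + 1"
    and "\<And>L. L \<ge> 1 \<Longrightarrow> E L \<in> sets surface_measure"
    and "relatively_dense E"
    and "\<omega> \<in> RH_infinity"
  shows "\<exists>C > 0. \<forall>L \<ge> 1. \<forall>Q \<in> spherical_polys L.
    weighted_sup (sphere 0 1) Q \<omega> \<le> ereal C * weighted_sup (E L) Q \<omega>"
proof -
  have n: "2 \<le> CARD('n)" using assms(1,2) by simp
  from assms(4) obtain r \<rho> where r: "0 < r" and \<rho>: "0 < \<rho>" and dense: "\<forall>L \<ge> 1.
     (INF u \<in> sphere 0 1. measure surface_measure (E L \<inter> cap u (r / real L)) /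
                          measure surface_measure (cap u (r / real L))) \<ge> \<rho>"
    unfolding relatively_dense_def by blast
  from RH_infinity_sampling[OF n assms(5) r \<rho>]
  obtain K1 K2 where K: "0 < K1" "0 < K2" and main: "\<forall>L\<ge>1. \<forall>Q\<in>spherical_polys L. \<exists>S\<ge>0. \<exists>z B. norm z = 1 \<and> B \<in> sets borel \<and> B \<subseteq> sphere 0 1 \<and>
    (AE u in surface_measure. cmod (Q u) * \<omega> u \<le> K1 * S) \<and>
    measure surface_measure B < \<rho> * measure surface_measure (cap z (r / real L)) \<and>
    (AE u in surface_measure. u \<in> cap z (r / real L) - B \<longrightarrow> K2 * S \<le> cmod (Q u) * \<omega> u)" by blast
  interpret sf: finite_measure "surface_measure :: (real ^ 'n) measure" by (rule finite_surface_measure)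
  show ?thesis
  \<comment> \<open>The whole sphere is bounded by \<open>K1 * S\<close> and the set
    \<open>E L\<close> reaches \<open>K2 * S\<close>.\<close>
  proof (intro exI[of _ "K1 / K2"] conjI allI impI ballI)
    show "0 < K1 / K2" using K by simp
    fix L :: nat and Q :: "real ^ 'n \<Rightarrow> complex" assume LQ: "1 \<le> L" "Q \<in> spherical_polys L"
    from main[rule_format, OF LQ] obtain S z B where S: "0 \<le> S" and z: "norm z = 1"
      and B: "B \<in> sets borel" "B \<subseteq> sphere 0 1"
      and up: "AE u in surface_measure. cmod (Q u) * \<omega> u \<le> K1 * S"
      and mB: "measure surface_measure B < \<rho> * measure surface_measure (cap z (r / real L))"
      and low: "AE u in surface_measure. u \<in> cap z (r / real L) - B \<longrightarrow> K2 * S \<le> cmod (Q u) * \<omega> u" by (elim exE conjE)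
    let ?f = "\<lambda>u. ereal (cmod (Q u) * \<omega> u)"
    have S_sets: "(sphere 0 1 :: (real ^ 'n) set) \<in> sets surface_measure"
      by (rule sets_surface_measure(1)) (auto simp: borel_closed)
    have Q: "Q \<in> borel_measurable surface_measure"
    proof -
      have "Q \<in> borel_measurable (restrict_space borel (sphere 0 1))"
        by (rule borel_measurable_continuous_on_restrict[OF continuous_on_spherical_poly[OF LQ(2)]])
      moreover have "sets (restrict_space borel (sphere 0 1)) = sets (restrict_space sphere_measure (sphere 0 1 :: (real ^ 'n) set))"
        by (simp add: sets_restrict_space)
      ultimately have "Q \<in> borel_measurable (restrict_space sphere_measure (sphere 0 1))"
        using measurable_cong_sets by blast
      then show ?thesis unfolding surface_measure_eq_completion by (rule measurable_completion)
    qed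
    have "\<omega> \<in> borel_measurable surface_measure"
      using assms(5) by (auto simp: RH_infinity_def)
    with measurable_compose[OF Q borel_measurable_norm]
    \<comment> \<open>The essential supremum of a nonmeasurable function is \<open>top\<close> by
      definition, so the upper bound rests on this.\<close>
    have f: "?f \<in> borel_measurable surface_measure"
      by (intro borel_measurable_ereal borel_measurable_times)
    have upper: "weighted_sup (sphere 0 1) Q \<omega> \<le> ereal (K1 * S)"
      unfolding weighted_sup_def
    proof (rule esssup_I)
      show "?f \<in> borel_measurable (restrict_space surface_measure (sphere 0 1))"
        by (rule measurable_restrict_space1[OF f])
      show "AE u in restrict_space surface_measure (sphere 0 1). ?f u \<le> ereal (K1 * S)"
        by (subst AE_restrict_space_iff) (use up S_sets in auto)
    qed
    \<comment> \<open>Otherwise almost every point of \<open>E L\<close> in the cap around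
      \<open>z\<close> would lie in \<open>B\<close>, which is smaller than the share \<rho> that
      \<open>E L\<close> has of every such cap.\<close>
    have lower: "ereal (K2 * S) \<le> weighted_sup (E L) Q \<omega>"
    proof (rule ccontr)
      assume "\<not> ereal (K2 * S) \<le> weighted_sup (E L) Q \<omega>"
      then have lt: "weighted_sup (E L) Q \<omega> < ereal (K2 * S)" by simp
      have EL: "E L \<in> sets surface_measure" by (rule assms(3)[OF LQ(1)])
      then have EL': "E L \<inter> space surface_measure \<in> sets surface_measure" by (simp only: sets.Int_space_eq2)
      have "AE u in restrict_space surface_measure (E L). ?f u \<le> weighted_sup (E L) Q \<omega>"
        unfolding weighted_sup_def by (rule esssup_AE)
      then have "AE u in surface_measure. u \<in> E L \<longrightarrow> ?f u \<le> weighted_sup (E L) Q \<omega>"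
        by (simp only: AE_restrict_space_iff[OF EL'])
      then have "AE u in surface_measure. u \<in> E L \<inter> cap z (r / real L) \<longrightarrow> u \<in> B"
        using low
      proof eventually_elim
        case (elim u)
        show ?case
        proof
          assume u: "u \<in> E L \<inter> cap z (r / real L)"
          show "u \<in> B"
          proof (rule ccontr)
            assume "u \<notin> B"
            then have "ereal (K2 * S) \<le> ?f u" using elim u by simp
            also have "?f u \<le> weighted_sup (E L) Q \<omega>" using elim u by simp
            finally show False using lt by simp
          qed
        qed
      qed
      then have "measure surface_measure (E L \<inter> cap z (r / real L)) \<le> measure surface_measure B"
        by (rule sf.finite_measure_mono_AE) (rule sets_surface_measure(1)[OF B])
      also have "\<dots> < \<rho> * measure surface_measure (cap z (r / real L))" by (rule mB)
      finally have less: "measure surface_measure (E L \<inter> cap z (r / real L)) < \<rho> * measure surface_measure (cap z (r / real L))" .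
      then have "0 < \<rho> * measure surface_measure (cap z (r / real L))"
        by (rule order.strict_trans1[OF measure_nonneg])
      then have cpos: "0 < measure surface_measure (cap z (r / real L))" using \<rho> by (rule zero_less_mult_pos)
      let ?q = "\<lambda>u. measure surface_measure (E L \<inter> cap u (r / real L)) / measure surface_measure (cap u (r / real L))"
      have "\<rho> \<le> (INF u \<in> sphere 0 1. ?q u)" using dense LQ(1) by blast
      also have "\<dots> \<le> ?q z"
        \<comment> \<open>The infimum is taken in the reals, so the lower bound 0 of the quotients
          has to be supplied.\<close>
        by (rule cINF_lower) (use z in \<open>auto intro!: bdd_belowI2[of _ 0]\<close>)
      finally show False using less cpos by (simp add: le_divide_eq)
    qed
    have "ereal (K1 * S) = ereal (K1 / K2) * ereal (K2 * S)" using K by simp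
    also have "\<dots> \<le> ereal (K1 / K2) * weighted_sup (E L) Q \<omega>"
      using K by (intro ereal_mult_left_mono lower) simp
    finally show "weighted_sup (sphere 0 1) Q \<omega> \<le> ereal (K1 / K2) * weighted_sup (E L) Q \<omega>"
      using upper by (rule order_trans[rotated])
  qed
qed

end
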